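(* Let $G$ be an ample groupoid. Suppose that $G^{(0)}$ is compact and $G$ is minimal. Then the following are equivalent: (1) $C_r^*(G)$ admits a faithful tracial state. (2) $C_r^*(G)$ is stably finite. (3) Every clopen subset of $G^{(0)}$ is completely $G^a$-non-paradoxical. (4) There exists a faithful state $\varphi:S(G,G^a)\to[0,\infty)$ with $\varphi([G^{(0)}])=1$.
   Context: Groupoids are locally compact Hausdorff with continuous product and inversion; $G^{(0)}$ is the unit space, $r(g)=gg^{-1}$, $d(g)=g^{-1}g$. $G$ is étale if $r,d$ are local homeomorphisms. A bisection is a subset $S\subseteq G$ such that $r|_S$ and $d|_S$ are homeomorphisms onto open subsets of $G$. An étale groupoid is ample if it has a basis of compact open bisections; $G^a$ is the set of compact open bisections. $D\subseteq G^{(0)}$ is invariant if $d(g)\in D$ implies $r(g)\in D$. $G$ is minimal if $G^{(0)}$ has no proper non-trivial closed invariant subsets. $C_r^*(G)$ is the reduced groupoid $C^*$-algebra. A unital $C^*$-algebra $A$ is stably finite if for every $n$ the unit of $M_n(A)$ is not Murray–von Neumann equivalent to a proper subprojection. For integers $k>l>0$, a non-empty subset $A\subseteq G^{(0)}$ is $(G^a,k,l)$-paradoxical if for each $1\le i\le k$ there are $n_i\in\mathbb{N}$, bisections $V_{i,1},\dots,V_{i,n_i}\in G^a$ and $m_{i,1},\dots,m_{i,n_i}\in\{1,\dots,l\}$ such that $\bigcup_{j=1}^{n_i}d(V_{i,j})=A$ for all $i$, and the sets $r(V_{i,j})\times\{m_{i,j}\}\subseteq A\times\{1,\dots,l\}$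 are pairwise disjoint. $A$ is completely $G^a$-non-paradoxical if it fails to be $(G^a,k,l)$-paradoxical for all integers $k>l>0$. Type semigroup: on the set of all $\bigcup_{i=1}^nA_i\times\{i\}$ with $n\in\mathbb{N}$ and $A_i\subseteq G^{(0)}$ compact open, define $A=\bigcup_{i=1}^nA_i\times\{i\}\sim B=\bigcup_{j=1}^mB_j\times\{j\}$ if there are $l\in\mathbb{N}$, $W_1,\dots,W_l\in G^a$ and $n_1,\dots,n_l,m_1,\dots,m_l\in\mathbb{N}$ with $A=\bigsqcup_{k=1}^ld(W_k)\times\{n_k\}$ and $B=\bigsqcup_{k=1}^lr(W_k)\times\{m_k\}$. This is an equivalence relation, and $S(G,G^a)$ is the set of classes $[\cdot]$ with addition $[\bigcup_{i=1}^nA_i\times\{i\}]+[\bigcup_{j=1}^mB_j\times\{j\}]=[\bigcup_{i=1}^nA_i\times\{i\}\cup\bigcup_{j=1}^mB_j\times\{n+j\}]$, neutral element $0=[\emptyset]$, and the algebraic preorder ($x\le y$ iff $y=x+z$ for some $z$). For $A\subseteq G^{(0)}$ compact open, $[A]$ denotes the class of $A\times\{1\}$. A state on a preordered abelian monoid $S$ is an additive, order preserving map $\varphi:S\to[0,\infty]$ with $\varphi(0)=0$; it is faithful if $\varphi(x)=0$ implies $x=0$. *)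

theory Defs
  imports "HOL-Analysis.Analysis"
begin

section \<open>Topological groupoids\<close>

text \<open>The arrows form a whole type \<^typ>\<open>'g\<close>; the product \<^term>\<open>gmult G g h\<close> is meaningful only for
  \<open>(g, h) \<in> composable G\<close>.\<close>

record 'g groupoid =
  composable :: "('g \<times> 'g) set"
  gmult :: "'g \<Rightarrow> 'g \<Rightarrow> 'g"
  ginv :: "'g \<Rightarrow> 'g"

definition rng :: "'g groupoid \<Rightarrow> 'g \<Rightarrow> 'g" where
  "rng G g = gmult G g (ginv G g)"

definition src :: "'g groupoid \<Rightarrow> 'g \<Rightarrow> 'g" where
  "src G g = gmult G (ginv G g) g"

definition unit_space :: "'g groupoid \<Rightarrow> 'g set" where
  "unit_space G = range (rng G)"

text \<open>Renault's axioms. They imply that \<open>(g, h)\<close> is composable iff \<open>src G g = rng G h\<close>.\<close>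

locale groupoid =
  fixes G :: "'g groupoid"
  assumes inv_inv: "ginv G (ginv G g) = g"
    and composable_left: "(g, h) \<in> composable G \<Longrightarrow> (h, k) \<in> composable G
      \<Longrightarrow> (gmult G g h, k) \<in> composable G"
    and composable_right: "(g, h) \<in> composable G \<Longrightarrow> (h, k) \<in> composable G
      \<Longrightarrow> (g, gmult G h k) \<in> composable G"
    and assoc: "(g, h) \<in> composable G \<Longrightarrow> (h, k) \<in> composable G
      \<Longrightarrow> gmult G (gmult G g h) k = gmult G g (gmult G h k)"
    and composable_inv_left: "(ginv G g, g) \<in> composable G"
    and inv_cancel_left: "(g, h) \<in> composable G \<Longrightarrow> gmult G (ginv G g) (gmult G g h) = h"
    and composable_inv_right: "(g, ginv G g) \<in> composable G"
    and inv_cancel_right: "(h, g) \<in> composable G \<Longrightarrow> gmult G (gmult G h g) (ginv G g) = h"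

locale lch_groupoid = groupoid G for G :: "('g::t2_space) groupoid" +
  assumes locally_compact: "locally compact (UNIV :: 'g set)"
    and continuous_mult: "continuous_on (composable G) (\<lambda>(g, h). gmult G g h)"
    and continuous_inv: "continuous_on UNIV (ginv G)"

definition local_homeomorphism ::
  "'a::topological_space set \<Rightarrow> 'b::topological_space set \<Rightarrow> ('a \<Rightarrow> 'b) \<Rightarrow> bool" where
  "local_homeomorphism X Y f \<longleftrightarrow> f ` X \<subseteq> Y \<and>
     (\<forall>x\<in>X. \<exists>U. x \<in> U \<and> openin (top_of_set X) U \<and> openin (top_of_set Y) (f ` U) \<and>
        (\<exists>h. homeomorphism U (f ` U) f h))"

locale etale_groupoid = lch_groupoid +
  assumes rng_local_homeomorphism: "local_homeomorphism UNIV (unit_space G) (rng G)"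
    and src_local_homeomorphism: "local_homeomorphism UNIV (unit_space G) (src G)"

definition bisection :: "('g::topological_space) groupoid \<Rightarrow> 'g set \<Rightarrow> bool" where
  "bisection G S \<longleftrightarrow>
     open (rng G ` S) \<and> (\<exists>h. homeomorphism S (rng G ` S) (rng G) h) \<and>
     open (src G ` S) \<and> (\<exists>h. homeomorphism S (src G ` S) (src G) h)"

definition compact_open_bisections :: "('g::topological_space) groupoid \<Rightarrow> 'g set set" where
  "compact_open_bisections G = {S. compact S \<and> open S \<and> bisection G S}"

locale ample_groupoid = etale_groupoid +
  assumes ample: "topological_basis (compact_open_bisections G)"

definition invariant :: "'g groupoid \<Rightarrow> 'g set \<Rightarrow> bool" where
  "invariant G D \<longleftrightarrow> D \<subseteq> unit_space G \<and> (\<forall>g. src G g \<in> D \<longrightarrow> rng G g \<in> D)"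

definition minimal_groupoid :: "('g::topological_space) groupoid \<Rightarrow> bool" where
  "minimal_groupoid G \<longleftrightarrow>
     (\<forall>D. closedin (top_of_set (unit_space G)) D \<and> invariant G D \<longrightarrow> D = {} \<or> D = unit_space G)"


section \<open>Paradoxicality\<close>

definition paradoxical :: "('g::topological_space) groupoid \<Rightarrow> nat \<Rightarrow> nat \<Rightarrow> 'g set \<Rightarrow> bool" where
  "paradoxical G k l A \<longleftrightarrow> A \<noteq> {} \<and> A \<subseteq> unit_space G \<and>
     (\<exists>(n :: nat \<Rightarrow> nat) (V :: nat \<Rightarrow> nat \<Rightarrow> 'g set) (m :: nat \<Rightarrow> nat \<Rightarrow> nat).
        (\<forall>i\<in>{1..k}. \<forall>j\<in>{1..n i}.
            V i j \<in> compact_open_bisections G \<and> m i j \<in> {1..l} \<and> rng G ` V i j \<subseteq> A) \<and>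
        (\<forall>i\<in>{1..k}. (\<Union>j\<in>{1..n i}. src G ` V i j) = A) \<and>
        disjoint_family_on (\<lambda>(i, j). (rng G ` V i j) \<times> {m i j}) (SIGMA i:{1..k}. {1..n i}))"

definition completely_non_paradoxical :: "('g::topological_space) groupoid \<Rightarrow> 'g set \<Rightarrow> bool" where
  "completely_non_paradoxical G A \<longleftrightarrow> (\<forall>k l. k > l \<and> l > 0 \<longrightarrow> \<not> paradoxical G k l A)"


section \<open>The type semigroup\<close>

record 'a preordered_monoid =
  pm_elems :: "'a set"
  pm_add :: "'a \<Rightarrow> 'a \<Rightarrow> 'a"
  pm_zero :: 'a
  pm_le :: "'a \<Rightarrow> 'a \<Rightarrow> bool"

definition monoid_state :: "'a preordered_monoid \<Rightarrow> ('a \<Rightarrow> ennreal) \<Rightarrow> bool" where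
  "monoid_state S \<phi> \<longleftrightarrow>
     \<phi> (pm_zero S) = 0 \<and>
     (\<forall>x\<in>pm_elems S. \<forall>y\<in>pm_elems S. \<phi> (pm_add S x y) = \<phi> x + \<phi> y) \<and>
     (\<forall>x\<in>pm_elems S. \<forall>y\<in>pm_elems S. pm_le S x y \<longrightarrow> \<phi> x \<le> \<phi> y)"

definition faithful_monoid_state :: "'a preordered_monoid \<Rightarrow> ('a \<Rightarrow> ennreal) \<Rightarrow> bool" where
  "faithful_monoid_state S \<phi> \<longleftrightarrow>
     monoid_state S \<phi> \<and> (\<forall>x\<in>pm_elems S. \<phi> x = 0 \<longrightarrow> x = pm_zero S)"

text \<open>Open in \<open>G\<close> and open in the unit space agree here, since the unit space of an etale groupoid
  is open.\<close>

definition ts_sets :: "('g::topological_space) groupoid \<Rightarrow> ('g \<times> nat) set set" where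
  "ts_sets G = {(\<Union>i\<in>{1..n}. A i \<times> {i}) | (n :: nat) (A :: nat \<Rightarrow> 'g set).
     \<forall>i\<in>{1..n}. A i \<subseteq> unit_space G \<and> compact (A i) \<and> open (A i)}"

definition ts_equiv :: "('g::topological_space) groupoid \<Rightarrow> (('g \<times> nat) set \<times> ('g \<times> nat) set) set" where
  "ts_equiv G = {(A, B). A \<in> ts_sets G \<and> B \<in> ts_sets G \<and>
     (\<exists>(l :: nat) (W :: nat \<Rightarrow> 'g set) (n :: nat \<Rightarrow> nat) (m :: nat \<Rightarrow> nat).
        (\<forall>k\<in>{1..l}. W k \<in> compact_open_bisections G) \<and>
        A = (\<Union>k\<in>{1..l}. (src G ` W k) \<times> {n k}) \<and>
        disjoint_family_on (\<lambda>k. (src G ` W k) \<times> {n k}) {1..l} \<and>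
        B = (\<Union>k\<in>{1..l}. (rng G ` W k) \<times> {m k}) \<and>
        disjoint_family_on (\<lambda>k. (rng G ` W k) \<times> {m k}) {1..l})}"

definition ts_class :: "('g::topological_space) groupoid \<Rightarrow> ('g \<times> nat) set \<Rightarrow> ('g \<times> nat) set set" where
  "ts_class G A = ts_equiv G `` {A}"

definition shift :: "nat \<Rightarrow> ('g \<times> nat) set \<Rightarrow> ('g \<times> nat) set" where
  "shift n B = (\<lambda>(x, j). (x, n + j)) ` B"

text \<open>A set \<open>A \<in> ts_sets G\<close> can be written as \<open>\<Union>i\<in>{1..n}. A i \<times> {i}\<close> precisely for those \<open>n\<close>
  with \<open>A \<subseteq> UNIV \<times> {1..n}\<close>. As usual for a congruence, the sum of two classes is the union of the
  (equal) classes obtained from all choices of representatives and of \<open>n\<close>.\<close>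

definition ts_add :: "('g::topological_space) groupoid
    \<Rightarrow> ('g \<times> nat) set set \<Rightarrow> ('g \<times> nat) set set \<Rightarrow> ('g \<times> nat) set set" where
  "ts_add G x y = (\<Union>A\<in>x. \<Union>B\<in>y. \<Union>n\<in>{n. A \<subseteq> UNIV \<times> {1..n}}. ts_class G (A \<union> shift n B))"

definition type_semigroup :: "('g::topological_space) groupoid \<Rightarrow> ('g \<times> nat) set set preordered_monoid" where
  "type_semigroup G = \<lparr>
     pm_elems = ts_sets G // ts_equiv G,
     pm_add = ts_add G,
     pm_zero = ts_class G {},
     pm_le = (\<lambda>x y. \<exists>z\<in>ts_sets G // ts_equiv G. y = ts_add G x z)\<rparr>"


section \<open>Unital star algebras, traces and stable finiteness\<close>

text \<open>The additive structure is taken from the ambient type whenever it is needed.\<close>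

record 'a star_algebra =
  elems :: "'a set"
  cscale :: "complex \<Rightarrow> 'a \<Rightarrow> 'a"
  mult :: "'a \<Rightarrow> 'a \<Rightarrow> 'a"
  star :: "'a \<Rightarrow> 'a"
  unit :: 'a

definition tracial_state :: "('a::comm_monoid_add) star_algebra \<Rightarrow> ('a \<Rightarrow> complex) \<Rightarrow> bool" where
  "tracial_state A \<tau> \<longleftrightarrow>
     (\<forall>a\<in>elems A. \<forall>b\<in>elems A. \<tau> (a + b) = \<tau> a + \<tau> b) \<and>
     (\<forall>c. \<forall>a\<in>elems A. \<tau> (cscale A c a) = c * \<tau> a) \<and>
     (\<forall>a\<in>elems A. \<tau> (mult A (star A a) a) \<in> \<real>\<^sub>\<ge>\<^sub>0) \<and>
     \<tau> (unit A) = 1 \<and>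
     (\<forall>a\<in>elems A. \<forall>b\<in>elems A. \<tau> (mult A a b) = \<tau> (mult A b a))"

definition faithful_tracial_state :: "('a::comm_monoid_add) star_algebra \<Rightarrow> ('a \<Rightarrow> complex) \<Rightarrow> bool" where
  "faithful_tracial_state A \<tau> \<longleftrightarrow>
     tracial_state A \<tau> \<and> (\<forall>a\<in>elems A. \<tau> (mult A (star A a) a) = 0 \<longrightarrow> a = 0)"

definition projection :: "'a star_algebra \<Rightarrow> 'a \<Rightarrow> bool" where
  "projection A p \<longleftrightarrow> p \<in> elems A \<and> mult A p p = p \<and> star A p = p"

definition murray_von_neumann_equiv :: "'a star_algebra \<Rightarrow> 'a \<Rightarrow> 'a \<Rightarrow> bool" where
  "murray_von_neumann_equiv A p q \<longleftrightarrow> projection A p \<and> projection A q \<and>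
     (\<exists>v\<in>elems A. mult A (star A v) v = p \<and> mult A v (star A v) = q)"

definition proper_subprojection :: "'a star_algebra \<Rightarrow> 'a \<Rightarrow> 'a \<Rightarrow> bool" where
  "proper_subprojection A q p \<longleftrightarrow> projection A q \<and> projection A p \<and> mult A q p = q \<and> q \<noteq> p"

text \<open>Matrices are normalised to be \<^term>\<open>0\<close> outside the index range, so that equality of
  representing functions is equality of matrices.\<close>

definition matrix_algebra :: "nat \<Rightarrow> ('a::comm_monoid_add) star_algebra \<Rightarrow> (nat \<Rightarrow> nat \<Rightarrow> 'a) star_algebra" where
  "matrix_algebra n A = \<lparr>
     elems = {a. \<forall>i j. if i < n \<and> j < n then a i j \<in> elems A else a i j = 0},
     cscale = (\<lambda>c a i j. if i < n \<and> j < n then cscale A c (a i j) else 0),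
     mult = (\<lambda>a b i j. if i < n \<and> j < n then (\<Sum>k<n. mult A (a i k) (b k j)) else 0),
     star = (\<lambda>a i j. if i < n \<and> j < n then star A (a j i) else 0),
     unit = (\<lambda>i j. if i < n \<and> i = j then unit A else 0)\<rparr>"

definition stably_finite :: "('a::comm_monoid_add) star_algebra \<Rightarrow> bool" where
  "stably_finite A \<longleftrightarrow> (\<forall>n\<ge>1. \<not> (\<exists>q.
     proper_subprojection (matrix_algebra n A) q (unit (matrix_algebra n A)) \<and>
     murray_von_neumann_equiv (matrix_algebra n A) (unit (matrix_algebra n A)) q))"


section \<open>The Hilbert space of square-summable functions\<close>

typedef 'i ell2 = "{f :: 'i \<Rightarrow> complex. (\<lambda>x. (cmod (f x))\<^sup>2) summable_on UNIV}"
  morphisms ell2_fun Abs_ell2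
  by (rule exI[of _ "\<lambda>_. 0"]) simp

setup_lifting type_definition_ell2

lemma ell2_prod_summable:
  fixes f g :: "'i \<Rightarrow> complex"
  assumes "(\<lambda>x. (cmod (f x))\<^sup>2) summable_on UNIV" "(\<lambda>x. (cmod (g x))\<^sup>2) summable_on UNIV"
  shows "(\<lambda>x. f x * cnj (g x)) summable_on UNIV"
proof -
  have "(\<lambda>x. (cmod (f x))\<^sup>2 + (cmod (g x))\<^sup>2) summable_on UNIV"
    using assms by (rule summable_on_add)
  then have "(\<lambda>x. norm (f x * cnj (g x))) summable_on UNIV"
  proof (rule summable_on_comparison_test)
    fix x
    have "cmod (f x) * cmod (g x) \<le> (cmod (f x))\<^sup>2 + (cmod (g x))\<^sup>2"
      using sum_squares_bound[of "cmod (f x)" "cmod (g x)"]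
        mult_nonneg_nonneg[of "cmod (f x)" "cmod (g x)"] by (simp del: mult_nonneg_nonneg)
    then show "norm (f x * cnj (g x)) \<le> (cmod (f x))\<^sup>2 + (cmod (g x))\<^sup>2"
      by (simp add: norm_mult)
  qed simp
  then show ?thesis by (rule abs_summable_summable)
qed

lemma ell2_scale_summable:
  fixes f :: "'i \<Rightarrow> complex"
  assumes "(\<lambda>x. (cmod (f x))\<^sup>2) summable_on UNIV"
  shows "(\<lambda>x. (cmod (c * f x))\<^sup>2) summable_on UNIV"
  using summable_on_cmult_right[OF assms, of "(cmod c)\<^sup>2"] by (simp add: norm_mult power_mult_distrib)

lemma ell2_add_summable:
  fixes f g :: "'i \<Rightarrow> complex"
  assumes "(\<lambda>x. (cmod (f x))\<^sup>2) summable_on UNIV" "(\<lambda>x. (cmod (g x))\<^sup>2) summable_on UNIV"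
  shows "(\<lambda>x. (cmod (f x + g x))\<^sup>2) summable_on UNIV"
proof -
  have "(\<lambda>x. 2 * ((cmod (f x))\<^sup>2 + (cmod (g x))\<^sup>2)) summable_on UNIV"
    by (intro summable_on_cmult_right summable_on_add assms)
  then show ?thesis
  proof (rule summable_on_comparison_test)
    fix x
    have "(cmod (f x + g x))\<^sup>2 \<le> (cmod (f x) + cmod (g x))\<^sup>2"
      by (intro power_mono norm_triangle_ineq) simp
    also have "\<dots> \<le> 2 * ((cmod (f x))\<^sup>2 + (cmod (g x))\<^sup>2)"
      using sum_squares_bound[of "cmod (f x)" "cmod (g x)"] by (simp add: power2_sum)
    finally show "(cmod (f x + g x))\<^sup>2 \<le> 2 * ((cmod (f x))\<^sup>2 + (cmod (g x))\<^sup>2)" .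
  qed simp
qed

definition cinner :: "'i ell2 \<Rightarrow> 'i ell2 \<Rightarrow> complex" where
  "cinner \<xi> \<eta> = (\<Sum>\<^sub>\<infinity>x. ell2_fun \<xi> x * cnj (ell2_fun \<eta> x))"

lift_definition scaleC_ell2 :: "complex \<Rightarrow> 'i ell2 \<Rightarrow> 'i ell2" is "\<lambda>c f x. c * f x"
  by (rule ell2_scale_summable)

text \<open>Only the real part of the inner product enters the type class, which knows real
  scalars only; the norm it induces is the usual one.\<close>

instantiation ell2 :: (type) real_inner
begin

lift_definition zero_ell2 :: "'a ell2" is "\<lambda>_. 0" by simp
lift_definition plus_ell2 :: "'a ell2 \<Rightarrow> 'a ell2 \<Rightarrow> 'a ell2" is "\<lambda>f g x. f x + g x"
  by (rule ell2_add_summable)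
lift_definition uminus_ell2 :: "'a ell2 \<Rightarrow> 'a ell2" is "\<lambda>f x. - f x" by simp
definition minus_ell2 :: "'a ell2 \<Rightarrow> 'a ell2 \<Rightarrow> 'a ell2" where "minus_ell2 \<xi> \<eta> = \<xi> + - \<eta>"
definition scaleR_ell2 :: "real \<Rightarrow> 'a ell2 \<Rightarrow> 'a ell2" where
  "r *\<^sub>R \<xi> = scaleC_ell2 (complex_of_real r) \<xi>"
definition inner_ell2 :: "'a ell2 \<Rightarrow> 'a ell2 \<Rightarrow> real" where "inner_ell2 \<xi> \<eta> = Re (cinner \<xi> \<eta>)"
definition norm_ell2 :: "'a ell2 \<Rightarrow> real" where "norm_ell2 \<xi> = sqrt (\<xi> \<bullet> \<xi>)"
definition sgn_ell2 :: "'a ell2 \<Rightarrow> 'a ell2" where "sgn_ell2 \<xi> = inverse (norm \<xi>) *\<^sub>R \<xi>"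
definition dist_ell2 :: "'a ell2 \<Rightarrow> 'a ell2 \<Rightarrow> real" where "dist_ell2 \<xi> \<eta> = norm (\<xi> - \<eta>)"
definition uniformity_ell2 :: "('a ell2 \<times> 'a ell2) filter" where
  "uniformity_ell2 = (INF e\<in>{0 <..}. principal {(\<xi>, \<eta>). dist \<xi> \<eta> < e})"
definition open_ell2 :: "'a ell2 set \<Rightarrow> bool" where
  "open_ell2 U = (\<forall>\<xi>\<in>U. eventually (\<lambda>(\<xi>', \<eta>). \<xi>' = \<xi> \<longrightarrow> \<eta> \<in> U) uniformity)"

lemma cinner_summable: "(\<lambda>x. ell2_fun \<xi> x * cnj (ell2_fun \<eta> x)) summable_on UNIV"
  using ell2_fun[of \<xi>] ell2_fun[of \<eta>] by (intro ell2_prod_summable) auto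

lemma inner_ell2_self: "(\<xi> :: 'a ell2) \<bullet> \<xi> = (\<Sum>\<^sub>\<infinity>x. (cmod (ell2_fun \<xi> x))\<^sup>2)"
  unfolding inner_ell2_def cinner_def infsum_Re[OF cinner_summable, symmetric]
  by (intro infsum_cong) (simp only: cmod_power2, simp add: power2_eq_square)

instance
proof
  fix x y z :: "'a ell2" and a b r :: real
  show "x + y + z = x + (y + z)" by transfer (simp add: add.assoc)
  show "x + y = y + x" by transfer (simp add: add.commute)
  show "0 + x = x" by transfer simp
  show "- x + x = 0" by transfer simp
  show "x - y = x + - y" by (rule minus_ell2_def)
  show "a *\<^sub>R (x + y) = a *\<^sub>R x + a *\<^sub>R y"
    unfolding scaleR_ell2_def by transfer (simp add: algebra_simps)
  show "(a + b) *\<^sub>R x = a *\<^sub>R x + b *\<^sub>R x"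
    unfolding scaleR_ell2_def by transfer (simp add: algebra_simps)
  show "a *\<^sub>R b *\<^sub>R x = (a * b) *\<^sub>R x"
    unfolding scaleR_ell2_def by transfer (simp add: algebra_simps)
  show "1 *\<^sub>R x = x" unfolding scaleR_ell2_def by transfer simp
  show "sgn x = inverse (norm x) *\<^sub>R x" by (rule sgn_ell2_def)
  show "dist x y = norm (x - y)" by (rule dist_ell2_def)
  show "(uniformity :: ('a ell2 \<times> 'a ell2) filter)
      = (INF e\<in>{0 <..}. principal {(x, y). dist x y < e})" by (rule uniformity_ell2_def)
  show "open U = (\<forall>x\<in>U. \<forall>\<^sub>F (x', y) in uniformity. x' = x \<longrightarrow> y \<in> U)" for U :: "'a ell2 set"
    by (rule open_ell2_def)
  have "cinner y x = cnj (cinner x y)"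
    unfolding cinner_def infsum_cnj[symmetric] by (simp add: mult.commute)
  then show "x \<bullet> y = y \<bullet> x" by (simp add: inner_ell2_def)
  have "cinner (x + y) z = cinner x z + cinner y z"
    unfolding cinner_def
    by (simp add: plus_ell2.rep_eq distrib_right infsum_add cinner_summable)
  then show "(x + y) \<bullet> z = x \<bullet> z + y \<bullet> z" by (simp add: inner_ell2_def)
  have "cinner (r *\<^sub>R x) y = complex_of_real r * cinner x y"
    unfolding cinner_def
    by (simp add: scaleR_ell2_def scaleC_ell2.rep_eq mult.assoc infsum_cmult_right cinner_summable)
  then show "(r *\<^sub>R x) \<bullet> y = r * (x \<bullet> y)" by (simp add: inner_ell2_def)
  show "0 \<le> x \<bullet> x" unfolding inner_ell2_self by (rule infsum_nonneg) simp
  show "(x \<bullet> x = 0) = (x = 0)"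
  proof
    assume "x \<bullet> x = 0"
    then have "(cmod (ell2_fun x i))\<^sup>2 = 0" for i
      using nonneg_infsum_le_0D[of "\<lambda>i. (cmod (ell2_fun x i))\<^sup>2" UNIV i] ell2_fun[of x]
      unfolding inner_ell2_self by simp
    then show "x = 0" by transfer auto
  qed (simp add: inner_ell2_self zero_ell2.rep_eq)
  show "norm x = sqrt (x \<bullet> x)" by (rule norm_ell2_def)
qed

end

lift_definition scaleC_blinfun :: "complex \<Rightarrow> 'i ell2 \<Rightarrow>\<^sub>L 'i ell2" is scaleC_ell2
proof -
  fix c
  have norm: "norm (scaleC_ell2 c \<xi>) = cmod c * norm \<xi>" for \<xi> :: "'i ell2"
    using ell2_fun[of \<xi>] infsum_cmult_right[of "(cmod c)\<^sup>2" "\<lambda>x. (cmod (ell2_fun \<xi> x))\<^sup>2" UNIV]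
    by (simp add: norm_ell2_def inner_ell2_self scaleC_ell2.rep_eq norm_mult power_mult_distrib
        real_sqrt_mult)
  show "bounded_linear (scaleC_ell2 c :: 'i ell2 \<Rightarrow> 'i ell2)"
  proof (rule bounded_linear_intro[where K = "cmod c"])
    fix \<xi> \<eta> :: "'i ell2" and r :: real
    show "scaleC_ell2 c (\<xi> + \<eta>) = scaleC_ell2 c \<xi> + scaleC_ell2 c \<eta>"
      by transfer (simp add: algebra_simps)
    show "scaleC_ell2 c (r *\<^sub>R \<xi>) = r *\<^sub>R scaleC_ell2 c \<xi>"
      unfolding scaleR_ell2_def by transfer (simp add: algebra_simps)
    show "norm (scaleC_ell2 c \<xi>) \<le> norm \<xi> * cmod c" by (simp add: norm)
  qed
qed

definition adjoint_op :: "('i ell2 \<Rightarrow>\<^sub>L 'i ell2) \<Rightarrow> ('i ell2 \<Rightarrow>\<^sub>L 'i ell2)" where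
  "adjoint_op T = (THE S. \<forall>\<xi> \<eta>. cinner (blinfun_apply S \<xi>) \<eta> = cinner \<xi> (blinfun_apply T \<eta>))"


section \<open>The reduced groupoid C*-algebra\<close>

definition Cc :: "('g::topological_space \<Rightarrow> complex) set" where
  "Cc = {f. continuous_on UNIV f \<and> compact (closure {g. f g \<noteq> 0})}"

text \<open>\<open>\<ell>\<^sup>2(G)\<close> is the direct sum of the spaces \<open>\<ell>\<^sup>2(G\<^sub>u)\<close>, where \<open>G\<^sub>u = {g. src G g = u}\<close> and \<open>u\<close>
  ranges over the units. The operator \<open>T\<close> below is the direct sum of the regular representations
  \<open>\<lambda>\<^sub>u(f)\<close> on \<open>\<ell>\<^sup>2(G\<^sub>u)\<close>, i.e. left convolution by \<open>f\<close>; in the etale case there is exactly one such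
  bounded operator for each \<open>f \<in> Cc\<close>, and its operator norm is the reduced norm of \<open>f\<close>.\<close>

definition is_regular_rep ::
  "'g groupoid \<Rightarrow> ('g \<Rightarrow> complex) \<Rightarrow> ('g ell2 \<Rightarrow>\<^sub>L 'g ell2) \<Rightarrow> bool" where
  "is_regular_rep G f T \<longleftrightarrow> (\<forall>\<xi> g. ell2_fun (blinfun_apply T \<xi>) g =
     (\<Sum>\<^sub>\<infinity>h\<in>{h. src G h = src G g}. f (gmult G g (ginv G h)) * ell2_fun \<xi> h))"

text \<open>The unit is the identity operator because the algebra is only considered for compact unit
  space, in which case the identity is the image of the indicator function of the units.\<close>

definition reduced_cstar_algebra ::
  "('g::topological_space) groupoid \<Rightarrow> ('g ell2 \<Rightarrow>\<^sub>L 'g ell2) star_algebra" where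
  "reduced_cstar_algebra G = \<lparr>
     elems = closure {T. \<exists>f\<in>Cc. is_regular_rep G f T},
     cscale = (\<lambda>c T. scaleC_blinfun c o\<^sub>L T),
     mult = (o\<^sub>L),
     star = adjoint_op,
     unit = id_blinfun\<rparr>"

end

theory Submission
  imports Defs "HOL-Library.Function_Algebras"
begin

text \<open>The conditions are linked in a cycle: trace, stable finiteness, absence of paradoxical sets, state,
  trace.

  Trace to stable finiteness: summing a faithful trace \<open>\<tau>\<close> over the diagonal entries gives a faithful
  trace on matrices. An isometry whose range projection is \<open>q\<close> forces the defect \<open>p = 1 - q\<close> to have
  trace \<open>0\<close>, and this trace is the sum of the nonnegative numbers \<open>\<tau> (p\<^sub>k\<^sub>i\<^sup>* p\<^sub>k\<^sub>i)\<close>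
  (\<open>stably_finite_if_faithful_trace\<close>).

  Stable finiteness to the absence of paradoxical sets: if \<open>A\<close> is \<open>(k, l)\<close>-paradoxical with
  \<open>l < k\<close>, then \<open>(l + 1) [A] \<le> l [A]\<close> in the type semigroup, and by iteration any multiple of \<open>[A]\<close>
  is below \<open>l [A]\<close>. Since the groupoid is minimal with compact unit space, the units are covered by
  finitely many translates of \<open>A\<close>, so that \<open>l\<close> copies of the unit space together with one copy of
  \<open>A\<close> embed into \<open>l\<close> copies of the unit space (\<open>paradoxical_proper_embedding\<close>). The characteristic
  functions of the bisections that realise this embedding are partial isometries, and they form an
  \<open>l\<close> by \<open>l\<close> matrix that is an isometry but not a unitary
  (\<open>not_stably_finite_if_proper_embedding\<close>).

  Absence of paradoxical sets to a state: for the unit space itself it says that the order unit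
  \<open>u = [G\<^sup>0]\<close> of the type semigroup never satisfies \<open>(n + 1) u \<le> n u\<close>. A Hahn-Banach argument then
  gives a state with value \<open>1\<close> at \<open>u\<close> (\<open>state_exists\<close>). It is faithful because \<open>u\<close> is below a
  multiple of every nonzero element (\<open>state_if_not_paradoxical\<close>).

  State to trace: the state restricts to a finitely additive measure on the compact open sets of
  units that is invariant under bisections. By compactness it extends to a measure
  (\<open>content_extends\<close>), and the trace of an operator is the integral of its diagonal. Decomposing a
  compactly supported function into functions supported on bisections reduces the trace property to
  the invariance of the measure (\<open>trace_commute_bisfun\<close>). The trace is faithful because the measure has
  full support and because the operators commute with right translations, so that an operator is
  determined by its values at the units (\<open>zero_if_zero_at_units\<close>).

  The type semigroup is handled through functions with natural number values on units times levels:
  finite sums of indicator functions of compact open sets, related by moving the summands along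
  bisections. Two tagged sets have the same class iff their indicator functions are related in this
  way (\<open>ts_equiv_iff\<close>), and all refinements of decompositions are contained in \<open>compose_moves\<close>.\<close>

section \<open>States on preordered monoids\<close>

abbreviation nsum :: "nat \<Rightarrow> 'a::comm_monoid_add \<Rightarrow> 'a" where
  "nsum n x \<equiv> (\<Sum>i<n. x)"

lemma nsum_add_left: "nsum (m + n) x = nsum m x + nsum n x"
  by (induction n) (simp_all add: add.assoc)

lemma nsum_mult: "nsum (m * n) x = nsum m (nsum n x)"
proof (induction m)
  case (Suc m)
  have "nsum (Suc m * n) x = nsum (m * n + n) x" by (simp add: add.commute)
  then show ?case using Suc by (simp add: nsum_add_left)
qed simp

text \<open>A state with value \<open>1\<close> at \<open>u\<close> takes the value \<open>n\<close> at \<open>n u\<close>, so that the last assumption is necessary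
  for its existence.\<close>

locale unital_preordered_monoid =
  fixes C :: "'a::comm_monoid_add set" and le :: "'a \<Rightarrow> 'a \<Rightarrow> bool" (infix "\<preceq>" 50) and u :: 'a
  assumes zero_in: "0 \<in> C" and add_in: "x \<in> C \<Longrightarrow> y \<in> C \<Longrightarrow> x + y \<in> C" and u_in: "u \<in> C"
    and le_refl: "x \<in> C \<Longrightarrow> x \<preceq> x"
    and le_trans: "x \<in> C \<Longrightarrow> y \<in> C \<Longrightarrow> z \<in> C \<Longrightarrow> x \<preceq> y \<Longrightarrow> y \<preceq> z \<Longrightarrow> x \<preceq> z"
    and le_add: "x \<in> C \<Longrightarrow> y \<in> C \<Longrightarrow> x' \<in> C \<Longrightarrow> y' \<in> C \<Longrightarrow> x \<preceq> y \<Longrightarrow> x' \<preceq> y' \<Longrightarrow> x + x' \<preceq> y + y'"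
    and zero_le: "x \<in> C \<Longrightarrow> 0 \<preceq> x"
    and order_unit: "x \<in> C \<Longrightarrow> \<exists>n. x \<preceq> nsum n u"
    and not_absorbing: "\<not> nsum (Suc n) u \<preceq> nsum n u"
begin

lemma nsum_in: "x \<in> C \<Longrightarrow> nsum n x \<in> C"
  by (induction n) (auto intro: zero_in add_in)

lemma nsum_le: "x \<in> C \<Longrightarrow> y \<in> C \<Longrightarrow> x \<preceq> y \<Longrightarrow> nsum n x \<preceq> nsum n y"
  by (induction n) (auto intro!: zero_in le_refl le_add nsum_in)

lemma nsum_u_mono: assumes "m \<le> n" shows "nsum m u \<preceq> nsum n u"
proof -
  have "nsum m u + 0 \<preceq> nsum m u + nsum (n - m) u"
    by (intro le_add nsum_in u_in zero_in le_refl zero_le)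
  then show ?thesis using assms by (simp add: nsum_add_left[symmetric])
qed

lemma nsum_u_leD: assumes "nsum j u \<preceq> nsum k u" shows "j \<le> k"
proof (rule ccontr)
  assume "\<not> j \<le> k"
  then have "nsum (Suc k) u \<preceq> nsum k u"
    by (intro le_trans[OF nsum_in nsum_in nsum_in nsum_u_mono assms] u_in) auto
  then show False using not_absorbing by blast
qed

text \<open>A sublinear functional that is additive along \<^term>\<open>u\<close>. This last condition replaces the
  values at negative elements, by which a linear functional below a sublinear one is normalised
  in a vector space.\<close>

definition sublinear :: "('a \<Rightarrow> real) \<Rightarrow> bool" where
  "sublinear q \<longleftrightarrow> (\<forall>x. x \<notin> C \<longrightarrow> q x = 0) \<and> (\<forall>x\<in>C. 0 \<le> q x)
     \<and> (\<forall>x\<in>C. \<forall>y\<in>C. q (x + y) \<le> q x + q y) \<and> (\<forall>x\<in>C. \<forall>n. q (nsum n x) = real n * q x)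
     \<and> (\<forall>x\<in>C. \<forall>y\<in>C. x \<preceq> y \<longrightarrow> q x \<le> q y) \<and> (\<forall>x\<in>C. q (x + u) = q x + 1)"

text \<open>A state that is \<open>1\<close> at \<open>u\<close> is at \<open>x\<close> at most each of these numbers. The summand
  \<open>j u\<close> stands for a subtraction of \<open>u\<close>, which the monoid lacks; with it the infimum is additive along
  \<open>u\<close>.\<close>

definition ratios :: "'a \<Rightarrow> real set" where
  "ratios x = {(real k - real j) / real n | n k j. 1 \<le> n \<and> nsum n x + nsum j u \<preceq> nsum k u}"

lemma ratios_nonneg: assumes "x \<in> C" "r \<in> ratios x" shows "0 \<le> r"
proof -
  obtain n k j where r: "r = (real k - real j) / real n" "1 \<le> n" "nsum n x + nsum j u \<preceq> nsum k u"
    using assms(2) unfolding ratios_def by blast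
  have "0 + nsum j u \<preceq> nsum n x + nsum j u"
    by (intro le_add zero_in nsum_in assms u_in zero_le le_refl)
  then have "nsum j u \<preceq> nsum k u"
    using le_trans[OF nsum_in add_in[OF nsum_in nsum_in] nsum_in _ r(3)] assms u_in by simp
  then have "j \<le> k" by (rule nsum_u_leD)
  then show ?thesis using r by simp
qed

lemma ratios_bdd: "x \<in> C \<Longrightarrow> bdd_below (ratios x)"
  using ratios_nonneg by (meson bdd_belowI)

lemma ratios_nonempty: assumes "x \<in> C" shows "ratios x \<noteq> {}"
proof -
  obtain n where "x \<preceq> nsum n u" using order_unit assms by blast
  then have "nsum 1 x + nsum 0 u \<preceq> nsum n u" by simp
  then show ?thesis unfolding ratios_def by blast
qed

lemma ratiosI: "1 \<le> n \<Longrightarrow> nsum n x + nsum j u \<preceq> nsum k u \<Longrightarrow> (real k - real j) / real n \<in> ratios x"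
  unfolding ratios_def by blast

definition gauge :: "'a \<Rightarrow> real" where
  "gauge x = (if x \<in> C then Inf (ratios x) else 0)"

lemma gauge_le: "x \<in> C \<Longrightarrow> r \<in> ratios x \<Longrightarrow> gauge x \<le> r"
  by (simp add: gauge_def cInf_lower ratios_bdd)

lemma gauge_greatest: "x \<in> C \<Longrightarrow> (\<And>r. r \<in> ratios x \<Longrightarrow> a \<le> r) \<Longrightarrow> a \<le> gauge x"
  by (simp add: gauge_def cInf_greatest ratios_nonempty)

lemma gauge_subadditive: assumes "x \<in> C" "y \<in> C" shows "gauge (x + y) \<le> gauge x + gauge y"
proof -
  have "gauge (x + y) - r \<le> s" if r: "r \<in> ratios x" and s: "s \<in> ratios y" for r s
  proof -
    obtain n k j where 1: "r = (real k - real j) / real n" "1 \<le> n" "nsum n x + nsum j u \<preceq> nsum k u"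
      using r unfolding ratios_def by blast
    obtain n' k' j' where 2: "s = (real k' - real j') / real n'" "1 \<le> n'"
        "nsum n' y + nsum j' u \<preceq> nsum k' u"
      using s unfolding ratios_def by blast
    note in' = add_in nsum_in assms u_in
    have "nsum n' (nsum n x + nsum j u) + nsum n (nsum n' y + nsum j' u)
        \<preceq> nsum n' (nsum k u) + nsum n (nsum k' u)"
      by (intro le_add nsum_le in' 1 2)
    then have "nsum (n' * n) (x + y) + nsum (n' * j + n * j') u \<preceq> nsum (n' * k + n * k') u"
      by (simp only: sum.distrib nsum_mult[symmetric] nsum_add_left mult.commute[of n n'] ac_simps)
    then have "(real (n' * k + n * k') - real (n' * j + n * j')) / real (n' * n) \<in> ratios (x + y)"
      using 1 2 by (intro ratiosI) (auto simp: Suc_le_eq)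
    moreover have "(real (n' * k + n * k') - real (n' * j + n * j')) / real (n' * n) = r + s"
      using 1(2) 2(2) unfolding 1(1) 2(1) by (simp add: field_simps)
    ultimately show ?thesis using gauge_le[OF add_in[OF assms]] by fastforce
  qed
  then have "gauge (x + y) - r \<le> gauge y" if "r \<in> ratios x" for r
    using gauge_greatest[OF assms(2)] that by blast
  then have "gauge (x + y) - gauge y \<le> gauge x"
    by (intro gauge_greatest assms) (simp add: algebra_simps)
  then show ?thesis by simp
qed

lemma gauge_mono: assumes "x \<in> C" "y \<in> C" "x \<preceq> y" shows "gauge x \<le> gauge y"
proof (intro gauge_greatest assms)
  fix r assume "r \<in> ratios y"
  then obtain n k j where 1: "r = (real k - real j) / real n" "1 \<le> n" "nsum n y + nsum j u \<preceq> nsum k u"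
    unfolding ratios_def by blast
  have "nsum n x + nsum j u \<preceq> nsum n y + nsum j u"
    by (intro le_add nsum_le nsum_in assms u_in le_refl)
  then have "nsum n x + nsum j u \<preceq> nsum k u"
    by (rule le_trans[rotated 3, OF _ 1(3)]) (intro add_in nsum_in assms u_in)+
  then show "gauge x \<le> r" using 1 gauge_le[OF assms(1)] ratiosI by blast
qed

lemma gauge_u: assumes "x \<in> C" shows "gauge (x + u) = gauge x + 1"
proof (rule antisym)
  have "gauge (x + u) - 1 \<le> gauge x"
  proof (intro gauge_greatest assms)
    fix r assume "r \<in> ratios x"
    then obtain n k j where 1: "r = (real k - real j) / real n" "1 \<le> n" "nsum n x + nsum j u \<preceq> nsum k u"
      unfolding ratios_def by blast
    have "(nsum n x + nsum j u) + nsum n u \<preceq> nsum k u + nsum n u"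
      by (intro le_add nsum_in add_in assms u_in le_refl 1)
    then have "nsum n (x + u) + nsum j u \<preceq> nsum (k + n) u"
      by (simp only: sum.distrib nsum_add_left ac_simps)
    then have "(real (k + n) - real j) / real n \<in> ratios (x + u)" using 1 by (intro ratiosI)
    then have "gauge (x + u) \<le> (real (k + n) - real j) / real n" by (intro gauge_le add_in assms u_in)
    moreover have "(real (k + n) - real j) / real n = r + 1"
      using 1(2) unfolding 1(1) by (simp add: field_simps)
    ultimately show "gauge (x + u) - 1 \<le> r" by simp
  qed
  then show "gauge (x + u) \<le> gauge x + 1" by simp
  show "gauge x + 1 \<le> gauge (x + u)"
  proof (intro gauge_greatest assms add_in u_in)
    fix r assume "r \<in> ratios (x + u)"
    then obtain n k j where 1: "r = (real k - real j) / real n" "1 \<le> n"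
        "nsum n (x + u) + nsum j u \<preceq> nsum k u"
      unfolding ratios_def by blast
    then have "nsum n x + nsum (n + j) u \<preceq> nsum k u"
      by (simp only: sum.distrib nsum_add_left ac_simps)
    then have "(real k - real (n + j)) / real n \<in> ratios x" using 1 by (intro ratiosI)
    then have "gauge x \<le> (real k - real (n + j)) / real n" by (intro gauge_le assms)
    moreover have "(real k - real (n + j)) / real n = r - 1"
      using 1(2) unfolding 1(1) by (simp add: field_simps)
    ultimately show "gauge x + 1 \<le> r" by simp
  qed
qed

lemma gauge_zero: "gauge 0 = 0"
proof (rule antisym)
  have "nsum 1 0 + nsum 0 u \<preceq> nsum 0 u" using le_refl[OF zero_in] by simp
  then have "(real 0 - real 0) / real 1 \<in> ratios 0" by (rule ratiosI[rotated]) simp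
  then show "gauge 0 \<le> 0" using gauge_le[OF zero_in] by force
  show "0 \<le> gauge 0" using gauge_greatest[OF zero_in] ratios_nonneg[OF zero_in] by blast
qed

lemma gauge_nsum: assumes "x \<in> C" shows "gauge (nsum m x) = real m * gauge x"
proof (cases "m = 0")
  case False
  show ?thesis
  proof (rule antisym)
    have "gauge (nsum m x) / real m \<le> gauge x"
    proof (intro gauge_greatest assms)
      fix r assume "r \<in> ratios x"
      then obtain n k j where 1: "r = (real k - real j) / real n" "1 \<le> n" "nsum n x + nsum j u \<preceq> nsum k u"
        unfolding ratios_def by blast
      have "nsum m (nsum n x + nsum j u) \<preceq> nsum m (nsum k u)"
        by (intro nsum_le nsum_in add_in assms u_in 1)
      then have "nsum n (nsum m x) + nsum (m * j) u \<preceq> nsum (m * k) u"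
        by (simp only: sum.distrib nsum_mult[symmetric] mult.commute)
      then have "(real (m * k) - real (m * j)) / real n \<in> ratios (nsum m x)" using 1 by (intro ratiosI)
      then have "gauge (nsum m x) \<le> (real (m * k) - real (m * j)) / real n"
        by (intro gauge_le nsum_in assms)
      moreover have "(real (m * k) - real (m * j)) / real n = real m * r"
        unfolding 1(1) by (simp add: right_diff_distrib)
      ultimately show "gauge (nsum m x) / real m \<le> r" using False by (simp add: field_simps)
    qed
    then show "gauge (nsum m x) \<le> real m * gauge x" using False by (simp add: field_simps)
    show "real m * gauge x \<le> gauge (nsum m x)"
    proof (intro gauge_greatest assms nsum_in)
      fix r assume "r \<in> ratios (nsum m x)"
      then obtain n k j where 1: "r = (real k - real j) / real n" "1 \<le> n"
          "nsum n (nsum m x) + nsum j u \<preceq> nsum k u"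
        unfolding ratios_def by blast
      then have "nsum (n * m) x + nsum j u \<preceq> nsum k u" by (simp only: nsum_mult)
      then have "(real k - real j) / real (n * m) \<in> ratios x" using 1 False by (intro ratiosI) auto
      then have "gauge x \<le> (real k - real j) / real (n * m)" by (intro gauge_le assms)
      moreover have "(real k - real j) / real (n * m) = r / real m" unfolding 1(1) by simp
      ultimately have "gauge x \<le> r / real m" by simp
      then show "real m * gauge x \<le> r" using False by (simp add: pos_le_divide_eq mult.commute)
    qed
  qed
qed (simp add: gauge_zero)

lemma sublinear_gauge: "sublinear gauge"
  unfolding sublinear_def
  using gauge_subadditive gauge_mono gauge_u gauge_nsum gauge_greatest ratios_nonneg
  by (auto simp: gauge_def[of "_"] intro!: cInf_greatest ratios_nonempty)

lemma sublinearD: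
  assumes "sublinear q"
  shows "x \<notin> C \<Longrightarrow> q x = 0" "x \<in> C \<Longrightarrow> 0 \<le> q x" "x \<in> C \<Longrightarrow> y \<in> C \<Longrightarrow> q (x + y) \<le> q x + q y"
    "x \<in> C \<Longrightarrow> q (nsum n x) = real n * q x" "x \<in> C \<Longrightarrow> y \<in> C \<Longrightarrow> x \<preceq> y \<Longrightarrow> q x \<le> q y"
    "x \<in> C \<Longrightarrow> q (x + u) = q x + 1"
  using assms unfolding sublinear_def by blast+

text \<open>Replacing \<^term>\<open>q\<close> by its directional derivative at infinity along \<^term>\<open>y\<close> keeps it
  sublinear; the terms \<^term>\<open>q (x + nsum n y) - real n * q y\<close> decrease in \<^term>\<open>n\<close>. A minimal
  sublinear functional is therefore unchanged, and this means \<^term>\<open>q (x + y) = q x + q y\<close>.\<close>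

definition drv :: "('a \<Rightarrow> real) \<Rightarrow> 'a \<Rightarrow> 'a \<Rightarrow> real" where
  "drv q y x = (if x \<in> C then Inf (range (\<lambda>n. q (x + nsum n y) - real n * q y)) else 0)"

context
  fixes q y assumes q: "sublinear q" and y: "y \<in> C"
begin

lemma drv_term_nonneg: assumes "x \<in> C" shows "0 \<le> q (x + nsum n y) - real n * q y"
proof -
  have "0 + nsum n y \<preceq> x + nsum n y"
    by (intro le_add zero_in assms nsum_in y zero_le le_refl)
  then have "q (nsum n y) \<le> q (x + nsum n y)"
    using sublinearD(5)[OF q nsum_in add_in[OF _ nsum_in]] assms y by simp
  then show ?thesis using sublinearD(4)[OF q y] by simp
qed

lemma drv_le: "x \<in> C \<Longrightarrow> drv q y x \<le> q (x + nsum n y) - real n * q y"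
  using drv_term_nonneg by (auto simp: drv_def intro!: cInf_lower bdd_belowI[of _ 0])

lemma drv_greatest:
  "x \<in> C \<Longrightarrow> (\<And>n. a \<le> q (x + nsum n y) - real n * q y) \<Longrightarrow> a \<le> drv q y x"
  by (auto simp: drv_def intro!: cInf_greatest)

lemma drv_term_decreasing:
  assumes "x \<in> C" "m \<le> n"
  shows "q (x + nsum n y) - real n * q y \<le> q (x + nsum m y) - real m * q y"
proof -
  have "x + nsum n y = (x + nsum m y) + nsum (n - m) y"
    using assms by (simp add: add.assoc nsum_add_left[symmetric])
  then have "q (x + nsum n y) \<le> q (x + nsum m y) + q (nsum (n - m) y)"
    using sublinearD(3)[OF q add_in[OF assms(1) nsum_in] nsum_in] y by simp
  then show ?thesis using sublinearD(4)[OF q y] assms by (simp add: of_nat_diff algebra_simps)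
qed

lemma drv_below: "drv q y x \<le> q x"
  using drv_le[of x 0] sublinearD(1)[OF q] by (cases "x \<in> C") (auto simp: drv_def)

lemma drv_subadditive:
  assumes x: "x \<in> C" and x': "x' \<in> C" shows "drv q y (x + x') \<le> drv q y x + drv q y x'"
proof -
  have "drv q y (x + x') - (q (x + nsum n y) - real n * q y) \<le> q (x' + nsum m y) - real m * q y" for n m
  proof -
    have "drv q y (x + x') \<le> q ((x + nsum n y) + (x' + nsum m y)) - real (n + m) * q y"
      using drv_le[OF add_in[OF x x'], of "n + m"] by (simp add: nsum_add_left ac_simps)
    also have "\<dots> \<le> q (x + nsum n y) + q (x' + nsum m y) - real (n + m) * q y"
      using sublinearD(3)[OF q add_in[OF x nsum_in] add_in[OF x' nsum_in]] y by simp
    finally show ?thesis by (simp add: algebra_simps)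
  qed
  then have "drv q y (x + x') - (q (x + nsum n y) - real n * q y) \<le> drv q y x'" for n
    by (intro drv_greatest x')
  then have "drv q y (x + x') - drv q y x' \<le> drv q y x"
    by (intro drv_greatest x) (simp add: algebra_simps)
  then show ?thesis by simp
qed

lemma drv_zero: "drv q y 0 = 0"
proof -
  have "q (0 + nsum n y) - real n * q y = 0" for n
    using sublinearD(4)[OF q y] by simp
  then show ?thesis by (simp add: drv_def zero_in)
qed

lemma drv_nsum: assumes "x \<in> C" shows "drv q y (nsum k x) = real k * drv q y x"
proof (cases "k = 0")
  case False
  have *: "q (nsum k x + nsum (k * n) y) - real (k * n) * q y
      = real k * (q (x + nsum n y) - real n * q y)" for n
  proof -
    have "nsum k x + nsum (k * n) y = nsum k (x + nsum n y)"
      by (simp only: sum.distrib nsum_mult)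
    then have "q (nsum k x + nsum (k * n) y) = real k * q (x + nsum n y)"
      by (simp only: sublinearD(4)[OF q add_in[OF assms nsum_in[OF y]]])
    then show ?thesis by (simp add: algebra_simps)
  qed
  show ?thesis
  proof (rule antisym)
    have "drv q y (nsum k x) / real k \<le> drv q y x"
    proof (intro drv_greatest assms)
      fix n
      show "drv q y (nsum k x) / real k \<le> q (x + nsum n y) - real n * q y"
        using drv_le[OF nsum_in[OF assms], of k "k * n"] False unfolding * by (simp add: field_simps)
    qed
    then show "drv q y (nsum k x) \<le> real k * drv q y x" using False by (simp add: field_simps)
    show "real k * drv q y x \<le> drv q y (nsum k x)"
    proof (intro drv_greatest assms nsum_in)
      fix n
      have "real k * drv q y x \<le> q (nsum k x + nsum (k * n) y) - real (k * n) * q y"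
        unfolding * using drv_le[OF assms, of n] by (simp add: mult_left_mono)
      also have "\<dots> \<le> q (nsum k x + nsum n y) - real n * q y"
        using False by (intro drv_term_decreasing nsum_in assms) auto
      finally show "real k * drv q y x \<le> q (nsum k x + nsum n y) - real n * q y" .
    qed
  qed
qed (simp add: drv_zero)

lemma drv_mono: assumes "x \<in> C" "x' \<in> C" "x \<preceq> x'" shows "drv q y x \<le> drv q y x'"
proof (intro drv_greatest assms)
  fix n
  have "x + nsum n y \<preceq> x' + nsum n y" by (intro le_add assms nsum_in y le_refl)
  then have "q (x + nsum n y) \<le> q (x' + nsum n y)"
    by (intro sublinearD(5)[OF q] add_in nsum_in assms y)
  then show "drv q y x \<le> q (x' + nsum n y) - real n * q y" using drv_le[OF assms(1), of n] by simp
qed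

lemma drv_u: assumes "x \<in> C" shows "drv q y (x + u) = drv q y x + 1"
proof -
  have "q (x + u + nsum n y) = q (x + nsum n y) + 1" for n
    using sublinearD(6)[OF q add_in[OF assms nsum_in[OF y]], of n] by (simp add: ac_simps)
  then have *: "q (x + u + nsum n y) - real n * q y = q (x + nsum n y) - real n * q y + 1" for n
    by simp
  have "drv q y (x + u) - 1 \<le> drv q y x"
    using drv_le[OF add_in[OF assms u_in]] unfolding * by (intro drv_greatest assms) (simp add: algebra_simps)
  moreover have "drv q y x + 1 \<le> drv q y (x + u)"
    by (intro drv_greatest add_in assms u_in) (simp add: * drv_le assms)
  ultimately show ?thesis by simp
qed

lemma sublinear_drv: "sublinear (drv q y)"
  unfolding sublinear_def
  using drv_subadditive drv_nsum drv_mono drv_u drv_greatest[OF _ drv_term_nonneg]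
  by (auto simp: drv_def[of _ _ "_"])

end

text \<open>Zorn's lemma applies because sublinear functionals are bounded below by \<open>0\<close>, so that the pointwise
  infimum of a chain exists and is sublinear again.\<close>

lemma minimal_sublinear_exists:
  obtains q where "sublinear q" "\<And>q'. sublinear q' \<Longrightarrow> (\<And>x. q' x \<le> q x) \<Longrightarrow> q' = q"
proof -
  let ?S = "Collect sublinear" and ?P = "\<lambda>q q' :: 'a \<Rightarrow> real. \<forall>x. q' x \<le> q x"
  have "\<exists>m\<in>?S. \<forall>a\<in>?S. ?P m a \<longrightarrow> a = m"
  proof (rule predicate_Zorn)
    show "partial_order_on ?S (relation_of ?P ?S)"
      by (rule partial_order_on_relation_ofI) (auto intro: order_trans intro!: ext order_antisym)
  next
    fix K assume K: "K \<in> Chains (relation_of ?P ?S)"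
    have KS: "sublinear q" if "q \<in> K" for q
      using K that by (auto simp: Chains_def relation_of_def)
    have Kc: "?P q q' \<or> ?P q' q" if "q \<in> K" "q' \<in> K" for q q'
      using K that unfolding Chains_def relation_of_def by blast
    show "\<exists>p\<in>?S. \<forall>a\<in>K. ?P a p"
    proof (cases "K = {}")
      case True
      then show ?thesis using sublinear_gauge by auto
    next
      case False
      define p where "p x = (INF q\<in>K. q x)" for x
      have nn: "0 \<le> q x" if "q \<in> K" for q x
        using sublinearD(1,2)[OF KS[OF that], of x] by (cases "x \<in> C") auto
      have lower: "p x \<le> q x" if "q \<in> K" for q x
        unfolding p_def using that nn by (auto intro!: cINF_lower bdd_belowI2[of _ 0])
      have greatest: "a \<le> p x" if "\<And>q. q \<in> K \<Longrightarrow> a \<le> q x" for a x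
        unfolding p_def using False that by (intro cINF_greatest) auto
      have "sublinear p"
        unfolding sublinear_def
      proof (intro conjI allI impI ballI)
        fix x assume "x \<notin> C"
        then have "q x = 0" if "q \<in> K" for q using sublinearD(1)[OF KS[OF that]] by blast
        then show "p x = 0"
          using False lower[of _ x] greatest[of 0 x] by (metis all_not_in_conv order_antisym order_refl)
      next
        fix x assume "x \<in> C" then show "0 \<le> p x" by (intro greatest nn)
      next
        fix x y assume C: "x \<in> C" "y \<in> C"
        have "p (x + y) - q x \<le> q' y" if q: "q \<in> K" "q' \<in> K" for q q'
        proof -
          \<comment> \<open>Of two members of a chain, the smaller one bounds both summands.\<close>
          obtain r where r: "r \<in> K" "r x \<le> q x" "r y \<le> q' y" using Kc[OF q] q by blast
          have "p (x + y) \<le> r x + r y"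
            using lower[OF r(1)] sublinearD(3)[OF KS[OF r(1)] C] by (rule order_trans)
          then show ?thesis using r by simp
        qed
        then have "p (x + y) - q x \<le> p y" if "q \<in> K" for q using that by (intro greatest)
        then have "p (x + y) - p y \<le> p x" by (intro greatest) (simp add: algebra_simps)
        then show "p (x + y) \<le> p x + p y" by simp
      next
        fix x n assume x: "x \<in> C"
        have *: "q (nsum n x) = real n * q x" if "q \<in> K" for q using sublinearD(4)[OF KS[OF that] x] .
        show "p (nsum n x) = real n * p x"
        proof (cases "n = 0")
          case True
          then have "q (nsum n x) = 0" if "q \<in> K" for q using *[OF that] by simp
          then show ?thesis using True False lower[of _ "nsum n x"] greatest[of 0 "nsum n x"]
            by (metis all_not_in_conv mult_zero_left of_nat_0 order_antisym order_refl)
        next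
          case n: False
          have "p (nsum n x) / real n \<le> p x"
            using n lower[of _ "nsum n x"] * by (intro greatest) (simp add: field_simps)
          moreover have "real n * p x \<le> p (nsum n x)"
            by (intro greatest) (metis * lower mult_left_mono of_nat_0_le_iff)
          ultimately show ?thesis using n by (simp add: field_simps)
        qed
      next
        fix x y assume "x \<in> C" "y \<in> C" "x \<preceq> y"
        then show "p x \<le> p y"
          using sublinearD(5)[OF KS] lower by (intro greatest) (meson order_trans)
      next
        fix x assume x: "x \<in> C"
        have *: "q (x + u) = q x + 1" if "q \<in> K" for q using sublinearD(6)[OF KS[OF that] x] .
        have "p (x + u) - 1 \<le> p x"
          using * lower[of _ "x + u"] by (intro greatest) (simp add: algebra_simps)
        moreover have "p x + 1 \<le> p (x + u)"
          by (intro greatest) (metis * lower add_right_mono)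
        ultimately show "p (x + u) = p x + 1" by simp
      qed
      then show ?thesis using lower by auto
    qed
  qed
  then show ?thesis using that by blast
qed

theorem state_exists:
  obtains q :: "'a \<Rightarrow> real" where "\<And>x. x \<in> C \<Longrightarrow> 0 \<le> q x"
    "\<And>x y. x \<in> C \<Longrightarrow> y \<in> C \<Longrightarrow> q (x + y) = q x + q y"
    "\<And>x y. x \<in> C \<Longrightarrow> y \<in> C \<Longrightarrow> x \<preceq> y \<Longrightarrow> q x \<le> q y" "q u = 1"
proof -
  obtain q where q: "sublinear q" and min: "\<And>q'. sublinear q' \<Longrightarrow> (\<And>x. q' x \<le> q x) \<Longrightarrow> q' = q"
    using minimal_sublinear_exists by blast
  have "q (x + y) = q x + q y" if C: "x \<in> C" "y \<in> C" for x y
  proof (rule antisym)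
    have "drv q y = q" by (intro min sublinear_drv q C drv_below)
    then have "q x \<le> q (x + nsum 1 y) - real 1 * q y" using drv_le[OF q C(2,1), of 1] by simp
    then show "q x + q y \<le> q (x + y)" by simp
  qed (use sublinearD(3)[OF q] C in blast)
  moreover have "q u = 1"
    using sublinearD(6)[OF q zero_in] sublinearD(4)[OF q zero_in, of 0] by simp
  ultimately show ?thesis using that sublinearD(2,5)[OF q] by blast
qed

end

section \<open>Ample groupoids and their compact open bisections\<close>

context groupoid
begin

abbreviation mul (infixl "\<odot>" 70) where "g \<odot> h \<equiv> gmult G g h"
abbreviation r where "r \<equiv> rng G"
abbreviation s where "s \<equiv> src G"
abbreviation inv' where "inv' \<equiv> ginv G"
abbreviation U0 where "U0 \<equiv> unit_space G"

text \<open>If \<open>(g, h)\<close> is composable, both \<open>r h\<close> and \<open>s g\<close> are bracketings of \<open>g\<^sup>-\<^sup>1 g h h\<^sup>-\<^sup>1\<close>. Conversely \<open>g\<close> is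
  composable with \<open>s g\<close>, and \<open>r h\<close> with \<open>h\<close>.\<close>

lemma composable_iff: "(g, h) \<in> composable G \<longleftrightarrow> s g = r h"
proof
  assume gh: "(g, h) \<in> composable G"
  have 1: "inv' g \<odot> (g \<odot> h) = h" and 2: "(g \<odot> h) \<odot> inv' h = g"
    using gh by (rule inv_cancel_left, rule inv_cancel_right)
  have "r h = (inv' g \<odot> (g \<odot> h)) \<odot> inv' h" using 1 by (simp add: rng_def)
  also have "\<dots> = inv' g \<odot> ((g \<odot> h) \<odot> inv' h)"
    by (intro assoc composable_right composable_left composable_inv_left composable_inv_right gh)
  also have "\<dots> = s g" using 2 by (simp add: src_def)
  finally show "s g = r h" by simp
next
  assume eq: "s g = r h"
  have "(g, s g) \<in> composable G"
    unfolding src_def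
    using composable_right[OF composable_inv_right[of g] composable_inv_left[of g]] .
  moreover have "(r h, h) \<in> composable G"
    unfolding rng_def using composable_left[OF composable_inv_right[of h] composable_inv_left[of h]] .
  ultimately have "(g \<odot> s g, h) \<in> composable G" using composable_left eq by simp
  moreover have "g \<odot> s g = g"
    unfolding src_def
    using inv_cancel_right[OF composable_inv_right[of g]] inv_inv
      assoc[OF composable_inv_right[of g] composable_inv_left[of g]] by simp
  ultimately show "(g, h) \<in> composable G" by simp
qed

lemma mult_assoc: "s g = r h \<Longrightarrow> s h = r k \<Longrightarrow> (g \<odot> h) \<odot> k = g \<odot> (h \<odot> k)"
  using assoc by (simp add: composable_iff)

lemma rng_inv [simp]: "r (inv' g) = s g" and src_inv [simp]: "s (inv' g) = r g"
  by (simp_all add: rng_def src_def inv_inv)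

lemma rng_mult [simp]: "s g = r h \<Longrightarrow> r (g \<odot> h) = r g"
proof -
  assume gh: "s g = r h"
  have "(inv' g, g \<odot> h) \<in> composable G"
    using composable_right[OF composable_inv_left] gh by (simp add: composable_iff)
  then show ?thesis by (simp add: composable_iff)
qed

lemma src_mult [simp]: "s g = r h \<Longrightarrow> s (g \<odot> h) = s h"
proof -
  assume gh: "s g = r h"
  have "(g \<odot> h, inv' h) \<in> composable G"
    using composable_left[OF _ composable_inv_right] gh by (simp add: composable_iff)
  then show ?thesis by (simp add: composable_iff)
qed

lemma rng_rng [simp]: "r (r g) = r g" and src_rng [simp]: "s (r g) = r g"
  using rng_mult[of g "inv' g"] src_mult[of g "inv' g"] by (simp_all add: rng_def[of G g, symmetric])

lemma rng_src [simp]: "r (s g) = s g" and src_src [simp]: "s (s g) = s g"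
  using rng_rng[of "inv' g"] src_rng[of "inv' g"] by simp_all

lemma inv_mult_self [simp]: "inv' g \<odot> g = s g" and mult_inv_self [simp]: "g \<odot> inv' g = r g"
  by (simp_all add: rng_def src_def)

lemma inv_mult_cancel [simp]: "s g = r h \<Longrightarrow> inv' g \<odot> (g \<odot> h) = h"
  using inv_cancel_left by (simp add: composable_iff)

lemma mult_inv_cancel [simp]: "r g = r h \<Longrightarrow> g \<odot> (inv' g \<odot> h) = h"
  using inv_mult_cancel[of "inv' g" h] by (simp add: inv_inv)

lemma mult_cancel_right [simp]: "s h = r g \<Longrightarrow> (h \<odot> g) \<odot> inv' g = h"
  using inv_cancel_right by (simp add: composable_iff)

lemma mult_inv_cancel_right [simp]: "s h = s g \<Longrightarrow> (h \<odot> inv' g) \<odot> g = h"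
  using mult_cancel_right[of h "inv' g"] by (simp add: inv_inv)

lemma rng_mult_self [simp]: "r g \<odot> g = g" and mult_src_self [simp]: "g \<odot> s g = g"
  using mult_inv_cancel_right[of g g] mult_inv_cancel[of g g] by simp_all

lemma rng_in [simp]: "r g \<in> U0" and src_in [simp]: "s g \<in> U0"
  unfolding unit_space_def by (rule rangeI) (metis rangeI rng_inv)

lemma unit_rng [simp]: "x \<in> U0 \<Longrightarrow> r x = x" and unit_src [simp]: "x \<in> U0 \<Longrightarrow> s x = x"
  unfolding unit_space_def by (metis imageE rng_rng) (metis imageE src_rng)

lemma unit_iff: "x \<in> U0 \<longleftrightarrow> r x = x" by (metis rng_in unit_rng)

lemma unit_inv [simp]: "x \<in> U0 \<Longrightarrow> inv' x = x"
  by (metis mult_src_self rng_mult_self mult_inv_self rng_inv unit_rng unit_src)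

lemma rng_unit_mult [simp]: "x \<in> U0 \<Longrightarrow> x = r g \<Longrightarrow> x \<odot> g = g" by simp

lemma mult_unit [simp]: "x \<in> U0 \<Longrightarrow> s g = x \<Longrightarrow> g \<odot> x = g" using mult_src_self by blast

end

context etale_groupoid
begin

lemma continuous_on_mul [continuous_intros]:
  assumes "continuous_on X f" "continuous_on X g" "\<And>x. x \<in> X \<Longrightarrow> s (f x) = r (g x)"
  shows "continuous_on X (\<lambda>x. f x \<odot> g x)"
proof -
  have "continuous_on X (\<lambda>x. (\<lambda>(g, h). g \<odot> h) (f x, g x))"
    using assms by (intro continuous_on_compose2[OF continuous_mult] continuous_on_Pair)
      (auto simp: composable_iff)
  then show ?thesis by simp
qed

lemma continuous_on_ginv [continuous_intros]: "continuous_on X f \<Longrightarrow> continuous_on X (\<lambda>x. inv' (f x))"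
  using continuous_on_compose2[OF continuous_inv] by blast

lemma continuous_on_rng [continuous_intros]: "continuous_on X f \<Longrightarrow> continuous_on X (\<lambda>x. r (f x))"
  unfolding rng_def by (intro continuous_intros) auto

lemma continuous_on_src [continuous_intros]: "continuous_on X f \<Longrightarrow> continuous_on X (\<lambda>x. s (f x))"
  unfolding src_def by (intro continuous_intros) auto

lemma closed_unit_space: "closed U0"
proof -
  have "closed {x. r x = x}" by (intro closed_Collect_eq continuous_intros)
  moreover have "U0 = {x. r x = x}" using unit_iff by blast
  ultimately show ?thesis by (simp only:)
qed

lemma local_homeomorphismE:
  assumes "local_homeomorphism UNIV U0 f"
  obtains U h where "x \<in> U" "open U" "openin (top_of_set U0) (f ` U)" "homeomorphism U (f ` U) f h"
proof -
  have "\<exists>U. x \<in> U \<and> openin (top_of_set UNIV) U \<and> openin (top_of_set U0) (f ` U) \<and>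
      (\<exists>h. homeomorphism U (f ` U) f h)"
    using assms unfolding local_homeomorphism_def by blast
  then show ?thesis using that by (auto simp: subtopology_UNIV)
qed

text \<open>On a neighbourhood \<open>U\<close> of a unit on which the range map is injective, an arrow whose range
  also lies in \<open>U\<close> equals its range.\<close>

lemma open_unit_space: "open U0"
proof (subst open_subopen, rule ballI)
  fix x assume x: "x \<in> U0"
  obtain U h where U: "x \<in> U" "open U" "homeomorphism U (r ` U) r h"
    using local_homeomorphismE[OF rng_local_homeomorphism, of x] by metis
  have inj: "inj_on r U" using U(3) by (metis homeomorphism_def inj_on_inverseI)
  let ?V = "U \<inter> r -` U"
  have "open ?V" by (intro open_Int open_vimage U continuous_intros)
  moreover have "x \<in> ?V" using U x by simp
  moreover have "?V \<subseteq> U0" using inj unit_iff rng_rng by (blast dest: inj_onD)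
  ultimately show "\<exists>T. open T \<and> x \<in> T \<and> T \<subseteq> U0" by blast
qed

lemma local_homeomorphism_open_map:
  assumes "local_homeomorphism UNIV U0 f" "open V" shows "open (f ` V)"
proof -
  have "\<exists>T. open T \<and> f x \<in> T \<and> T \<subseteq> f ` V" if x: "x \<in> V" for x
  proof -
    obtain U h where U: "x \<in> U" "open U" "openin (top_of_set U0) (f ` U)"
        "homeomorphism U (f ` U) f h"
      using local_homeomorphismE[OF assms(1), of x] by metis
    have "open (f ` U)" using U(3) openin_open_eq open_unit_space by blast
    moreover have "openin (top_of_set (f ` U)) (f ` (U \<inter> V))"
      using U assms(2) by (intro homeomorphism_imp_open_map[OF U(4)]) (simp add: openin_open_Int)
    ultimately have "open (f ` (U \<inter> V))" using openin_open_eq by blast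
    then show ?thesis using x U by blast
  qed
  then show ?thesis by (subst open_subopen) blast
qed

lemma open_rng_image: "open V \<Longrightarrow> open (r ` V)" and open_src_image: "open V \<Longrightarrow> open (s ` V)"
  using local_homeomorphism_open_map rng_local_homeomorphism src_local_homeomorphism by auto

lemma bisection_inj: "bisection G W \<Longrightarrow> inj_on r W \<and> inj_on s W"
  unfolding bisection_def homeomorphism_def by (metis inj_on_inverseI)

abbreviation cobs where "cobs \<equiv> compact_open_bisections G"

text \<open>The homeomorphisms required of a bisection come for free on compact open sets: a continuous
  injection of a compact set into a Hausdorff space is a homeomorphism onto its image, and the range
  and source maps are open.\<close>

lemma cob_iff: "W \<in> cobs \<longleftrightarrow> compact W \<and> open W \<and> inj_on r W \<and> inj_on s W"
proof
  assume "W \<in> cobs" then show "compact W \<and> open W \<and> inj_on r W \<and> inj_on s W"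
    using bisection_inj by (auto simp: compact_open_bisections_def)
next
  assume W: "compact W \<and> open W \<and> inj_on r W \<and> inj_on s W"
  have "\<exists>h. homeomorphism W (r ` W) r h" "\<exists>h. homeomorphism W (s ` W) s h"
    using W by (auto intro!: homeomorphism_compact continuous_intros)
  then show "W \<in> cobs" using W open_rng_image open_src_image
    by (simp add: compact_open_bisections_def bisection_def)
qed

lemma cobD: assumes "W \<in> cobs"
  shows "compact W" "open W" "inj_on r W" "inj_on s W" "compact (r ` W)" "compact (s ` W)"
    "open (r ` W)" "open (s ` W)" "closed W"
  using assms cob_iff open_rng_image open_src_image compact_imp_closed
  by (auto intro!: compact_continuous_image continuous_intros)

lemma cob_rng_eqD: "W \<in> cobs \<Longrightarrow> g \<in> W \<Longrightarrow> h \<in> W \<Longrightarrow> r g = r h \<Longrightarrow> g = h"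
  and cob_src_eqD: "W \<in> cobs \<Longrightarrow> g \<in> W \<Longrightarrow> h \<in> W \<Longrightarrow> s g = s h \<Longrightarrow> g = h"
  using cobD(3,4) by (auto simp: inj_on_def)

definition copens :: "'a set set" where
  "copens = {A. A \<subseteq> U0 \<and> compact A \<and> open A}"

lemma copensD: assumes "A \<in> copens" shows "A \<subseteq> U0" "compact A" "open A" "closed A"
  using assms compact_imp_closed by (auto simp: copens_def)

lemma copens_Un: "A \<in> copens \<Longrightarrow> B \<in> copens \<Longrightarrow> A \<union> B \<in> copens"
  and copens_Diff: "A \<in> copens \<Longrightarrow> B \<in> copens \<Longrightarrow> A - B \<in> copens"
  and copens_empty: "{} \<in> copens"
  by (auto simp: copens_def compact_Int compact_diff compact_imp_closed open_Diff)

lemma copens_cob: assumes "A \<in> copens" shows "A \<in> cobs"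
proof -
  have "inj_on r A" "inj_on s A" using copensD(1)[OF assms] by (auto simp: inj_on_def subset_iff)
  then show ?thesis using copensD[OF assms] by (simp add: cob_iff)
qed

lemma copens_image: assumes "A \<in> copens" shows "r ` A = A" "s ` A = A"
  using copensD(1)[OF assms] by (force simp: image_iff)+

lemma cob_rng_copen: "W \<in> cobs \<Longrightarrow> r ` W \<in> copens" and cob_src_copen: "W \<in> cobs \<Longrightarrow> s ` W \<in> copens"
  using cobD by (auto simp: copens_def)

lemma cob_subset: assumes "W \<in> cobs" "V \<subseteq> W" "open V" "closed V" shows "V \<in> cobs"
  using assms cobD[OF assms(1)] by (auto simp: cob_iff intro: inj_on_subset compact_Int_closed
      dest: compact_Int_closed[of W V] simp: Int_absorb1)

lemma cob_restrict_src: assumes "W \<in> cobs" "open A" "closed A" shows "{g \<in> W. s g \<in> A} \<in> cobs"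
proof -
  have "{g \<in> W. s g \<in> A} = W \<inter> s -` A" by auto
  moreover have "open (W \<inter> s -` A)" "closed (W \<inter> s -` A)"
    by (intro open_Int closed_Int open_vimage closed_vimage continuous_intros assms cobD)+
  ultimately show ?thesis using cob_subset[OF assms(1), of "W \<inter> s -` A"] by simp
qed

lemma cob_restrict_rng: assumes "W \<in> cobs" "open A" "closed A" shows "{g \<in> W. r g \<in> A} \<in> cobs"
proof -
  have "{g \<in> W. r g \<in> A} = W \<inter> r -` A" by auto
  moreover have "open (W \<inter> r -` A)" "closed (W \<inter> r -` A)"
    by (intro open_Int closed_Int open_vimage closed_vimage continuous_intros assms cobD)+
  ultimately show ?thesis using cob_subset[OF assms(1), of "W \<inter> r -` A"] by simp
qed

lemma cob_inv: assumes "W \<in> cobs" shows "inv' ` W \<in> cobs"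
proof -
  have "inv' ` W = inv' -` W" using inv_inv by (auto simp: image_iff) (metis inv_inv)
  then have "open (inv' ` W)" using cobD(2)[OF assms] by (simp add: open_vimage continuous_inv)
  moreover have "compact (inv' ` W)"
    by (intro compact_continuous_image continuous_on_ginv continuous_on_id cobD assms)
  moreover have "inj_on r (inv' ` W)" "inj_on s (inv' ` W)"
    using cob_src_eqD[OF assms] cob_rng_eqD[OF assms] by (auto simp: inj_on_def)
  ultimately show ?thesis by (simp add: cob_iff)
qed

definition sect :: "'a set \<Rightarrow> 'a \<Rightarrow> 'a" where
  "sect U = the_inv_into U r"

lemma sect: assumes "U \<in> cobs" "x \<in> r ` U" shows "sect U x \<in> U" "r (sect U x) = x"
  unfolding sect_def using assms cobD(3)[OF assms(1)]
  by (auto intro: the_inv_into_into f_the_inv_into_f simp del: rng_def)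

lemma sect_eq: assumes "U \<in> cobs" "g \<in> U" shows "sect U (r g) = g"
  using the_inv_into_f_f[OF cobD(3)] assms by (simp add: sect_def)

lemma sect_eqI: assumes "U \<in> cobs" "g \<in> U" "r g = x" shows "sect U x = g"
  using sect_eq assms by blast

lemma continuous_on_sect: assumes "U \<in> cobs" shows "continuous_on (r ` U) (sect U)"
  unfolding sect_def
  by (intro continuous_on_inv_into continuous_intros cobD assms)

text \<open>Left translation by the inverses of the arrows of a bisection is a homeomorphism between
  clopen sets; it is what convolution by a function supported on the bisection does.\<close>

definition ltrans_dom :: "'a set \<Rightarrow> 'a set" where
  "ltrans_dom U = {x. r x \<in> r ` U}"

definition ltrans :: "'a set \<Rightarrow> 'a \<Rightarrow> 'a" where
  "ltrans U x = inv' (sect U (r x)) \<odot> x"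

lemma open_ltrans_dom: "U \<in> cobs \<Longrightarrow> open (ltrans_dom U)"
  and closed_ltrans_dom: "U \<in> cobs \<Longrightarrow> closed (ltrans_dom U)"
  unfolding ltrans_dom_def vimage_def[symmetric]
  by (intro open_vimage closed_vimage continuous_intros cobD compact_imp_closed; assumption)+

lemma continuous_on_sect_rng: assumes "U \<in> cobs" shows "continuous_on (ltrans_dom U) (\<lambda>x. sect U (r x))"
  by (rule continuous_on_compose2[OF continuous_on_sect[OF assms]])
    (auto simp: ltrans_dom_def intro: continuous_intros)

lemma continuous_on_ltrans: assumes "U \<in> cobs" shows "continuous_on (ltrans_dom U) (ltrans U)"
  unfolding ltrans_def using sect[OF assms]
  by (intro continuous_intros continuous_on_sect_rng assms) (auto simp: ltrans_dom_def)

lemma ltrans_eq: "U \<in> cobs \<Longrightarrow> u \<in> U \<Longrightarrow> s u = r h \<Longrightarrow> ltrans U (u \<odot> h) = h"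
  by (simp add: ltrans_def sect_eq)

lemma src_ltrans: "U \<in> cobs \<Longrightarrow> x \<in> ltrans_dom U \<Longrightarrow> s (ltrans U x) = s x"
  and rng_ltrans: "U \<in> cobs \<Longrightarrow> x \<in> ltrans_dom U \<Longrightarrow> r (ltrans U x) = s (sect U (r x))"
  and sect_mult_ltrans: "U \<in> cobs \<Longrightarrow> x \<in> ltrans_dom U \<Longrightarrow> sect U (r x) \<odot> ltrans U x = x"
  using sect[of U "r x"] by (simp_all add: ltrans_def ltrans_dom_def)

lemma inj_on_ltrans: assumes "U \<in> cobs" shows "inj_on (ltrans U) (ltrans_dom U)"
proof (rule inj_onI)
  fix x y assume xy: "x \<in> ltrans_dom U" "y \<in> ltrans_dom U" "ltrans U x = ltrans U y"
  then have "s (sect U (r x)) = s (sect U (r y))" using rng_ltrans assms by metis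
  then have "sect U (r x) = sect U (r y)"
    using cob_src_eqD[OF assms] sect(1)[OF assms] xy by (auto simp: ltrans_dom_def)
  then show "x = y" using sect_mult_ltrans[OF assms] xy by metis
qed

definition setmul :: "'a set \<Rightarrow> 'a set \<Rightarrow> 'a set" where
  "setmul U V = {u \<odot> v | u v. u \<in> U \<and> v \<in> V \<and> s u = r v}"

lemma setmulI: "u \<in> U \<Longrightarrow> v \<in> V \<Longrightarrow> s u = r v \<Longrightarrow> u \<odot> v \<in> setmul U V"
  by (auto simp: setmul_def)

text \<open>The first factor of a product in \<open>setmul U V\<close> is determined by the range of the product, so that
  membership is a condition on the translate by its inverse. This makes products of open sets open.\<close>

lemma setmul_eq_vimage: assumes "U \<in> cobs" shows "setmul U V = ltrans_dom U \<inter> ltrans U -` V"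
proof (intro set_eqI iffI)
  fix x assume "x \<in> setmul U V"
  then obtain u v where x: "x = u \<odot> v" "u \<in> U" "v \<in> V" "s u = r v" by (auto simp: setmul_def)
  then show "x \<in> ltrans_dom U \<inter> ltrans U -` V"
    using ltrans_eq[OF assms] by (auto simp: ltrans_dom_def)
next
  fix x assume "x \<in> ltrans_dom U \<inter> ltrans U -` V"
  then have x: "x \<in> ltrans_dom U" "ltrans U x \<in> V" by auto
  then have "sect U (r x) \<odot> ltrans U x \<in> setmul U V"
    using sect(1)[OF assms] rng_ltrans[OF assms] by (intro setmulI) (auto simp: ltrans_dom_def)
  then show "x \<in> setmul U V" using sect_mult_ltrans[OF assms] x by simp
qed

lemma compact_setmul: assumes "compact U" "compact V" shows "compact (setmul U V)"
proof -
  have "closed {p. s (fst p) = r (snd p)}"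
    by (intro closed_Collect_eq continuous_intros)
  then have "compact ((U \<times> V) \<inter> {p. s (fst p) = r (snd p)})"
    using assms by (intro compact_Int_closed compact_Times)
  moreover have "setmul U V = (\<lambda>p. fst p \<odot> snd p) ` ((U \<times> V) \<inter> {p. s (fst p) = r (snd p)})"
    by (force simp: setmul_def image_iff)
  ultimately show ?thesis by (auto intro!: compact_continuous_image continuous_intros)
qed

lemma cob_setmul: assumes "U \<in> cobs" "V \<in> cobs" shows "setmul U V \<in> cobs"
proof -
  have "openin (top_of_set (ltrans_dom U)) (ltrans_dom U \<inter> ltrans U -` V)"
    using continuous_on_ltrans[OF assms(1)] cobD(2)[OF assms(2)] continuous_openin_preimage_gen by blast
  then have "open (setmul U V)"
    using open_ltrans_dom[OF assms(1)] openin_open_eq setmul_eq_vimage[OF assms(1)] by auto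
  moreover have "u \<odot> v = u' \<odot> v'"
    if "u \<in> U" "v \<in> V" "s u = r v" "u' \<in> U" "v' \<in> V" "s u' = r v'"
      and "r (u \<odot> v) = r (u' \<odot> v') \<or> s (u \<odot> v) = s (u' \<odot> v')" for u v u' v'
    using that cob_rng_eqD[OF assms(1)] cob_rng_eqD[OF assms(2)] cob_src_eqD[OF assms(1)]
      cob_src_eqD[OF assms(2)] by (metis rng_mult src_mult)
  then have "inj_on r (setmul U V)" "inj_on s (setmul U V)"
    unfolding inj_on_def setmul_def by blast+
  moreover have "compact (setmul U V)" by (intro compact_setmul cobD assms)
  ultimately show ?thesis by (simp add: cob_iff)
qed

lemma rng_inv_image: "r ` inv' ` W = s ` W" and src_inv_image: "s ` inv' ` W = r ` W"
  by (auto simp: image_iff)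

end

section \<open>Equidecomposability by bisections\<close>

lemma sum_fun_apply: "(\<Sum>i\<in>I. f i) x = (\<Sum>i\<in>I. f i x)" for f :: "'i \<Rightarrow> 'x \<Rightarrow> 'b::comm_monoid_add"
  by (induction I rule: infinite_finite_induct) simp_all

lemma nsum_fun_apply: "nsum n f x = n * f x" for f :: "'x \<Rightarrow> nat"
  by (induction n) (simp_all add: algebra_simps)

lemma indicator_split:
  "A = B \<union> C \<Longrightarrow> B \<inter> C = {} \<Longrightarrow> (indicator A :: 'x \<Rightarrow> nat) = indicator B + indicator C"
  by (auto simp: fun_eq_iff indicator_def)

lemma indicator_empty_fun: "(indicator {} :: 'x \<Rightarrow> nat) = 0"
  by (simp add: fun_eq_iff)

lemma indicator_mono_fun: "A \<subseteq> B \<Longrightarrow> (indicator A :: 'x \<Rightarrow> nat) \<le> indicator B"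
  by (auto simp: le_fun_def indicator_def)

lemma indicator_le_fun_iff: "(indicator A :: 'x \<Rightarrow> nat) \<le> f \<longleftrightarrow> (\<forall>p\<in>A. 1 \<le> f p)"
  by (auto simp: le_fun_def indicator_def)

lemma indicator_inject_fun: "(indicator A :: 'x \<Rightarrow> nat) = indicator B \<longleftrightarrow> A = B"
  by (auto simp: fun_eq_iff indicator_def split: if_splits)

lemma disjoint_of_sum_indicator_le:
  assumes "finite I" "(\<Sum>i\<in>I. indicator (X i) :: 'x \<Rightarrow> nat) \<le> indicator B"
  shows "disjoint_family_on X I"
  unfolding disjoint_family_on_def
proof (intro ballI impI, rule ccontr)
  fix i j assume ij: "i \<in> I" "j \<in> I" "i \<noteq> j" "X i \<inter> X j \<noteq> {}"
  then obtain p where p: "p \<in> X i" "p \<in> X j" by blast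
  have "(\<Sum>k\<in>{i, j}. indicator (X k) p :: nat) \<le> (\<Sum>k\<in>I. indicator (X k) p)"
    using ij assms(1) by (intro sum_mono2) auto
  also have "\<dots> \<le> indicator B p" using assms(2) by (simp add: le_fun_def sum_fun_apply)
  also have "\<dots> \<le> 1" by (simp add: indicator_def)
  finally show False using ij p by simp
qed

lemma sum_indicator_disjoint:
  assumes "finite I" "disjoint_family_on X I"
  shows "(\<Sum>i\<in>I. indicator (X i) :: 'x \<Rightarrow> nat) = indicator (\<Union>i\<in>I. X i)"
  using assms by (simp add: fun_eq_iff sum_fun_apply indicator_UN_disjoint)

lemma Union_of_sum_indicator:
  assumes "finite I" "(\<Sum>i\<in>I. indicator (X i) :: 'x \<Rightarrow> nat) = indicator B"
  shows "(\<Union>i\<in>I. X i) = B"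
proof -
  have "disjoint_family_on X I"
    using assms by (intro disjoint_of_sum_indicator_le[where B = B]) simp_all
  then have "(indicator (\<Union>i\<in>I. X i) :: 'x \<Rightarrow> nat) = indicator B"
    using sum_indicator_disjoint[OF assms(1), of X] assms(2) by simp
  then show ?thesis by (simp only: indicator_inject_fun)
qed

context etale_groupoid
begin

definition tsrc :: "'a set \<times> nat \<times> nat \<Rightarrow> ('a \<times> nat) set" where
  "tsrc t = s ` fst t \<times> {fst (snd t)}"

definition trng :: "'a set \<times> nat \<times> nat \<Rightarrow> ('a \<times> nat) set" where
  "trng t = r ` fst t \<times> {snd (snd t)}"

lemma tsrc_simp [simp]: "tsrc (W, n, m) = s ` W \<times> {n}" and trng_simp [simp]: "trng (W, n, m) = r ` W \<times> {m}"
  by (simp_all add: tsrc_def trng_def)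

text \<open>A move \<open>(W, n, m)\<close> carries the sources of \<open>W\<close> at level \<open>n\<close> to the ranges of \<open>W\<close> at level \<open>m\<close>. Summing
  indicator functions over a list of moves records multiplicities, so that no disjointness has to
  be maintained.\<close>

definition moves :: "('a set \<times> nat \<times> nat) list \<Rightarrow> bool" where
  "moves L \<longleftrightarrow> (\<forall>t\<in>set L. fst t \<in> cobs)"

definition dsum :: "('a set \<times> nat \<times> nat) list \<Rightarrow> 'a \<times> nat \<Rightarrow> nat" where
  "dsum L = (\<Sum>t\<leftarrow>L. indicator (tsrc t))"

definition rsum :: "('a set \<times> nat \<times> nat) list \<Rightarrow> 'a \<times> nat \<Rightarrow> nat" where
  "rsum L = (\<Sum>t\<leftarrow>L. indicator (trng t))"

lemma moves_simps [simp]: "moves []" "moves (t # L) \<longleftrightarrow> fst t \<in> cobs \<and> moves L"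
    "moves (L @ M) \<longleftrightarrow> moves L \<and> moves M"
  by (auto simp: moves_def)

lemma dsum_simps [simp]: "dsum [] = 0" "dsum (t # L) = indicator (tsrc t) + dsum L"
    "dsum (L @ M) = dsum L + dsum M"
  by (simp_all add: dsum_def)

lemma rsum_simps [simp]: "rsum [] = 0" "rsum (t # L) = indicator (trng t) + rsum L"
    "rsum (L @ M) = rsum L + rsum M"
  by (simp_all add: rsum_def)

lemma dsum_pos: assumes "1 \<le> dsum L p" shows "\<exists>t\<in>set L. p \<in> tsrc t"
proof (rule ccontr)
  assume "\<not> (\<exists>t\<in>set L. p \<in> tsrc t)"
  then have "dsum L p = 0" by (induction L) (auto simp: indicator_def)
  then show False using assms by simp
qed

text \<open>Either sum vanishes only if all the bisections are empty.\<close>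

lemma rsum_zero_if_dsum_zero: "dsum L = 0 \<Longrightarrow> rsum L = 0"
  and dsum_zero_if_rsum_zero: "rsum L = 0 \<Longrightarrow> dsum L = 0"
proof -
  have d: "\<forall>t\<in>set L. fst t = {}" if "dsum L = 0"
  proof (rule ballI, rule ccontr)
    fix t assume t: "t \<in> set L" "fst t \<noteq> {}"
    then obtain p where p: "p \<in> tsrc t" by (force simp: tsrc_def)
    have "dsum L p > 0" using t p by (induction L) (auto simp: indicator_def)
    then show False using that by simp
  qed
  have e: "\<forall>t\<in>set L. fst t = {}" if "rsum L = 0"
  proof (rule ballI, rule ccontr)
    fix t assume t: "t \<in> set L" "fst t \<noteq> {}"
    then obtain p where p: "p \<in> trng t" by (force simp: trng_def)
    have "rsum L p > 0" using t p by (induction L) (auto simp: indicator_def)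
    then show False using that by simp
  qed
  have f: "dsum L = 0 \<and> rsum L = 0" if "\<forall>t\<in>set L. fst t = {}"
    using that by (induction L) (auto simp: tsrc_def trng_def indicator_empty_fun)
  show "dsum L = 0 \<Longrightarrow> rsum L = 0" using d f by blast
  show "rsum L = 0 \<Longrightarrow> dsum L = 0" using e f by blast
qed

text \<open>The first bisection \<open>V\<close> of the list takes over those arrows of \<open>W\<close> that end in its sources; the
  rest of \<open>W\<close> is left to the tail of the list. What \<open>V\<close> has not used goes to the remainder
  \<^term>\<open>Vs'\<close>.\<close>

lemma compose_one_move:
  assumes "moves Vs" "W \<in> cobs" "r ` W \<times> {m} \<subseteq> (\<Union>t\<in>set Vs. tsrc t)"
  shows "\<exists>Us Vs'. moves Us \<and> moves Vs' \<and> dsum Us = indicator (s ` W \<times> {n})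
     \<and> rsum Us + rsum Vs' = rsum Vs \<and> dsum Vs' + indicator (r ` W \<times> {m}) = dsum Vs"
  using assms
proof (induction Vs arbitrary: W)
  case Nil
  then have "W = {}" by auto
  then show ?case by (intro exI[of _ "[]"]) (simp add: indicator_empty_fun)
next
  case (Cons t Vs)
  obtain V a b where t: "t = (V, a, b)" by (cases t) auto
  have V: "V \<in> cobs" and Vs: "moves Vs" using Cons.prems t by simp_all
  show ?case
  proof (cases "a = m")
    case False
    then have "r ` W \<times> {m} \<subseteq> (\<Union>t\<in>set Vs. tsrc t)" using Cons.prems(3) t by auto
    then obtain Us Vs' where *: "moves Us" "moves Vs'" "dsum Us = indicator (s ` W \<times> {n})"
        "rsum Us + rsum Vs' = rsum Vs" "dsum Vs' + indicator (r ` W \<times> {m}) = dsum Vs"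
      using Cons.IH[OF Vs Cons.prems(2)] by blast
    show ?thesis
    proof (intro exI conjI)
      show "moves Us" "dsum Us = indicator (s ` W \<times> {n})" using * by auto
      show "moves (t # Vs')" using * Cons.prems by simp
      show "rsum Us + rsum (t # Vs') = rsum (t # Vs)"
        by (simp only: rsum_simps *(4)[symmetric] ac_simps)
      show "dsum (t # Vs') + indicator (r ` W \<times> {m}) = dsum (t # Vs)"
        by (simp only: dsum_simps *(5)[symmetric] ac_simps)
    qed
  next
    case True
    define W1 where "W1 = {g \<in> W. r g \<in> s ` V}"
    define W2 where "W2 = {g \<in> W. r g \<in> - s ` V}"
    define V' where "V' = {g \<in> V. s g \<in> - r ` W}"
    have cob: "W1 \<in> cobs" "W2 \<in> cobs" "V' \<in> cobs"
      unfolding W1_def W2_def V'_def using Cons.prems V cobD[OF V] cobD[OF Cons.prems(2)]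
      by (intro cob_restrict_src cob_restrict_rng; auto simp: compact_imp_closed)+
    have "r ` W2 \<times> {m} \<subseteq> (\<Union>t\<in>set Vs. tsrc t)"
      using Cons.prems(3) t by (fastforce simp: W2_def)
    then obtain Us Vs' where *: "moves Us" "moves Vs'" "dsum Us = indicator (s ` W2 \<times> {n})"
        "rsum Us + rsum Vs' = rsum Vs" "dsum Vs' + indicator (r ` W2 \<times> {m}) = dsum Vs"
      using Cons.IH[OF Vs cob(2)] by blast
    have sW: "indicator (s ` W \<times> {n}) = indicator (s ` W1 \<times> {n}) + (indicator (s ` W2 \<times> {n}) :: _ \<Rightarrow> nat)"
    proof (rule indicator_split)
      show "(s ` W1 \<times> {n}) \<inter> (s ` W2 \<times> {n}) = {}"
        using cob_src_eqD[OF Cons.prems(2)] by (auto simp: W1_def W2_def)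
    qed (auto simp: W1_def W2_def)
    have rW: "indicator (r ` W \<times> {m}) = indicator (r ` W1 \<times> {m}) + (indicator (r ` W2 \<times> {m}) :: _ \<Rightarrow> nat)"
      by (rule indicator_split) (force simp: W1_def W2_def)+
    have sV: "indicator (s ` V \<times> {m}) = indicator (s ` V' \<times> {m}) + (indicator (r ` W1 \<times> {m}) :: _ \<Rightarrow> nat)"
      by (rule indicator_split) (force simp: W1_def V'_def)+
    have rprod: "r ` setmul V W1 = r ` {g \<in> V. s g \<in> r ` W}"
    proof (intro set_eqI iffI)
      fix x assume "x \<in> r ` setmul V W1"
      then obtain v w where "v \<in> V" "w \<in> W1" "s v = r w" "x = r v" by (auto simp: setmul_def)
      then show "x \<in> r ` {g \<in> V. s g \<in> r ` W}" by (auto simp: W1_def)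
    next
      fix x assume "x \<in> r ` {g \<in> V. s g \<in> r ` W}"
      then obtain v w where v: "v \<in> V" "w \<in> W" "s v = r w" "x = r v" by auto
      then have "v \<odot> w \<in> setmul V W1" by (intro setmulI) (auto simp: W1_def intro: rev_image_eqI)
      then show "x \<in> r ` setmul V W1" using v by (metis imageI rng_mult)
    qed
    have sprod: "s ` setmul V W1 = s ` W1"
    proof (intro set_eqI iffI)
      fix x assume "x \<in> s ` setmul V W1" then show "x \<in> s ` W1" by (auto simp: setmul_def)
    next
      fix x assume "x \<in> s ` W1"
      then obtain w where w: "w \<in> W1" "x = s w" by blast
      moreover from w obtain v where "v \<in> V" "s v = r w"
        unfolding W1_def by (metis (mono_tags, lifting) imageE mem_Collect_eq)
      ultimately have v: "v \<in> V" "w \<in> W1" "s v = r w" "x = s w" by auto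
      then have "v \<odot> w \<in> setmul V W1" by (intro setmulI)
      then show "x \<in> s ` setmul V W1" using v by (metis imageI src_mult)
    qed
    have rV: "indicator (r ` V \<times> {b}) = indicator (r ` setmul V W1 \<times> {b}) + (indicator (r ` V' \<times> {b}) :: _ \<Rightarrow> nat)"
    proof (rule indicator_split)
      show "(r ` setmul V W1 \<times> {b}) \<inter> (r ` V' \<times> {b}) = {}"
        unfolding rprod using cob_rng_eqD[OF V] by (auto simp: V'_def)
    qed (auto simp: rprod V'_def)
    show ?thesis
    proof (intro exI conjI)
      show "moves ((setmul V W1, n, b) # Us)" "moves ((V', m, b) # Vs')"
        using * cob V by (auto intro: cob_setmul)
      show "dsum ((setmul V W1, n, b) # Us) = indicator (s ` W \<times> {n})"
        using * by (simp add: sprod sW)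
      show "rsum ((setmul V W1, n, b) # Us) + rsum ((V', m, b) # Vs') = rsum (t # Vs)"
        by (simp add: t rV *(4)[symmetric] ac_simps)
      show "dsum ((V', m, b) # Vs') + indicator (r ` W \<times> {m}) = dsum (t # Vs)"
        by (simp add: t True sV rW *(5)[symmetric] ac_simps)
    qed
  qed
qed


lemma compose_moves:
  assumes "moves Vs" "moves Ws" "rsum Ws \<le> dsum Vs"
  shows "\<exists>Us Vs'. moves Us \<and> moves Vs' \<and> dsum Us = dsum Ws \<and> rsum Us + rsum Vs' = rsum Vs
     \<and> dsum Vs' + rsum Ws = dsum Vs"
  using assms
proof (induction Ws arbitrary: Vs)
  case Nil
  then show ?case by (intro exI[of _ "[]"] exI[of _ Vs]) simp
next
  case (Cons t Ws)
  obtain W n m where t: "t = (W, n, m)" by (cases t) auto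
  have e: "rsum (t # Ws) = indicator (r ` W \<times> {m}) + rsum Ws" by (simp add: t)
  have "indicator (r ` W \<times> {m}) p \<le> dsum Vs p" for p
    using le_funD[OF Cons.prems(3), of p] unfolding e by simp
  then have "indicator (r ` W \<times> {m}) \<le> dsum Vs" by (rule le_funI)
  then have "r ` W \<times> {m} \<subseteq> (\<Union>t\<in>set Vs. tsrc t)"
    using dsum_pos[of Vs] unfolding indicator_le_fun_iff by blast
  then obtain Us1 Vs1 where 1: "moves Us1" "moves Vs1" "dsum Us1 = indicator (s ` W \<times> {n})"
      "rsum Us1 + rsum Vs1 = rsum Vs" "dsum Vs1 + indicator (r ` W \<times> {m}) = dsum Vs"
    using compose_one_move[of Vs W m n] Cons.prems(1,2) unfolding t moves_simps fst_conv by blast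
  have "indicator (r ` W \<times> {m}) + rsum Ws \<le> indicator (r ` W \<times> {m}) + dsum Vs1"
    using Cons.prems(3) unfolding e 1(5)[symmetric] by (simp only: add.commute)
  then have "rsum Ws \<le> dsum Vs1" by (simp only: add_le_cancel_left)
  then obtain Us2 Vs2 where 2: "moves Us2" "moves Vs2" "dsum Us2 = dsum Ws"
      "rsum Us2 + rsum Vs2 = rsum Vs1" "dsum Vs2 + rsum Ws = dsum Vs1"
    using Cons.IH[of Vs1] 1(2) Cons.prems(2) unfolding moves_simps by blast
  show ?case
  proof (intro exI conjI)
    show "moves (Us1 @ Us2)" "moves Vs2" using 1(1) 2(1,2) by simp_all
    show "dsum (Us1 @ Us2) = dsum (t # Ws)" by (simp only: dsum_simps 1(3) 2(3) t tsrc_simp)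
    show "rsum (Us1 @ Us2) + rsum Vs2 = rsum Vs" by (simp only: rsum_simps add.assoc 2(4) 1(4))
    show "dsum Vs2 + rsum (t # Ws) = dsum Vs"
      by (simp only: e 1(5)[symmetric] 2(5)[symmetric] ac_simps)
  qed
qed

text \<open>The representatives of the elements of the type semigroup: all finite sums of indicator functions
  of sets \<open>A \<times> {n}\<close> with \<open>A\<close> compact open.\<close>

definition tagged :: "('a \<times> nat \<Rightarrow> nat) set" where
  "tagged = dsum ` Collect moves"

definition embeds :: "('a \<times> nat \<Rightarrow> nat) \<Rightarrow> ('a \<times> nat \<Rightarrow> nat) \<Rightarrow> bool" (infix "\<preceq>" 50) where
  "f \<preceq> h \<longleftrightarrow> (\<exists>L. moves L \<and> dsum L = f \<and> rsum L \<le> h)"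

definition equidec :: "('a \<times> nat \<Rightarrow> nat) \<Rightarrow> ('a \<times> nat \<Rightarrow> nat) \<Rightarrow> bool" (infix "\<bowtie>" 50) where
  "f \<bowtie> h \<longleftrightarrow> (\<exists>L. moves L \<and> dsum L = f \<and> rsum L = h)"

lemma equidec_embeds: "f \<bowtie> h \<Longrightarrow> f \<preceq> h" by (auto simp: embeds_def equidec_def)

lemma embeds_mono: "f \<preceq> h \<Longrightarrow> h \<le> h' \<Longrightarrow> f \<preceq> h'" by (force simp: embeds_def)

text \<open>Each source set is itself a bisection, consisting of units.\<close>

lemma tagged_identity: assumes "f \<in> tagged" obtains L where "moves L" "dsum L = f" "rsum L = f"
proof -
  obtain M where M: "moves M" "f = dsum M" using assms by (auto simp: tagged_def)
  let ?L = "map (\<lambda>(W, n, m). (s ` W, n, n)) M"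
  have "moves ?L \<and> dsum ?L = dsum M \<and> rsum ?L = dsum M"
    using M(1)
    by (induction M) (auto simp: copens_cob cob_src_copen image_image)
  then show ?thesis using that M by blast
qed

lemma equidec_refl: "f \<in> tagged \<Longrightarrow> f \<bowtie> f"
  unfolding equidec_def using tagged_identity by metis

lemma embeds_refl: "f \<in> tagged \<Longrightarrow> f \<preceq> f" using equidec_refl equidec_embeds by blast

lemma embeds_le: "f \<in> tagged \<Longrightarrow> f \<le> h \<Longrightarrow> f \<preceq> h" using embeds_refl embeds_mono by blast

lemma equidec_sym: assumes "f \<bowtie> h" shows "h \<bowtie> f"
proof -
  obtain M where M: "moves M" "f = dsum M" "h = rsum M" using assms by (auto simp: equidec_def)
  let ?L = "map (\<lambda>(W, n, m). (inv' ` W, m, n)) M"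
  have "moves ?L \<and> dsum ?L = rsum M \<and> rsum ?L = dsum M"
    using M(1) by (induction M) (auto simp: cob_inv rng_inv_image src_inv_image)
  then show ?thesis unfolding equidec_def M by blast
qed

lemma tagged_if_equidec: "f \<bowtie> h \<Longrightarrow> f \<in> tagged" "f \<bowtie> h \<Longrightarrow> h \<in> tagged"
proof -
  show 1: "f \<in> tagged" if "f \<bowtie> h" for f h using that by (auto simp: tagged_def equidec_def)
  show "h \<in> tagged" if "f \<bowtie> h" using 1[OF equidec_sym[OF that]] .
qed

lemma embeds_trans: assumes "f \<preceq> h" "h \<preceq> k" shows "f \<preceq> k"
proof -
  obtain Ws Vs where "moves Ws" "f = dsum Ws" "rsum Ws \<le> h" "moves Vs" "h = dsum Vs" "rsum Vs \<le> k"
    using assms by (auto simp: embeds_def)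
  moreover from this obtain Us Vs' where
      "moves Us" "dsum Us = dsum Ws" "rsum Us + rsum Vs' = rsum Vs"
    using compose_moves[of Vs Ws] by blast
  moreover from this(3) have "rsum Us \<le> rsum Vs" by (metis le_fun_def le_add1 plus_fun_apply)
  ultimately show ?thesis unfolding embeds_def by (metis order_trans)
qed

text \<open>The remainder in the composition vanishes, since nothing of the second list is left over.\<close>

lemma equidec_trans: assumes "f \<bowtie> h" "h \<bowtie> k" shows "f \<bowtie> k"
proof -
  obtain Ws Vs where 1: "moves Ws" "f = dsum Ws" "rsum Ws = h" "moves Vs" "h = dsum Vs" "rsum Vs = k"
    using assms unfolding equidec_def by metis
  then obtain Us Vs' where
      2: "moves Us" "dsum Us = dsum Ws" "rsum Us + rsum Vs' = rsum Vs" "dsum Vs' + rsum Ws = dsum Vs"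
    using compose_moves[of Vs Ws] order_refl by metis
  have "dsum Vs' + h = 0 + h" using 2 1 by simp
  then have "dsum Vs' = 0" using add_right_cancel by blast
  then have "rsum Vs' = 0" by (rule rsum_zero_if_dsum_zero)
  then show ?thesis unfolding equidec_def using 1 2 by auto
qed

lemma embeds_add: assumes "f \<preceq> h" "f' \<preceq> h'" shows "f + f' \<preceq> h + h'"
proof -
  obtain L L' where "moves L" "dsum L = f" "rsum L \<le> h" "moves L'" "dsum L' = f'" "rsum L' \<le> h'"
    using assms by (auto simp: embeds_def)
  then show ?thesis unfolding embeds_def by (intro exI[of _ "L @ L'"]) (auto intro: add_mono)
qed

lemma equidec_add: assumes "f \<bowtie> h" "f' \<bowtie> h'" shows "f + f' \<bowtie> h + h'"
proof -
  obtain L L' where "moves L" "dsum L = f" "rsum L = h" "moves L'" "dsum L' = f'" "rsum L' = h'"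
    using assms by (auto simp: equidec_def)
  then show ?thesis unfolding equidec_def by (intro exI[of _ "L @ L'"]) auto
qed

lemma tagged_zero: "0 \<in> tagged" and tagged_add: "f \<in> tagged \<Longrightarrow> h \<in> tagged \<Longrightarrow> f + h \<in> tagged"
proof -
  show "0 \<in> tagged" unfolding tagged_def by (rule image_eqI[of _ _ "[]"]) auto
  show "f \<in> tagged \<Longrightarrow> h \<in> tagged \<Longrightarrow> f + h \<in> tagged"
    unfolding tagged_def by (auto intro!: image_eqI[of _ _ "_ @ _"] simp: dsum_simps(3)[symmetric] simp del: dsum_simps)
qed

lemma tagged_nsum: "f \<in> tagged \<Longrightarrow> nsum n f \<in> tagged"
  by (induction n) (simp_all add: tagged_zero tagged_add del: sum_constant)

lemma embeds_nsum: "f \<preceq> h \<Longrightarrow> nsum n f \<preceq> nsum n h"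
  by (induction n) (simp_all add: embeds_add embeds_refl tagged_zero del: sum_constant)

lemma embeds_sum: "finite I \<Longrightarrow> (\<And>i. i \<in> I \<Longrightarrow> f i \<preceq> h i) \<Longrightarrow> (\<Sum>i\<in>I. f i) \<preceq> (\<Sum>i\<in>I. h i)"
  by (induction I rule: finite_induct) (simp_all add: embeds_add embeds_refl tagged_zero)

lemma zero_embeds: "0 \<preceq> f"
  by (rule embeds_le[OF tagged_zero]) (simp add: le_fun_def)

lemma equidec_move: "W \<in> cobs \<Longrightarrow> indicator (s ` W \<times> {n}) \<bowtie> indicator (r ` W \<times> {m})"
  unfolding equidec_def by (intro exI[of _ "[(W, n, m)]"]) simp

lemma equidec_retag: "A \<in> copens \<Longrightarrow> indicator (A \<times> {n}) \<bowtie> indicator (A \<times> {m})"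
  using equidec_move[OF copens_cob, of A n m] by (simp add: copens_image)

lemma tagged_indicator: "A \<in> copens \<Longrightarrow> indicator (A \<times> {n}) \<in> tagged"
  using equidec_retag tagged_if_equidec(1) by blast

lemma equidec_levels:
  assumes "A \<in> copens" "finite I"
  shows "indicator (A \<times> I) \<bowtie> nsum (card I) (indicator (A \<times> {m}))"
  using assms(2)
proof (induction I rule: finite_induct)
  case empty
  show ?case
    unfolding Sigma_empty2 indicator_empty_fun card.empty lessThan_0 sum.empty
    by (rule equidec_refl[OF tagged_zero])
next
  case (insert i I)
  have "indicator (A \<times> insert i I) = indicator (A \<times> I) + (indicator (A \<times> {i}) :: _ \<Rightarrow> nat)"
    using insert by (intro indicator_split) auto
  moreover have "nsum (card (insert i I)) (indicator (A \<times> {m}) :: _ \<Rightarrow> nat)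
      = nsum (card I) (indicator (A \<times> {m})) + indicator (A \<times> {m})"
    using insert by (simp del: sum_constant)
  ultimately show ?case
    using equidec_add[OF insert.IH equidec_retag[OF assms(1), of i m]] by (simp only:)
qed

text \<open>Composing with the identity moves of \<^term>\<open>f\<close> splits the embedding; the part that moves
  \<^term>\<open>a\<close> occupies a nonzero part of \<^term>\<open>h\<close>, which the part that moves \<^term>\<open>f\<close> misses.\<close>

lemma proper_embedding:
  assumes "f + a \<preceq> h" "f \<in> tagged" "a \<noteq> 0"
  shows "\<exists>L. moves L \<and> dsum L = f \<and> rsum L \<le> h \<and> rsum L \<noteq> h"
proof -
  obtain Vs where V: "moves Vs" "dsum Vs = f + a" "rsum Vs \<le> h" using assms by (auto simp: embeds_def)
  obtain Ws where W: "moves Ws" "dsum Ws = f" "rsum Ws = f" using assms tagged_identity by metis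
  have "rsum Ws \<le> dsum Vs" using V W by (simp add: le_fun_def)
  then obtain Us Vs' where U: "moves Us" "dsum Us = f" "rsum Us + rsum Vs' = rsum Vs"
      "dsum Vs' + f = f + a"
    using compose_moves[OF V(1) W(1)] unfolding V(2) W(2,3) by blast
  have "f + dsum Vs' = f + a" using U(4) by (simp add: add.commute)
  then have "dsum Vs' = a" using add_left_cancel by blast
  then have "rsum Vs' \<noteq> 0" using dsum_zero_if_rsum_zero assms(3) by blast
  then have "rsum Us \<noteq> rsum Vs" "rsum Us \<le> rsum Vs"
    unfolding U(3)[symmetric] by (auto simp: le_fun_def)
  then show ?thesis using U V by (metis order_trans order_antisym)
qed

text \<open>The sources may overlap. Each bisection is therefore restricted to the sources that the other
  ones have not covered, which only shrinks its range.\<close>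

lemma embeds_cover:
  assumes "finite J" "\<And>j. j \<in> J \<Longrightarrow> V j \<in> cobs"
  shows "indicator ((\<Union>j\<in>J. s ` V j) \<times> {n}) \<preceq> (\<Sum>j\<in>J. indicator (r ` V j \<times> {m j}))"
  using assms
proof (induction J rule: finite_induct)
  case empty
  show ?case unfolding UN_empty Sigma_empty1 sum.empty indicator_empty_fun by (rule zero_embeds)
next
  case (insert i J)
  let ?U = "\<Union>j\<in>J. s ` V j"
  have "closed ?U" "open ?U" using insert cobD by (auto intro!: closed_UN open_UN compact_imp_closed)
  then have W: "{g \<in> V i. s g \<in> - ?U} \<in> cobs"
    using insert.prems by (intro cob_restrict_src open_Compl closed_Compl) simp_all
  have a: "indicator ((\<Union>j\<in>insert i J. s ` V j) \<times> {n})
      = indicator (s ` {g \<in> V i. s g \<in> - ?U} \<times> {n}) + (indicator (?U \<times> {n}) :: _ \<Rightarrow> nat)"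
    by (rule indicator_split) auto
  have b: "indicator (s ` {g \<in> V i. s g \<in> - ?U} \<times> {n}) \<preceq> indicator (r ` V i \<times> {m i})"
    by (rule embeds_mono[OF equidec_embeds[OF equidec_move[OF W]]]) (auto intro!: indicator_mono_fun)
  have c: "indicator (?U \<times> {n}) \<preceq> (\<Sum>j\<in>J. indicator (r ` V j \<times> {m j}))"
    by (intro insert.IH insert.prems insertI2)
  show ?case unfolding sum.insert[OF insert.hyps(1,2)] a by (rule embeds_add[OF b c])
qed


section \<open>Equidecomposability and paradoxical sets\<close>

lemma equidec_levels_atLeastAtMost:
  "A \<in> copens \<Longrightarrow> indicator (A \<times> {1..k}) \<bowtie> nsum k (indicator (A \<times> {1}))"
  using equidec_levels[OF _ finite_atLeastAtMost[of 1 k], of A 1]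
  unfolding card_atLeastAtMost diff_Suc_1 .

text \<open>The pairwise disjoint ranges of a paradoxical decomposition fit into \<open>l\<close> levels over \<open>A\<close>, while
  its sources cover each of \<open>k\<close> levels.\<close>

lemma embeds_if_paradoxical:
  assumes "paradoxical G k l A" "A \<in> copens"
  shows "nsum k (indicator (A \<times> {1})) \<preceq> nsum l (indicator (A \<times> {1}))"
proof -
  obtain n :: "nat \<Rightarrow> nat" and V :: "nat \<Rightarrow> nat \<Rightarrow> 'a set" and m :: "nat \<Rightarrow> nat \<Rightarrow> nat"
    where *: "\<forall>i\<in>{1..k}. \<forall>j\<in>{1..n i}. V i j \<in> cobs \<and> m i j \<in> {1..l} \<and> r ` V i j \<subseteq> A"
      and A: "\<forall>i\<in>{1..k}. (\<Union>j\<in>{1..n i}. s ` V i j) = A"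
      and disj: "disjoint_family_on (\<lambda>(i, j). (r ` V i j) \<times> {m i j}) (SIGMA i:{1..k}. {1..n i})"
    using assms(1) unfolding paradoxical_def by blast
  let ?S = "SIGMA i:{1..k}. {1..n i}"
  have 1: "(\<Sum>i\<in>{1..k}. indicator (A \<times> {i})) \<preceq> (\<Sum>i\<in>{1..k}. \<Sum>j\<in>{1..n i}. indicator (r ` V i j \<times> {m i j}))"
  proof (rule embeds_sum)
    fix i assume i: "i \<in> {1..k}"
    have Vc: "\<And>j. j \<in> {1..n i} \<Longrightarrow> V i j \<in> cobs" using * i by blast
    have "indicator ((\<Union>j\<in>{1..n i}. s ` V i j) \<times> {i}) \<preceq> (\<Sum>j\<in>{1..n i}. indicator (r ` V i j \<times> {m i j}))"
      by (rule embeds_cover[of "{1..n i}" "V i" i "m i", OF finite_atLeastAtMost Vc])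
    then show "indicator (A \<times> {i}) \<preceq> (\<Sum>j\<in>{1..n i}. indicator (r ` V i j \<times> {m i j}))"
      using A i by simp
  qed simp
  have e1: "(\<Sum>i\<in>{1..k}. indicator (A \<times> {i})) = (indicator (A \<times> {1..k}) :: _ \<Rightarrow> nat)"
  proof -
    have "(\<Union>i\<in>{1..k}. A \<times> {i}) = A \<times> {1..k}" by auto
    moreover have "disjoint_family_on (\<lambda>i. A \<times> {i}) {1..k}" by (auto simp: disjoint_family_on_def)
    ultimately show ?thesis
      using sum_indicator_disjoint[of "{1..k}" "\<lambda>i. A \<times> {i}"] by simp
  qed
  have "(\<Sum>i\<in>{1..k}. \<Sum>j\<in>{1..n i}. indicator (r ` V i j \<times> {m i j}))
      = (\<Sum>p\<in>?S. indicator ((\<lambda>(i, j). (r ` V i j) \<times> {m i j}) p) :: _ \<Rightarrow> nat)"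
    by (subst sum.Sigma) (auto intro!: sum.cong)
  also have "\<dots> = indicator (\<Union>p\<in>?S. (\<lambda>(i, j). (r ` V i j) \<times> {m i j}) p)"
    by (rule sum_indicator_disjoint[OF _ disj]) simp
  finally have e2: "(\<Sum>i\<in>{1..k}. \<Sum>j\<in>{1..n i}. indicator (r ` V i j \<times> {m i j}))
      = (indicator (\<Union>p\<in>?S. (\<lambda>(i, j). (r ` V i j) \<times> {m i j}) p) :: _ \<Rightarrow> nat)" .
  have "(\<Union>p\<in>?S. (\<lambda>(i, j). (r ` V i j) \<times> {m i j}) p) \<subseteq> A \<times> {1..l}" using * by fastforce
  then have "indicator (A \<times> {1..k}) \<preceq> indicator (A \<times> {1..l})"
    using embeds_mono[OF 1[unfolded e1 e2]] indicator_mono_fun by blast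
  then show ?thesis
    using equidec_levels_atLeastAtMost[OF assms(2)] embeds_trans equidec_embeds equidec_sym by blast
qed

lemma dsum_conv_sum: "dsum L = (\<Sum>p<length L. indicator (tsrc (L ! p)))"
  and rsum_conv_sum: "rsum L = (\<Sum>p<length L. indicator (trng (L ! p)))"
  unfolding dsum_def rsum_def sum_list_sum_nth length_map atLeast0LessThan by (auto intro!: sum.cong)

text \<open>An embedding of \<open>k\<close> levels over \<open>A\<close> into \<open>l\<close> of them is a list of moves; sorting it by the source
  levels gives the double family of bisections.\<close>

lemma paradoxical_if_embeds:
  assumes "nsum k (indicator (A \<times> {1})) \<preceq> nsum l (indicator (A \<times> {1}))" "A \<in> copens" "A \<noteq> {}"
  shows "paradoxical G k l A"
proof -
  have "indicator (A \<times> {1..k}) \<preceq> indicator (A \<times> {1..l})"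
    using equidec_levels_atLeastAtMost[OF assms(2)] embeds_trans equidec_embeds equidec_sym assms(1)
    by blast
  then obtain L0 where L0: "moves L0" "dsum L0 = indicator (A \<times> {1..k})" "rsum L0 \<le> indicator (A \<times> {1..l})"
    unfolding embeds_def by blast
  \<comment> \<open>An empty bisection may carry an arbitrary tag, so it is removed.\<close>
  define L where "L = filter (\<lambda>t. fst t \<noteq> {}) L0"
  have "dsum L = dsum L0 \<and> rsum L = rsum L0"
    unfolding L_def by (induction L0) (auto simp: tsrc_def trng_def indicator_empty_fun)
  then have L: "moves L" "dsum L = indicator (A \<times> {1..k})" "rsum L \<le> indicator (A \<times> {1..l})"
      "\<And>t. t \<in> set L \<Longrightarrow> fst t \<noteq> {}"
    using L0 by (auto simp: L_def moves_def)
  define I where "I i = {p. p < length L \<and> fst (snd (L ! p)) = i}" for i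
  have finI: "finite (I i)" for i by (simp add: I_def)
  have "\<forall>i. \<exists>h. bij_betw h {1..card (I i)} (I i)" using ex_bij_betw_nat_finite_1[OF finI] by blast
  then obtain h where h: "\<And>i. bij_betw (h i) {1..card (I i)} (I i)" by metis
  have hI: "h i j \<in> I i" if "j \<in> {1..card (I i)}" for i j using h[of i] that by (auto simp: bij_betw_def)
  have len: "h i j < length L" "fst (snd (L ! h i j)) = i" if "j \<in> {1..card (I i)}" for i j
    using hI[OF that] by (auto simp: I_def)
  have dL: "(\<Union>p<length L. tsrc (L ! p)) = A \<times> {1..k}"
    by (rule Union_of_sum_indicator) (use L(2) in \<open>simp_all add: dsum_conv_sum\<close>)
  have rL: "disjoint_family_on (\<lambda>p. trng (L ! p)) {..<length L}"
    by (rule disjoint_of_sum_indicator_le) (use L(3) in \<open>simp_all add: rsum_conv_sum\<close>)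
  have rsub: "trng (L ! p) \<subseteq> A \<times> {1..l}" if "p < length L" for p
  proof -
    have "(\<Union>p<length L. trng (L ! p)) \<subseteq> A \<times> {1..l}"
    proof
      fix x assume x: "x \<in> (\<Union>p<length L. trng (L ! p))"
      have "rsum L = indicator (\<Union>p<length L. trng (L ! p))"
        unfolding rsum_conv_sum by (rule sum_indicator_disjoint[OF _ rL]) simp
      then have "rsum L x = 1" using x by simp
      then have "indicator (A \<times> {1..l}) x \<ge> (1::nat)" using L(3) by (metis le_fun_def)
      then show "x \<in> A \<times> {1..l}" by (cases "x \<in> A \<times> {1..l}") (simp_all only: indicator_simps, simp)
    qed
    then show ?thesis using that by blast
  qed
  define V where "V i j = fst (L ! h i j)" for i j
  define m where "m i j = snd (snd (L ! h i j))" for i j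
  show ?thesis
    unfolding paradoxical_def
  proof (intro conjI exI ballI)
    show "A \<noteq> {}" "A \<subseteq> U0" using assms copensD(1) by auto
    fix i assume i: "i \<in> {1..k}"
    {
      fix j assume j: "j \<in> {1..card (I i)}"
      have "L ! h i j \<in> set L" using len[OF j] by simp
      then show "V i j \<in> cobs" using L(1) by (simp add: V_def moves_def)
      have ne: "V i j \<noteq> {}" using L(4) \<open>L ! h i j \<in> set L\<close> by (simp add: V_def)
      have "r ` V i j \<times> {m i j} \<subseteq> A \<times> {1..l}"
        using rsub[OF len(1)[OF j]] by (simp add: trng_def V_def m_def)
      then show "m i j \<in> {1..l}" "r ` V i j \<subseteq> A" using ne by blast+
    }
    show "(\<Union>j\<in>{1..card (I i)}. s ` V i j) = A"
    proof (intro set_eqI iffI)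
      fix x assume "x \<in> (\<Union>j\<in>{1..card (I i)}. s ` V i j)"
      then obtain j where j: "j \<in> {1..card (I i)}" "x \<in> s ` V i j" by blast
      then have "(x, i) \<in> tsrc (L ! h i j)" using len(2)[OF j(1)] by (simp add: tsrc_def V_def)
      then show "x \<in> A" using dL len(1)[OF j(1)] by blast
    next
      fix x assume "x \<in> A"
      then have "(x, i) \<in> (\<Union>p<length L. tsrc (L ! p))" unfolding dL using i by simp
      then obtain p where p: "p < length L" "(x, i) \<in> tsrc (L ! p)" by blast
      then have "p \<in> I i" "x \<in> s ` fst (L ! p)" by (auto simp: I_def tsrc_def)
      moreover then obtain j where "j \<in> {1..card (I i)}" "p = h i j"
        by (metis bij_betw_imp_surj_on[OF h] imageE)
      ultimately show "x \<in> (\<Union>j\<in>{1..card (I i)}. s ` V i j)" by (auto simp: V_def)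
    qed
  next
    show "disjoint_family_on (\<lambda>(i, j). r ` V i j \<times> {m i j}) (SIGMA i:{1..k}. {1..card (I i)})"
      unfolding disjoint_family_on_def
    proof (intro ballI impI)
      fix p q assume pq: "p \<in> (SIGMA i:{1..k}. {1..card (I i)})" "q \<in> (SIGMA i:{1..k}. {1..card (I i)})" "p \<noteq> q"
      obtain i j where p: "p = (i, j)" by (cases p)
      obtain i' j' where q: "q = (i', j')" by (cases q)
      have j: "j \<in> {1..card (I i)}" "j' \<in> {1..card (I i')}" using pq p q by auto
      have "h i j \<noteq> h i' j'"
      proof
        assume eq: "h i j = h i' j'"
        then have i: "i = i'" using len(2)[OF j(1)] len(2)[OF j(2)] by simp
        have "j' \<in> {1..card (I i)}" "h i j = h i j'" using i j eq by simp_all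
        then have "j = j'" using inj_onD[OF bij_betw_imp_inj_on[OF h[of i]]] j(1) by blast
        then show False using pq p q i by simp
      qed
      then have "trng (L ! h i j) \<inter> trng (L ! h i' j') = {}"
        using rL len(1)[OF j(1)] len(1)[OF j(2)] unfolding disjoint_family_on_def by blast
      then show "(case p of (i, j) \<Rightarrow> r ` V i j \<times> {m i j}) \<inter> (case q of (i, j) \<Rightarrow> r ` V i j \<times> {m i j}) = {}"
        by (simp add: p q trng_def V_def m_def)
    qed
  qed
qed

end

section \<open>The type semigroup\<close>

context etale_groupoid
begin

lemma tagged_sum: "finite I \<Longrightarrow> (\<And>i. i \<in> I \<Longrightarrow> f i \<in> tagged) \<Longrightarrow> (\<Sum>i\<in>I. f i) \<in> tagged"
  by (induction I rule: finite_induct) (simp_all add: tagged_zero tagged_add)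

lemma equidec_sum: assumes "finite I" "\<And>i. i \<in> I \<Longrightarrow> f i \<bowtie> h i" shows "(\<Sum>i\<in>I. f i) \<bowtie> (\<Sum>i\<in>I. h i)"
  using assms
proof (induction I rule: finite_induct)
  case empty
  show ?case unfolding sum.empty by (rule equidec_refl[OF tagged_zero])
next
  case (insert i I)
  have "f i \<bowtie> h i" "(\<Sum>i\<in>I. f i) \<bowtie> (\<Sum>i\<in>I. h i)" using insert by blast+
  then show ?case unfolding sum.insert[OF insert.hyps(1,2)] by (rule equidec_add)
qed

lemma ts_setsE:
  assumes "A \<in> ts_sets G"
  obtains N B where "\<And>i. i \<in> {1..N} \<Longrightarrow> B i \<in> copens" "A = (\<Union>i\<in>{1..N}. B i \<times> {i})"
    "(indicator A :: _ \<Rightarrow> nat) = (\<Sum>i\<in>{1..N}. indicator (B i \<times> {i}))"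
proof -
  obtain N and B :: "nat \<Rightarrow> 'a set" where A: "A = (\<Union>i\<in>{1..N}. B i \<times> {i})"
      and B: "\<forall>i\<in>{1..N}. B i \<subseteq> U0 \<and> compact (B i) \<and> open (B i)"
    using assms unfolding ts_sets_def by blast
  have "disjoint_family_on (\<lambda>i. B i \<times> {i}) {1..N}" by (auto simp: disjoint_family_on_def)
  then have "(indicator A :: _ \<Rightarrow> nat) = (\<Sum>i\<in>{1..N}. indicator (B i \<times> {i}))"
    unfolding A by (intro sum_indicator_disjoint[symmetric]) simp_all
  then show ?thesis using that[of N B] A B by (simp add: copens_def)
qed

lemma ts_setsI:
  assumes "A \<subseteq> UNIV \<times> {1..N}" "\<And>i. {x. (x, i) \<in> A} \<in> copens"
  shows "A \<in> ts_sets G"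
proof -
  have "A = (\<Union>i\<in>{1..N}. {x. (x, i) \<in> A} \<times> {i})" using assms(1) by auto
  moreover have "\<forall>i\<in>{1..N}. {x. (x, i) \<in> A} \<subseteq> U0 \<and> compact {x. (x, i) \<in> A} \<and> open {x. (x, i) \<in> A}"
    using copensD(1-3)[OF assms(2)] by simp
  ultimately show ?thesis
    unfolding ts_sets_def by (intro CollectI exI[of _ N] exI[of _ "\<lambda>i. {x. (x, i) \<in> A}"] conjI)
qed

lemma ts_sets_slice: assumes "A \<in> ts_sets G" shows "{x. (x, i) \<in> A} \<in> copens"
proof -
  obtain N and B :: "nat \<Rightarrow> 'a set" where B: "\<And>i. i \<in> {1..N} \<Longrightarrow> B i \<in> copens" "A = (\<Union>i\<in>{1..N}. B i \<times> {i})"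
    using ts_setsE[OF assms] by metis
  have "{x. (x, i) \<in> A} = (if i \<in> {1..N} then B i else {})" using B(2) by auto
  then show ?thesis using B(1) copens_empty by (cases "i \<in> {1..N}") simp_all
qed

lemma ts_sets_bounded: assumes "A \<in> ts_sets G" obtains N where "A \<subseteq> UNIV \<times> {1..N}"
proof -
  obtain N and B :: "nat \<Rightarrow> 'a set" where "A = (\<Union>i\<in>{1..N}. B i \<times> {i})"
    using ts_setsE[OF assms] by metis
  then have "A \<subseteq> UNIV \<times> {1..N}" by auto
  then show ?thesis by (rule that)
qed

lemma ts_sets_level: assumes "A \<in> copens" "1 \<le> n" shows "A \<times> {n} \<in> ts_sets G"
proof (rule ts_setsI[of _ n])
  fix i
  have "{x. (x, i) \<in> A \<times> {n}} = (if i = n then A else {})" by auto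
  then show "{x. (x, i) \<in> A \<times> {n}} \<in> copens" using assms copens_empty by simp
qed (use assms in auto)

lemma ts_sets_empty: "{} \<in> ts_sets G"
  by (rule ts_setsI[of _ 0]) (simp_all add: copens_empty)

lemma indicator_tagged: assumes "A \<in> ts_sets G" shows "indicator A \<in> tagged"
proof -
  obtain N and B :: "nat \<Rightarrow> 'a set" where B: "\<And>i. i \<in> {1..N} \<Longrightarrow> B i \<in> copens" "A = (\<Union>i\<in>{1..N}. B i \<times> {i})"
      "(indicator A :: _ \<Rightarrow> nat) = (\<Sum>i\<in>{1..N}. indicator (B i \<times> {i}))"
    using ts_setsE[OF assms] by blast
  show ?thesis unfolding B(3) by (intro tagged_sum tagged_indicator B(1)) simp_all
qed

lemma indicator_shift: assumes "B \<in> ts_sets G" shows "indicator (shift n B) \<bowtie> indicator B"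
proof -
  obtain N and C :: "nat \<Rightarrow> 'a set" where C: "\<And>i. i \<in> {1..N} \<Longrightarrow> C i \<in> copens" "B = (\<Union>i\<in>{1..N}. C i \<times> {i})"
      "(indicator B :: _ \<Rightarrow> nat) = (\<Sum>i\<in>{1..N}. indicator (C i \<times> {i}))"
    using ts_setsE[OF assms] by blast
  have "shift n B = (\<Union>i\<in>{1..N}. C i \<times> {n + i})" unfolding C(2) shift_def by auto
  moreover have "disjoint_family_on (\<lambda>i. C i \<times> {n + i}) {1..N}" by (auto simp: disjoint_family_on_def)
  ultimately have e: "(indicator (shift n B) :: _ \<Rightarrow> nat) = (\<Sum>i\<in>{1..N}. indicator (C i \<times> {n + i}))"
    using sum_indicator_disjoint[of "{1..N}" "\<lambda>i. C i \<times> {n + i}"] by (simp only: finite_atLeastAtMost)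
  show ?thesis unfolding e C(3) by (intro equidec_sum equidec_retag C(1)) simp_all
qed

text \<open>A union is disjoint iff the indicator functions of its members add up to an indicator function, so
  that the two disjoint decompositions in the relation are the two sums of a list of moves.\<close>

lemma ts_equiv_iff:
  "(A, B) \<in> ts_equiv G \<longleftrightarrow> A \<in> ts_sets G \<and> B \<in> ts_sets G \<and> indicator A \<bowtie> indicator B"
proof
  assume "(A, B) \<in> ts_equiv G"
  then obtain l and W :: "nat \<Rightarrow> 'a set" and n m where AB: "A \<in> ts_sets G" "B \<in> ts_sets G"
      and W: "\<forall>k\<in>{1..l}. W k \<in> cobs"
      and A: "A = (\<Union>k\<in>{1..l}. (s ` W k) \<times> {n k})"
      and dA: "disjoint_family_on (\<lambda>k. (s ` W k) \<times> {n k}) {1..l}"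
      and B: "B = (\<Union>k\<in>{1..l}. (r ` W k) \<times> {m k})"
      and dB: "disjoint_family_on (\<lambda>k. (r ` W k) \<times> {m k}) {1..l}"
    unfolding ts_equiv_def by blast
  let ?L = "map (\<lambda>k. (W k, n k, m k)) [1..<Suc l]"
  have "moves ?L" using W by (auto simp: moves_def)
  moreover have "dsum ?L = indicator A"
    unfolding dsum_def map_map interv_sum_list_conv_sum_set_nat set_upt
      atLeastLessThanSuc_atLeastAtMost o_def tsrc_simp A
    by (rule sum_indicator_disjoint[OF _ dA]) simp
  moreover have "rsum ?L = indicator B"
    unfolding rsum_def map_map interv_sum_list_conv_sum_set_nat set_upt
      atLeastLessThanSuc_atLeastAtMost o_def trng_simp B
    by (rule sum_indicator_disjoint[OF _ dB]) simp
  ultimately show "A \<in> ts_sets G \<and> B \<in> ts_sets G \<and> indicator A \<bowtie> indicator B"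
    using AB unfolding equidec_def by blast
next
  assume AB: "A \<in> ts_sets G \<and> B \<in> ts_sets G \<and> indicator A \<bowtie> indicator B"
  then obtain L where L: "moves L" "dsum L = indicator A" "rsum L = indicator B"
    unfolding equidec_def by blast
  let ?W = "\<lambda>k. fst (L ! (k - 1))" and ?n = "\<lambda>k. fst (snd (L ! (k - 1)))"
    and ?m = "\<lambda>k. snd (snd (L ! (k - 1)))"
  have d: "(\<Sum>k\<in>{1..length L}. indicator (s ` ?W k \<times> {?n k})) = (indicator A :: _ \<Rightarrow> nat)"
    using L(2) unfolding dsum_conv_sum One_nat_def sum.atLeast1_atMost_eq tsrc_def by simp
  have r': "(\<Sum>k\<in>{1..length L}. indicator (r ` ?W k \<times> {?m k})) = (indicator B :: _ \<Rightarrow> nat)"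
    using L(3) unfolding rsum_conv_sum One_nat_def sum.atLeast1_atMost_eq trng_def by simp
  have "\<forall>k\<in>{1..length L}. ?W k \<in> cobs"
  proof
    fix k assume "k \<in> {1..length L}"
    then have "L ! (k - 1) \<in> set L" by (intro nth_mem) auto
    then show "?W k \<in> cobs" using L(1) by (simp add: moves_def)
  qed
  moreover have "A = (\<Union>k\<in>{1..length L}. (s ` ?W k) \<times> {?n k})"
    "B = (\<Union>k\<in>{1..length L}. (r ` ?W k) \<times> {?m k})"
    using Union_of_sum_indicator[OF _ d] Union_of_sum_indicator[OF _ r'] by simp_all
  moreover have "disjoint_family_on (\<lambda>k. (s ` ?W k) \<times> {?n k}) {1..length L}"
    by (rule disjoint_of_sum_indicator_le[where B = A]) (use d in simp_all)
  moreover have "disjoint_family_on (\<lambda>k. (r ` ?W k) \<times> {?m k}) {1..length L}"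
    by (rule disjoint_of_sum_indicator_le[where B = B]) (use r' in simp_all)
  ultimately have "\<exists>(l :: nat) (W :: nat \<Rightarrow> 'a set) (n :: nat \<Rightarrow> nat) (m :: nat \<Rightarrow> nat).
        (\<forall>k\<in>{1..l}. W k \<in> cobs) \<and>
        A = (\<Union>k\<in>{1..l}. (s ` W k) \<times> {n k}) \<and>
        disjoint_family_on (\<lambda>k. (s ` W k) \<times> {n k}) {1..l} \<and>
        B = (\<Union>k\<in>{1..l}. (r ` W k) \<times> {m k}) \<and>
        disjoint_family_on (\<lambda>k. (r ` W k) \<times> {m k}) {1..l}"
    by (intro exI[of _ "length L"] exI[of _ ?W] exI[of _ ?n] exI[of _ ?m] conjI)
  then show "(A, B) \<in> ts_equiv G" using AB unfolding ts_equiv_def by blast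
qed

lemma mem_ts_class: "B \<in> ts_class G A \<longleftrightarrow> (A, B) \<in> ts_equiv G"
  by (simp add: ts_class_def)

lemma ts_class_eqI:
  assumes "A \<in> ts_sets G" "B \<in> ts_sets G" "indicator A \<bowtie> indicator B"
  shows "ts_class G A = ts_class G B"
  unfolding set_eq_iff mem_ts_class ts_equiv_iff
  using assms equidec_sym equidec_trans by blast

lemma self_mem_ts_class: "A \<in> ts_sets G \<Longrightarrow> A \<in> ts_class G A"
  unfolding mem_ts_class ts_equiv_iff using equidec_refl[OF indicator_tagged] by blast

lemma indicator_Un_shift:
  assumes "A \<in> ts_sets G" "B \<in> ts_sets G" "A \<subseteq> UNIV \<times> {1..n}"
  shows "A \<union> shift n B \<in> ts_sets G" "indicator (A \<union> shift n B) \<bowtie> indicator A + indicator B"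
proof -
  obtain M where M: "B \<subseteq> UNIV \<times> {1..M}" using ts_sets_bounded[OF assms(2)] by blast
  show "A \<union> shift n B \<in> ts_sets G"
  proof (rule ts_setsI[of _ "n + M"])
    show "A \<union> shift n B \<subseteq> UNIV \<times> {1..n + M}" using assms(3) M by (fastforce simp: shift_def)
    fix i
    have "{x. (x, i) \<in> A \<union> shift n B}
        = {x. (x, i) \<in> A} \<union> (if n \<le> i then {x. (x, i - n) \<in> B} else {})"
      by (force simp: shift_def)
    then show "{x. (x, i) \<in> A \<union> shift n B} \<in> copens"
      using ts_sets_slice[OF assms(1), of i] ts_sets_slice[OF assms(2), of "i - n"]
      by (cases "n \<le> i") (simp_all add: copens_Un)
  qed
  have "A \<inter> shift n B = {}" using assms(3) M by (fastforce simp: shift_def)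
  then have e: "indicator (A \<union> shift n B) = indicator A + (indicator (shift n B) :: _ \<Rightarrow> nat)"
    by (intro indicator_split) simp_all
  show "indicator (A \<union> shift n B) \<bowtie> indicator A + indicator B"
    unfolding e by (intro equidec_add equidec_refl indicator_tagged indicator_shift assms)
qed

text \<open>All members of the union that defines the sum coincide, because shifting a set to other levels does
  not change its class.\<close>

lemma ts_add_class:
  assumes "A \<in> ts_sets G" "B \<in> ts_sets G" "C \<in> ts_sets G" "indicator C \<bowtie> indicator A + indicator B"
  shows "ts_add G (ts_class G A) (ts_class G B) = ts_class G C"
proof -
  have eq: "ts_class G (A' \<union> shift n B') = ts_class G C"
    if "A' \<in> ts_class G A" "B' \<in> ts_class G B" "A' \<subseteq> UNIV \<times> {1..n}" for A' B' n
  proof -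
    have *: "A' \<in> ts_sets G" "indicator A \<bowtie> indicator A'" "B' \<in> ts_sets G" "indicator B \<bowtie> indicator B'"
      using that unfolding mem_ts_class ts_equiv_iff by blast+
    have "indicator (A' \<union> shift n B') \<bowtie> indicator A' + indicator B'"
      by (rule indicator_Un_shift(2)[OF *(1,3) that(3)])
    moreover have "indicator A' + indicator B' \<bowtie> indicator A + indicator B"
      by (intro equidec_add equidec_sym[OF *(2)] equidec_sym[OF *(4)])
    ultimately have "indicator (A' \<union> shift n B') \<bowtie> indicator C"
      using equidec_trans equidec_sym[OF assms(4)] by blast
    then show ?thesis
      by (rule ts_class_eqI[OF indicator_Un_shift(1)[OF *(1,3) that(3)] assms(3)])
  qed
  obtain n where n: "A \<subseteq> UNIV \<times> {1..n}" using ts_sets_bounded[OF assms(1)] by blast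
  show ?thesis
  proof (intro set_eqI iffI)
    fix x assume "x \<in> ts_add G (ts_class G A) (ts_class G B)"
    then show "x \<in> ts_class G C" unfolding ts_add_def using eq by blast
  next
    fix x assume "x \<in> ts_class G C"
    then have "x \<in> ts_class G (A \<union> shift n B)"
      using eq[OF self_mem_ts_class[OF assms(1)] self_mem_ts_class[OF assms(2)] n] by simp
    then show "x \<in> ts_add G (ts_class G A) (ts_class G B)"
      unfolding ts_add_def using self_mem_ts_class[OF assms(1)] self_mem_ts_class[OF assms(2)] n
      by blast
  qed
qed

lemma pm_elems_type_semigroup: "pm_elems (type_semigroup G) = ts_class G ` ts_sets G"
  by (auto simp: type_semigroup_def quotient_def ts_class_def)

lemma type_semigroup_simps: "pm_add (type_semigroup G) = ts_add G" "pm_zero (type_semigroup G) = ts_class G {}"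
  "pm_le (type_semigroup G) x y \<longleftrightarrow> (\<exists>z\<in>pm_elems (type_semigroup G). y = ts_add G x z)"
  by (simp_all add: type_semigroup_def)

text \<open>A function that is monotone for embeddings is constant on the classes, so that an arbitrary
  representative may be chosen.\<close>

definition class_state :: "(('a \<times> nat \<Rightarrow> nat) \<Rightarrow> real) \<Rightarrow> ('a \<times> nat) set set \<Rightarrow> ennreal" where
  "class_state q x = ennreal (q (indicator (SOME A. A \<in> x)))"

lemma class_state_class:
  assumes "\<And>f h. f \<in> tagged \<Longrightarrow> h \<in> tagged \<Longrightarrow> f \<preceq> h \<Longrightarrow> q f \<le> q h" "A \<in> ts_sets G"
  shows "class_state q (ts_class G A) = ennreal (q (indicator A))"
proof -
  let ?B = "SOME B. B \<in> ts_class G A"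
  have "?B \<in> ts_class G A" using self_mem_ts_class[OF assms(2)] by (rule someI)
  then have e: "indicator A \<bowtie> indicator ?B" unfolding mem_ts_class ts_equiv_iff by blast
  have "q (indicator A) = q (indicator ?B)"
    using assms(1)[OF tagged_if_equidec[OF e] equidec_embeds[OF e]]
      assms(1)[OF tagged_if_equidec[OF equidec_sym[OF e]] equidec_embeds[OF equidec_sym[OF e]]]
    by simp
  then show ?thesis by (simp add: class_state_def)
qed

lemma faithful_class_state:
  assumes nonneg: "\<And>f. f \<in> tagged \<Longrightarrow> 0 \<le> q f"
    and add: "\<And>f h. f \<in> tagged \<Longrightarrow> h \<in> tagged \<Longrightarrow> q (f + h) = q f + q h"
    and mono: "\<And>f h. f \<in> tagged \<Longrightarrow> h \<in> tagged \<Longrightarrow> f \<preceq> h \<Longrightarrow> q f \<le> q h"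
    and faithful: "\<And>f. f \<in> tagged \<Longrightarrow> q f = 0 \<Longrightarrow> f = 0"
  shows "faithful_monoid_state (type_semigroup G) (class_state q)"
proof -
  have cls: "class_state q (ts_class G A) = ennreal (q (indicator A))" if "A \<in> ts_sets G" for A
    by (rule class_state_class[OF mono that])
  have "q (0 + 0) = q 0 + q 0" by (intro add tagged_zero)
  then have q0: "q 0 = 0" by simp
  have zero: "class_state q (ts_class G {}) = 0"
    using cls[OF ts_sets_empty] unfolding indicator_empty_fun q0 by simp
  have add': "class_state q (ts_add G (ts_class G A) (ts_class G B))
      = class_state q (ts_class G A) + class_state q (ts_class G B)"
    if AB: "A \<in> ts_sets G" "B \<in> ts_sets G" for A B
  proof -
    obtain n where n: "A \<subseteq> UNIV \<times> {1..n}" using ts_sets_bounded[OF AB(1)] by blast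
    note C = indicator_Un_shift[OF AB n]
    have "class_state q (ts_add G (ts_class G A) (ts_class G B)) = ennreal (q (indicator (A \<union> shift n B)))"
      unfolding ts_add_class[OF AB C] by (rule cls[OF C(1)])
    also have "q (indicator (A \<union> shift n B)) = q (indicator A + indicator B)"
      using mono[OF tagged_if_equidec[OF C(2)] equidec_embeds[OF C(2)]]
        mono[OF tagged_if_equidec[OF equidec_sym[OF C(2)]] equidec_embeds[OF equidec_sym[OF C(2)]]]
      by simp
    also have "\<dots> = q (indicator A) + q (indicator B)"
      by (intro add indicator_tagged AB)
    also have "ennreal \<dots> = ennreal (q (indicator A)) + ennreal (q (indicator B))"
      by (intro ennreal_plus nonneg indicator_tagged AB)
    finally show ?thesis unfolding cls[OF AB(1)] cls[OF AB(2)] .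
  qed
  have faithful': "A = {}" if "A \<in> ts_sets G" "class_state q (ts_class G A) = 0" for A
  proof -
    have "ennreal (q (indicator A)) = 0" using that(2) unfolding cls[OF that(1)] .
    then have "q (indicator A) = 0"
      using nonneg[OF indicator_tagged[OF that(1)]] by (simp add: ennreal_eq_0_iff)
    then have "(indicator A :: _ \<Rightarrow> nat) = indicator {}"
      unfolding indicator_empty_fun by (rule faithful[OF indicator_tagged[OF that(1)]])
    then show ?thesis by (simp only: indicator_inject_fun)
  qed
  show ?thesis
    unfolding faithful_monoid_state_def monoid_state_def pm_elems_type_semigroup type_semigroup_simps
  proof (intro conjI ballI impI)
    show "class_state q (ts_class G {}) = 0" by (rule zero)
    fix x assume "x \<in> ts_class G ` ts_sets G"
    then obtain A where A: "A \<in> ts_sets G" "x = ts_class G A" by blast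
    show "x = ts_class G {}" if "class_state q x = 0"
      using faithful'[OF A(1)] that unfolding A(2) by simp
    fix y assume "y \<in> ts_class G ` ts_sets G"
    then obtain B where B: "B \<in> ts_sets G" "y = ts_class G B" by blast
    show "class_state q (ts_add G x y) = class_state q x + class_state q y"
      unfolding A(2) B(2) by (rule add'[OF A(1) B(1)])
    assume "\<exists>z\<in>ts_class G ` ts_sets G. y = ts_add G x z"
    then obtain C where C: "C \<in> ts_sets G" "y = ts_add G x (ts_class G C)" by blast
    have "class_state q y = class_state q x + class_state q (ts_class G C)"
      unfolding A(2) C(2) by (rule add'[OF A(1) C(1)])
    then show "class_state q x \<le> class_state q y" by simp
  qed
qed

end

lemma indicator_eq_zero_fun: "(indicator A :: 'x \<Rightarrow> nat) = 0 \<longleftrightarrow> A = {}"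
  by (simp only: indicator_empty_fun[symmetric] indicator_inject_fun)

section \<open>Consequences of minimality\<close>

context ample_groupoid
begin

text \<open>The units in the orbits of \<^term>\<open>A\<close> form a nonempty open set whose complement is invariant; by
  minimality the complement is empty.\<close>

lemma minimal_orbit_meets:
  assumes "minimal_groupoid G" "A \<in> copens" "A \<noteq> {}" "x \<in> U0"
  obtains g where "s g = x" "r g \<in> A"
proof -
  let ?S = "r ` (s -` A)"
  have "open (s -` A)"
    using assms(2) by (intro open_vimage continuous_on_src continuous_on_id) (rule copensD)
  then have "open ?S" by (rule open_rng_image)
  then have "closedin (top_of_set U0) (U0 - ?S)"
    by (simp add: closedin_closed_eq closed_unit_space closed_Diff)
  moreover have "invariant G (U0 - ?S)"
    unfolding invariant_def
  proof (intro conjI allI impI)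
    fix g assume g: "s g \<in> U0 - ?S"
    have "r g \<notin> ?S"
    proof
      assume "r g \<in> ?S"
      then obtain h where "r g = r h" "s h \<in> A" by auto
      then have "s g = r (inv' g \<odot> h)" "inv' g \<odot> h \<in> s -` A" by simp_all
      then show False using g by blast
    qed
    then show "r g \<in> U0 - ?S" by simp
  qed blast
  moreover have "U0 - ?S \<noteq> U0"
  proof -
    obtain a where a: "a \<in> A" using assms(3) by blast
    then have "a \<in> U0" using copensD(1)[OF assms(2)] by blast
    then have "r a = a" "s a = a" by simp_all
    then have "a \<in> ?S" using a by (intro image_eqI[of _ _ a]) simp_all
    then show ?thesis using \<open>a \<in> U0\<close> by blast
  qed
  ultimately have "U0 - ?S = {}" using assms(1) unfolding minimal_groupoid_def by blast
  then obtain h where "x = r h" "s h \<in> A" using assms(4) by blast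
  then show ?thesis using that[of "inv' h"] by simp
qed

text \<open>Each unit is the source of an arrow that ends in \<open>A\<close>. By compactness finitely many bisections
  with ranges in \<open>A\<close> have sources that cover all units.\<close>

lemma unit_space_embeds:
  assumes "minimal_groupoid G" "compact U0" "A \<in> copens" "A \<noteq> {}"
  obtains m where "indicator (U0 \<times> {1}) \<preceq> nsum m (indicator (A \<times> {k}))"
proof -
  have "\<exists>W. W \<in> cobs \<and> x \<in> s ` W \<and> r ` W \<subseteq> A" if x: "x \<in> U0" for x
  proof -
    obtain g where g: "s g = x" "r g \<in> A" using minimal_orbit_meets[OF assms(1,3,4) x] by blast
    have "open (r -` A)"
      using assms(3) by (intro open_vimage continuous_on_rng continuous_on_id) (rule copensD)
    then obtain W where "W \<in> cobs" "g \<in> W" "W \<subseteq> r -` A"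
      using topological_basisE[OF ample, of "r -` A" g] g by auto
    then show ?thesis using g by (intro exI[of _ W]) auto
  qed
  then obtain W where W: "\<And>x. x \<in> U0 \<Longrightarrow> W x \<in> cobs \<and> x \<in> s ` W x \<and> r ` W x \<subseteq> A" by metis
  have "open (s ` W x)" if "x \<in> U0" for x using W[OF that] cobD(8) by blast
  moreover have "U0 \<subseteq> (\<Union>x\<in>U0. s ` W x)" using W by blast
  ultimately obtain J where J: "J \<subseteq> U0" "finite J" "U0 \<subseteq> (\<Union>x\<in>J. s ` W x)"
    by (rule compactE_image[OF assms(2), of U0 "\<lambda>x. s ` W x"])
  have U: "(\<Union>x\<in>J. s ` W x) = U0" using J(3) by auto
  have WJ: "W x \<in> cobs" if "x \<in> J" for x using W J(1) that by blast
  have "indicator ((\<Union>x\<in>J. s ` W x) \<times> {1}) \<preceq> (\<Sum>x\<in>J. indicator (r ` W x \<times> {k}))"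
    by (rule embeds_cover[of J W 1 "\<lambda>_. k", OF J(2) WJ])
  then have "indicator (U0 \<times> {1}) \<preceq> (\<Sum>x\<in>J. indicator (r ` W x \<times> {k}))" unfolding U .
  then have "indicator (U0 \<times> {1}) \<preceq> nsum (card J) (indicator (A \<times> {k}))"
  proof (rule embeds_mono)
    show "(\<Sum>x\<in>J. indicator (r ` W x \<times> {k})) \<le> (nsum (card J) (indicator (A \<times> {k})) :: _ \<Rightarrow> nat)"
    proof (rule le_funI)
      fix p
      have "(\<Sum>x\<in>J. indicator (r ` W x \<times> {k}) p) \<le> (\<Sum>x\<in>J. indicator (A \<times> {k}) p :: nat)"
      proof (rule sum_mono)
        fix x assume "x \<in> J"
        then have "r ` W x \<times> {k} \<subseteq> A \<times> {k}" using W J(1) by blast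
        then show "indicator (r ` W x \<times> {k}) p \<le> (indicator (A \<times> {k}) p :: nat)"
          by (auto simp: indicator_def)
      qed
      then show "(\<Sum>x\<in>J. indicator (r ` W x \<times> {k})) p \<le> (nsum (card J) (indicator (A \<times> {k})) p :: nat)"
        unfolding sum_fun_apply nsum_fun_apply by simp
    qed
  qed
  then show ?thesis by (rule that)
qed

lemma unit_space_copens: "compact U0 \<Longrightarrow> U0 \<in> copens"
  by (simp add: copens_def open_unit_space)

lemma tagged_order_unit:
  assumes "f \<in> tagged" "compact U0"
  shows "\<exists>n. f \<preceq> nsum n (indicator (U0 \<times> {1}))"
proof -
  have "\<exists>n. dsum L \<preceq> nsum n (indicator (U0 \<times> {1}))" if "moves L" for L
    using that
  proof (induction L)
    case Nil
    show ?case unfolding dsum_simps using zero_embeds by blast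
  next
    case (Cons t L)
    obtain W n m where t: "t = (W, n, m)" by (cases t) auto
    have "moves L" using Cons.prems by simp
    then obtain k where k: "dsum L \<preceq> nsum k (indicator (U0 \<times> {1}))" using Cons.IH by blast
    have W: "s ` W \<in> copens" using Cons.prems t cob_src_copen by simp
    have "indicator (s ` W \<times> {n}) \<preceq> indicator (U0 \<times> {1})"
      by (rule embeds_mono[OF equidec_embeds[OF equidec_retag[OF W, of n 1]]])
        (rule indicator_mono_fun, auto)
    then have "dsum (t # L) \<preceq> indicator (U0 \<times> {1}) + nsum k (indicator (U0 \<times> {1}))"
      unfolding dsum_simps t tsrc_simp using k by (rule embeds_add)
    then have "dsum (t # L) \<preceq> nsum (Suc k) (indicator (U0 \<times> {1}))"
      unfolding sum.lessThan_Suc by (simp only: add.commute)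
    then show ?case by blast
  qed
  then show ?thesis using assms(1) by (auto simp: tagged_def)
qed

lemma nonzero_tagged:
  assumes "f \<in> tagged" "f \<noteq> 0"
  obtains A n where "A \<in> copens" "A \<noteq> {}" "indicator (A \<times> {n}) \<le> f"
proof -
  obtain L where L: "moves L" "f = dsum L" using assms(1) by (auto simp: tagged_def)
  obtain p where "f p \<noteq> 0" using assms(2) by (auto simp: fun_eq_iff)
  then have "1 \<le> dsum L p" using L by simp
  then obtain t where t: "t \<in> set L" "p \<in> tsrc t" using dsum_pos by blast
  have "indicator (tsrc t) q \<le> dsum L q" for q
    using t(1) by (induction L) auto
  then have "indicator (s ` fst t \<times> {fst (snd t)}) \<le> f"
    unfolding L(2) tsrc_def by (intro le_funI)
  moreover have "s ` fst t \<in> copens" using L(1) t(1) cob_src_copen by (simp add: moves_def)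
  moreover have "s ` fst t \<noteq> {}" using t(2) by (auto simp: tsrc_def)
  ultimately show ?thesis using that by blast
qed

text \<open>Repeated use of \<open>(l + 1) [A] \<le> l [A]\<close> embeds arbitrarily many copies of \<^term>\<open>A\<close>, and so
  arbitrarily many copies of the unit space, into \<open>l\<close> copies of \<^term>\<open>A\<close>.\<close>

lemma paradoxical_proper_embedding:
  assumes "minimal_groupoid G" "compact U0" "A \<in> copens" "paradoxical G k l A" "l < k"
  shows "\<exists>L. moves L \<and> dsum L = indicator (U0 \<times> {..<l}) \<and> rsum L \<le> indicator (U0 \<times> {..<l})
      \<and> rsum L \<noteq> indicator (U0 \<times> {..<l})"
proof -
  have A: "A \<noteq> {}" "A \<subseteq> U0" using assms(4) unfolding paradoxical_def by blast+
  let ?a = "indicator (A \<times> {1}) :: 'a \<times> nat \<Rightarrow> nat" and ?u = "indicator (U0 \<times> {1}) :: 'a \<times> nat \<Rightarrow> nat"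
  note U = unit_space_copens[OF assms(2)]
  have aT: "nsum n ?a \<in> tagged" for n by (intro tagged_nsum tagged_indicator assms)
  have mono: "nsum m ?a \<preceq> nsum n ?a" if "m \<le> n" for m n
  proof (rule embeds_le[OF aT])
    show "nsum m ?a \<le> nsum n ?a"
      by (rule le_funI) (simp only: nsum_fun_apply mult_le_mono1 that)
  qed
  have step: "nsum (Suc l) ?a \<preceq> nsum l ?a"
    using mono[of "Suc l" k] embeds_if_paradoxical[OF assms(4,3)] assms(5) embeds_trans by auto
  have many: "nsum (l + j) ?a \<preceq> nsum l ?a" for j
  proof (induction j)
    case 0
    show ?case using mono[of l l] by (simp only: add_0_right order_refl)
  next
    case (Suc j)
    have "nsum (Suc l) ?a + nsum j ?a \<preceq> nsum l ?a + nsum j ?a"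
      by (rule embeds_add[OF step embeds_refl[OF aT]])
    then have "nsum (l + Suc j) ?a \<preceq> nsum (l + j) ?a"
      by (simp only: nsum_add_left[symmetric] add_Suc add_Suc_right)
    then show ?case using Suc embeds_trans by blast
  qed
  obtain m where m: "?u \<preceq> nsum m ?a"
    using unit_space_embeds[OF assms(1,2,3) A(1)] by blast
  have "nsum l ?u + ?a \<preceq> nsum l (nsum m ?a) + nsum 1 ?a"
    by (rule embeds_add[OF embeds_nsum[OF m]]) (use embeds_refl[OF aT[of 1]] in simp)
  then have 1: "nsum l ?u + ?a \<preceq> nsum (l * m + 1) ?a"
    by (simp only: nsum_mult nsum_add_left)
  have 2: "nsum (l * m + 1) ?a \<preceq> nsum l ?a"
    using embeds_trans[OF mono many, of "l * m + 1" "l * m + 1"] by simp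
  have "?a \<preceq> ?u"
    using embeds_le[OF tagged_indicator[OF assms(3)] indicator_mono_fun[of "A \<times> {1}" "U0 \<times> {1}"]] A(2)
    by blast
  then have 3: "nsum l ?a \<preceq> nsum l ?u" by (rule embeds_nsum)
  have lev: "indicator (U0 \<times> {..<l}) \<bowtie> nsum l ?u"
    using equidec_levels[OF U finite_lessThan[of l], of 1] unfolding card_lessThan .
  have "indicator (U0 \<times> {..<l}) + ?a \<preceq> nsum l ?u + ?a"
    using embeds_add[OF equidec_embeds[OF lev] embeds_refl[OF tagged_indicator[OF assms(3)]]] .
  then have "indicator (U0 \<times> {..<l}) + ?a \<preceq> indicator (U0 \<times> {..<l})"
    using embeds_trans 1 2 3 equidec_embeds[OF equidec_sym[OF lev]] by blast
  moreover have "?a \<noteq> 0" using A(1) by (simp add: indicator_eq_zero_fun)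
  ultimately show ?thesis using proper_embedding tagged_if_equidec(1)[OF lev] by blast
qed

text \<open>Paradoxicality of the unit space with \<open>k = n + 1\<close> and \<open>l = n\<close> is exactly what the existence theorem for
  states forbids.\<close>

lemma state_if_not_paradoxical:
  assumes "minimal_groupoid G" "compact U0"
    and "\<And>k l. l < k \<Longrightarrow> 0 < l \<Longrightarrow> \<not> paradoxical G k l U0"
  shows "\<exists>\<phi>. faithful_monoid_state (type_semigroup G) \<phi> \<and>
      (\<forall>x\<in>pm_elems (type_semigroup G). \<phi> x < \<infinity>) \<and> \<phi> (ts_class G (U0 \<times> {1})) = 1"
proof -
  note U = unit_space_copens[OF assms(2)]
  let ?u = "indicator (U0 \<times> {1}) :: 'a \<times> nat \<Rightarrow> nat"
  have ne: "U0 \<noteq> {}" using rng_in by blast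
  have *: "\<not> nsum (Suc n) ?u \<preceq> nsum n ?u" for n
  proof
    assume emb: "nsum (Suc n) ?u \<preceq> nsum n ?u"
    show False
    proof (cases "n = 0")
      case True
      then obtain L where L: "dsum L = nsum (Suc 0) ?u" "rsum L \<le> 0"
        using emb unfolding embeds_def by auto
      then have "rsum L = 0" by (auto simp: le_fun_def fun_eq_iff)
      then have "dsum L = 0" by (rule dsum_zero_if_rsum_zero)
      then have "nsum (Suc 0) ?u = 0" using L(1) by simp
      then have "?u = 0" unfolding sum.lessThan_Suc lessThan_0 sum.empty add_0 .
      then show False using ne by (simp add: indicator_eq_zero_fun)
    next
      case False
      then have "paradoxical G (Suc n) n U0" by (intro paradoxical_if_embeds emb U ne)
      then show False using assms(3)[of n "Suc n"] False by simp
    qed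
  qed
  interpret M: unital_preordered_monoid tagged "(\<preceq>)" ?u
  proof
    show "\<exists>n. f \<preceq> nsum n ?u" if "f \<in> tagged" for f using tagged_order_unit[OF that assms(2)] .
  qed (use * tagged_zero tagged_add tagged_indicator[OF U] embeds_refl embeds_trans embeds_add
      zero_embeds in blast)+
  obtain q where q: "\<And>f. f \<in> tagged \<Longrightarrow> 0 \<le> q f"
      "\<And>f h. f \<in> tagged \<Longrightarrow> h \<in> tagged \<Longrightarrow> q (f + h) = q f + q h"
      "\<And>f h. f \<in> tagged \<Longrightarrow> h \<in> tagged \<Longrightarrow> f \<preceq> h \<Longrightarrow> q f \<le> q h" "q ?u = (1 :: real)"
    using M.state_exists by blast
  have qn: "q (nsum n f) = real n * q f" if f: "f \<in> tagged" for n f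
  proof (induction n)
    case 0
    have "q (0 + 0) = q 0 + q 0" by (intro q tagged_zero)
    then have "q 0 = 0" by simp
    then show ?case unfolding lessThan_0 sum.empty by (simp only: of_nat_0 mult_zero_left)
  next
    case (Suc n)
    show ?case unfolding sum.lessThan_Suc q(2)[OF tagged_nsum[OF f] f]
      by (simp only: Suc.IH of_nat_Suc distrib_right mult_1_left add.commute)
  qed
  have faithful: "f = 0" if f: "f \<in> tagged" "q f = 0" for f
  proof (rule ccontr)
    assume "f \<noteq> 0"
    then obtain A n where A: "A \<in> copens" "A \<noteq> {}" "indicator (A \<times> {n}) \<le> f"
      using nonzero_tagged[OF f(1)] by metis
    obtain m where m: "?u \<preceq> nsum m (indicator (A \<times> {n}))"
      using unit_space_embeds[OF assms(1,2) A(1,2)] by blast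
    have "indicator (A \<times> {n}) \<preceq> f" by (rule embeds_le[OF tagged_indicator[OF A(1)] A(3)])
    then have "?u \<preceq> nsum m f" using m embeds_nsum embeds_trans by blast
    then have "q ?u \<le> q (nsum m f)" by (intro q(3) tagged_indicator[OF U] tagged_nsum f)
    then show False using q(4) qn[OF f(1)] f(2) by simp
  qed
  have "class_state q x < \<infinity>" for x by (simp add: class_state_def)
  moreover have "class_state q (ts_class G (U0 \<times> {1})) = 1"
    using class_state_class[OF q(3) ts_sets_level[OF U, of 1]] q(4) by simp
  ultimately show ?thesis
    using faithful_class_state[OF q(1-3) faithful] by blast
qed

text \<open>The measure of \<open>A\<close> is the value of the state at \<open>[A]\<close>. It is additive because disjoint sets satisfy
  \<open>[A \<union> B] = [A] + [B]\<close>, and invariant because the sources and the ranges of a bisection have the same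
  class.\<close>

lemma invariant_content_if_state:
  assumes "faithful_monoid_state (type_semigroup G) \<phi>"
    and "\<forall>x\<in>pm_elems (type_semigroup G). \<phi> x < \<infinity>" and "\<phi> (ts_class G (U0 \<times> {1})) = 1"
  obtains \<mu> :: "'a set \<Rightarrow> ennreal" where "\<And>A B. A \<in> copens \<Longrightarrow> B \<in> copens \<Longrightarrow> A \<inter> B = {} \<Longrightarrow> \<mu> (A \<union> B) = \<mu> A + \<mu> B"
    "\<And>W. W \<in> cobs \<Longrightarrow> \<mu> (r ` W) = \<mu> (s ` W)" "\<mu> U0 = 1"
    "\<And>A. A \<in> copens \<Longrightarrow> \<mu> A = 0 \<Longrightarrow> A = {}" "\<And>A. A \<in> copens \<Longrightarrow> \<mu> A < \<infinity>" "\<mu> {} = 0"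
proof
  let ?\<mu> = "\<lambda>A. \<phi> (ts_class G (A \<times> {1}))"
  have lev: "A \<times> {1} \<in> ts_sets G" if "A \<in> copens" for A using ts_sets_level[OF that] by simp
  have el: "ts_class G (A \<times> {1}) \<in> pm_elems (type_semigroup G)" if "A \<in> copens" for A
    unfolding pm_elems_type_semigroup using lev[OF that] by blast
  show "?\<mu> (A \<union> B) = ?\<mu> A + ?\<mu> B" if AB: "A \<in> copens" "B \<in> copens" "A \<inter> B = {}" for A B
  proof -
    have "indicator ((A \<union> B) \<times> {1}) = indicator (A \<times> {1}) + (indicator (B \<times> {1}) :: _ \<times> nat \<Rightarrow> nat)"
      using AB by (intro indicator_split) auto
    then have "indicator ((A \<union> B) \<times> {1}) \<bowtie> indicator (A \<times> {1}) + indicator (B \<times> {1})"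
      using equidec_refl[OF tagged_indicator[OF copens_Un[OF AB(1,2)], of 1]] by simp
    then have "ts_add G (ts_class G (A \<times> {1})) (ts_class G (B \<times> {1})) = ts_class G ((A \<union> B) \<times> {1})"
      by (intro ts_add_class lev AB copens_Un)
    then show ?thesis
      using assms(1) el AB(1,2) unfolding faithful_monoid_state_def monoid_state_def type_semigroup_simps
      by metis
  qed
  show "?\<mu> (r ` W) = ?\<mu> (s ` W)" if "W \<in> cobs" for W
    using ts_class_eqI[OF lev lev equidec_move, OF cob_src_copen cob_rng_copen, OF that that that] by simp
  show "?\<mu> U0 = 1" by (rule assms)
  show "?\<mu> A < \<infinity>" if "A \<in> copens" for A using assms(2) el[OF that] by blast
  show "?\<mu> {} = 0"
    using assms(1) unfolding faithful_monoid_state_def monoid_state_def type_semigroup_simps by simp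
  show "A = {}" if "A \<in> copens" "?\<mu> A = 0" for A
  proof -
    have "ts_class G (A \<times> {1}) = ts_class G {}"
      using assms(1) el[OF that(1)] that(2) unfolding faithful_monoid_state_def type_semigroup_simps by blast
    then have "A \<times> {1} \<in> ts_class G {}" using self_mem_ts_class[OF lev[OF that(1)]] by simp
    then have "indicator {} \<bowtie> indicator (A \<times> {1})" unfolding mem_ts_class ts_equiv_iff by blast
    then obtain L where "dsum L = 0" "rsum L = indicator (A \<times> {1})"
      unfolding equidec_def indicator_empty_fun by blast
    then have "(indicator (A \<times> {1}) :: _ \<times> nat \<Rightarrow> nat) = indicator {}"
      using rsum_zero_if_dsum_zero unfolding indicator_empty_fun by metis
    then have "A \<times> {1::nat} = {}" by (simp only: indicator_inject_fun)
    then show ?thesis by simp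
  qed
qed

end

section \<open>Operators on square-summable functions and their adjoints\<close>

lemma ell2_eqI: "(\<And>x. ell2_fun \<xi> x = ell2_fun \<eta> x) \<Longrightarrow> \<xi> = \<eta>"
  by (metis ell2_fun_inject ext)

lemma ell2_fun_simps [simp]:
  "ell2_fun 0 x = 0" "ell2_fun (\<xi> + \<eta>) x = ell2_fun \<xi> x + ell2_fun \<eta> x"
  "ell2_fun (- \<xi>) x = - ell2_fun \<xi> x" "ell2_fun (\<xi> - \<eta>) x = ell2_fun \<xi> x - ell2_fun \<eta> x"
  "ell2_fun (scaleC_ell2 c \<xi>) x = c * ell2_fun \<xi> x" "ell2_fun (a *\<^sub>R \<xi>) x = a *\<^sub>R ell2_fun \<xi> x"
proof -
  show "ell2_fun (\<xi> - \<eta>) x = ell2_fun \<xi> x - ell2_fun \<eta> x"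
    by (simp only: minus_ell2_def plus_ell2.rep_eq uminus_ell2.rep_eq diff_conv_add_uminus)
qed (simp_all add: zero_ell2.rep_eq plus_ell2.rep_eq uminus_ell2.rep_eq scaleC_ell2.rep_eq
    scaleR_ell2_def scaleR_conv_of_real)

lemma ell2_summable: "(\<lambda>x. (cmod (ell2_fun \<xi> x))\<^sup>2) summable_on UNIV"
  using ell2_fun[of \<xi>] by simp

lemma norm_ell2_sq: "(norm \<xi>)\<^sup>2 = (\<Sum>\<^sub>\<infinity>x. (cmod (ell2_fun \<xi> x))\<^sup>2)"
  by (simp only: power2_norm_eq_inner inner_ell2_self)

lemma ell2_sum_le: assumes "finite F" shows "(\<Sum>x\<in>F. (cmod (ell2_fun \<xi> x))\<^sup>2) \<le> (norm \<xi>)\<^sup>2"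
  unfolding norm_ell2_sq by (rule finite_sum_le_infsum[OF ell2_summable assms]) simp_all

lemma ell2_coord_le: "cmod (ell2_fun \<xi> x) \<le> norm \<xi>"
proof -
  have "(cmod (ell2_fun \<xi> x))\<^sup>2 \<le> (norm \<xi>)\<^sup>2" using ell2_sum_le[of "{x}" \<xi>] by simp
  then show ?thesis by (rule power2_le_imp_le) simp
qed

lemma ell2_of_bounded_sums:
  assumes "0 \<le> B" "\<And>F. finite F \<Longrightarrow> (\<Sum>x\<in>F. (cmod (f x))\<^sup>2) \<le> B\<^sup>2"
  shows "\<exists>\<xi>. ell2_fun \<xi> = f \<and> norm \<xi> \<le> B"
proof -
  have s: "(\<lambda>x. (cmod (f x))\<^sup>2) summable_on UNIV"
    by (rule nonneg_bounded_partial_sums_imp_summable_on[where C = "B\<^sup>2"])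
      (auto intro!: eventually_finite_subsets_at_top_weakI assms(2))
  then have f: "ell2_fun (Abs_ell2 f) = f" by (simp add: Abs_ell2_inverse)
  have "(norm (Abs_ell2 f))\<^sup>2 \<le> B\<^sup>2"
    unfolding norm_ell2_sq f by (rule infsum_le_finite_sums[OF s assms(2)])
  then have "norm (Abs_ell2 f) \<le> B" using assms(1) by (rule power2_le_imp_le)
  then show ?thesis using f by blast
qed

text \<open>A Cauchy sequence converges at each coordinate. Bounding finite partial sums and passing to the limit
  in them shows that the pointwise limit is square summable and is the limit in norm.\<close>

lemma ell2_Cauchy_convergent:
  fixes X :: "nat \<Rightarrow> 'i ell2"
  assumes "Cauchy X"
  shows "convergent X"
proof -
  have "Cauchy (\<lambda>n. ell2_fun (X n) x)" for x
  proof (rule metric_CauchyI)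
    fix e :: real assume "0 < e"
    then obtain N where "\<forall>m\<ge>N. \<forall>n\<ge>N. dist (X m) (X n) < e" using metric_CauchyD[OF assms] by blast
    then show "\<exists>N. \<forall>m\<ge>N. \<forall>n\<ge>N. dist (ell2_fun (X m) x) (ell2_fun (X n) x) < e"
      using ell2_coord_le[of "X _ - X _" x] unfolding dist_norm ell2_fun_simps by (meson le_less_trans)
  qed
  then have "\<forall>x. \<exists>a. (\<lambda>n. ell2_fun (X n) x) \<longlonglongrightarrow> a"
    using Cauchy_convergent_iff convergent_def by blast
  then obtain a where a: "\<And>x. (\<lambda>n. ell2_fun (X n) x) \<longlonglongrightarrow> a x" by metis
  have close: "\<exists>\<xi>. ell2_fun \<xi> = (\<lambda>x. a x - ell2_fun (X n) x) \<and> norm \<xi> \<le> e"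
    if e: "0 < e" and N: "\<And>m. N \<le> m \<Longrightarrow> dist (X m) (X n) < e" for e n N
  proof -
    have "(\<Sum>x\<in>F. (cmod (a x - ell2_fun (X n) x))\<^sup>2) \<le> e\<^sup>2" if F: "finite F" for F
    proof (rule LIMSEQ_le_const2)
      show "(\<lambda>m. \<Sum>x\<in>F. (cmod (ell2_fun (X m) x - ell2_fun (X n) x))\<^sup>2)
          \<longlonglongrightarrow> (\<Sum>x\<in>F. (cmod (a x - ell2_fun (X n) x))\<^sup>2)"
        by (intro tendsto_intros a)
      have "(\<Sum>x\<in>F. (cmod (ell2_fun (X m) x - ell2_fun (X n) x))\<^sup>2) \<le> e\<^sup>2" if "N \<le> m" for m
      proof -
        have "(\<Sum>x\<in>F. (cmod (ell2_fun (X m) x - ell2_fun (X n) x))\<^sup>2) \<le> (norm (X m - X n))\<^sup>2"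
          using ell2_sum_le[OF F, of "X m - X n"] by simp
        also have "\<dots> \<le> e\<^sup>2" using N[OF that] by (intro power_mono) (simp_all add: dist_norm)
        finally show ?thesis .
      qed
      then show "\<exists>N. \<forall>m\<ge>N. (\<Sum>x\<in>F. (cmod (ell2_fun (X m) x - ell2_fun (X n) x))\<^sup>2) \<le> e\<^sup>2" by blast
    qed
    then show ?thesis using e by (intro ell2_of_bounded_sums) simp_all
  qed
  obtain N0 where N0: "\<And>m. N0 \<le> m \<Longrightarrow> dist (X m) (X N0) < 1"
    using metric_CauchyD[OF assms, of 1] by auto
  then obtain \<xi>0 where \<xi>0: "ell2_fun \<xi>0 = (\<lambda>x. a x - ell2_fun (X N0) x)" using close[of 1 N0 N0] by auto
  define L where "L = \<xi>0 + X N0"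
  have L: "ell2_fun L x = a x" for x by (simp add: L_def \<xi>0)
  have "X \<longlonglongrightarrow> L"
  proof (rule metric_LIMSEQ_I)
    fix e :: real assume e: "0 < e"
    then obtain N where N: "\<And>m n. N \<le> m \<Longrightarrow> N \<le> n \<Longrightarrow> dist (X m) (X n) < e / 2"
      using metric_CauchyD[OF assms, of "e / 2"] by auto
    have "dist (X n) L < e" if n: "N \<le> n" for n
    proof -
      obtain \<xi> where \<xi>: "ell2_fun \<xi> = (\<lambda>x. a x - ell2_fun (X n) x)" "norm \<xi> \<le> e / 2"
        using close[of "e / 2" N n] e N n by auto
      have "\<xi> = L - X n" by (rule ell2_eqI) (simp add: \<xi> L)
      then show ?thesis using \<xi>(2) e by (simp add: dist_norm norm_minus_commute)
    qed
    then show "\<exists>N. \<forall>n\<ge>N. dist (X n) L < e" by blast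
  qed
  then show ?thesis by (auto simp: convergent_def)
qed

instance ell2 :: (type) banach
  by standard (rule ell2_Cauchy_convergent)

lift_definition delta :: "'i \<Rightarrow> 'i ell2" is "\<lambda>i x. if x = i then 1 else 0"
proof -
  fix i :: 'i
  have "(\<lambda>x. (cmod (if x = i then 1 else 0))\<^sup>2) summable_on {i}" by simp
  then show "(\<lambda>x. (cmod (if x = i then 1 else 0))\<^sup>2) summable_on UNIV"
    by (rule summable_on_cong_neutral[THEN iffD1, rotated -1]) auto
qed

lemma ell2_fun_delta: "ell2_fun (delta i) x = (if x = i then 1 else 0)"
  by (simp add: delta.rep_eq)

lemma infsum_single: "(\<And>x. x \<noteq> i \<Longrightarrow> f x = 0) \<Longrightarrow> (\<Sum>\<^sub>\<infinity>x. f x) = f i"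
  for f :: "'i \<Rightarrow> complex"
  using infsum_cong_neutral[of UNIV "{i}" f f] by simp

lemma cinner_delta: "cinner \<xi> (delta g) = ell2_fun \<xi> g" "cinner (delta g) \<xi> = cnj (ell2_fun \<xi> g)"
  unfolding cinner_def by (subst infsum_single[of g]; simp add: ell2_fun_delta)+

lemma norm_delta: "norm (delta i) = 1"
proof -
  have "complex_of_real ((norm (delta i))\<^sup>2) = 1"
    using cinner_delta(1)[of "delta i" i]
    by (metis Re_complex_of_real ell2_fun_delta inner_ell2_def of_real_1 one_complex.sel(1) power2_norm_eq_inner)
  then have "(norm (delta i))\<^sup>2 = 1" by (simp only: of_real_eq_1_iff)
  then show ?thesis by (simp add: power2_eq_1_iff) (smt (verit) norm_ge_zero)
qed

lemma cinner_commute: "cinner \<eta> \<xi> = cnj (cinner \<xi> \<eta>)"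
  unfolding cinner_def infsum_cnj[symmetric] by (simp add: mult.commute)

lemma cinner_add_left: "cinner (\<xi> + \<xi>') \<eta> = cinner \<xi> \<eta> + cinner \<xi>' \<eta>"
  unfolding cinner_def by (simp add: distrib_right infsum_add cinner_summable)

lemma cinner_add_right: "cinner \<eta> (\<xi> + \<xi>') = cinner \<eta> \<xi> + cinner \<eta> \<xi>'"
  by (subst (1 2 3) cinner_commute) (simp add: cinner_add_left)

lemma cinner_scale_left: "cinner (scaleC_ell2 c \<xi>) \<eta> = c * cinner \<xi> \<eta>"
  unfolding cinner_def by (simp add: mult.assoc infsum_cmult_right cinner_summable)

lemma cinner_minus_left: "cinner (- \<xi>) \<eta> = - cinner \<xi> \<eta>"
  unfolding cinner_def by (simp add: infsum_uminus)

lemma cinner_zero_left: "cinner 0 \<eta> = 0"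
  by (simp add: cinner_def)

lemma cinner_zero_right: "cinner \<eta> 0 = 0"
  by (subst cinner_commute) (simp add: cinner_zero_left)

lemma cinner_minus_right: "cinner \<eta> (- \<xi>) = - cinner \<eta> \<xi>"
  by (subst (1 2) cinner_commute) (simp add: cinner_minus_left)

lemma cinner_diff_left: "cinner (\<xi> - \<xi>') \<eta> = cinner \<xi> \<eta> - cinner \<xi>' \<eta>"
  and cinner_diff_right: "cinner \<eta> (\<xi> - \<xi>') = cinner \<eta> \<xi> - cinner \<eta> \<xi>'"
  by (simp_all only: diff_conv_add_uminus cinner_add_left cinner_minus_left cinner_add_right
      cinner_minus_right)

lemma cinner_self: "cinner \<xi> \<xi> = of_real ((norm \<xi>)\<^sup>2)"
proof (rule complex_eqI)
  show "Re (cinner \<xi> \<xi>) = Re (of_real ((norm \<xi>)\<^sup>2))"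
    by (simp only: power2_norm_eq_inner inner_ell2_def Re_complex_of_real)
  have "Im (cinner \<xi> \<xi>) = - Im (cinner \<xi> \<xi>)" using cinner_commute[of \<xi> \<xi>] by (metis cnj.sel(2))
  then show "Im (cinner \<xi> \<xi>) = Im (of_real ((norm \<xi>)\<^sup>2))" by simp
qed

lemma Im_cinner: "Im (cinner \<xi> \<eta>) = scaleC_ell2 (- \<i>) \<xi> \<bullet> \<eta>"
  by (simp add: inner_ell2_def cinner_scale_left)

lemma tendsto_cinner_left: assumes "(f \<longlongrightarrow> \<xi>) F" shows "((\<lambda>n. cinner (f n) \<eta>) \<longlongrightarrow> cinner \<xi> \<eta>) F"
proof -
  have *: "cinner \<xi> \<eta> = Complex (\<xi> \<bullet> \<eta>) (scaleC_ell2 (- \<i>) \<xi> \<bullet> \<eta>)" for \<xi>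
    by (rule complex_eqI) (simp_all add: Im_cinner inner_ell2_def)
  have "((\<lambda>n. blinfun_apply (scaleC_blinfun (- \<i>)) (f n)) \<longlongrightarrow> blinfun_apply (scaleC_blinfun (- \<i>)) \<xi>) F"
    by (intro tendsto_intros assms)
  then have "((\<lambda>n. scaleC_ell2 (- \<i>) (f n)) \<longlongrightarrow> scaleC_ell2 (- \<i>) \<xi>) F"
    by (simp add: scaleC_blinfun.rep_eq)
  then show ?thesis unfolding * by (intro tendsto_intros assms)
qed

lemma tendsto_cinner_right: assumes "(f \<longlongrightarrow> \<xi>) F" shows "((\<lambda>n. cinner \<eta> (f n)) \<longlongrightarrow> cinner \<eta> \<xi>) F"
  by (subst (1 2) cinner_commute) (intro tendsto_intros tendsto_cinner_left assms)

text \<open>For a merely real linear operator no such \<open>S\<close> need exist, and then the description that defines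
  \<^const>\<open>adjoint_op\<close> has no witness.\<close>

definition is_adjoint :: "('i ell2 \<Rightarrow>\<^sub>L 'i ell2) \<Rightarrow> ('i ell2 \<Rightarrow>\<^sub>L 'i ell2) \<Rightarrow> bool" where
  "is_adjoint T S \<longleftrightarrow> (\<forall>\<xi> \<eta>. cinner (blinfun_apply S \<xi>) \<eta> = cinner \<xi> (blinfun_apply T \<eta>))"

lemma is_adjointD: "is_adjoint T S \<Longrightarrow> cinner (blinfun_apply S \<xi>) \<eta> = cinner \<xi> (blinfun_apply T \<eta>)"
  by (simp add: is_adjoint_def)

lemma is_adjoint_unique: assumes "is_adjoint T S" "is_adjoint T S'" shows "S = S'"
proof (rule blinfun_eqI, rule ell2_eqI)
  fix \<xi> g
  show "ell2_fun (blinfun_apply S \<xi>) g = ell2_fun (blinfun_apply S' \<xi>) g"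
    unfolding cinner_delta(1)[symmetric] using assms by (simp add: is_adjoint_def)
qed

lemma adjoint_op_eq: "is_adjoint T S \<Longrightarrow> adjoint_op T = S"
  unfolding adjoint_op_def is_adjoint_def[symmetric] using is_adjoint_unique by blast

lemma is_adjoint_sym: assumes "is_adjoint T S" shows "is_adjoint S T"
  unfolding is_adjoint_def
proof (intro allI)
  fix \<xi> \<eta>
  show "cinner (blinfun_apply T \<xi>) \<eta> = cinner \<xi> (blinfun_apply S \<eta>)"
    using assms by (subst (1 2) cinner_commute) (simp add: is_adjoint_def)
qed

lemma is_adjoint_id: "is_adjoint id_blinfun id_blinfun"
  by (simp add: is_adjoint_def)

lemma is_adjoint_zero: "is_adjoint 0 0"
  by (simp add: is_adjoint_def cinner_zero_left cinner_zero_right)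

lemma is_adjoint_add: "is_adjoint T S \<Longrightarrow> is_adjoint T' S' \<Longrightarrow> is_adjoint (T + T') (S + S')"
  by (simp add: is_adjoint_def blinfun.add_left cinner_add_left cinner_add_right)

lemma is_adjoint_diff: "is_adjoint T S \<Longrightarrow> is_adjoint T' S' \<Longrightarrow> is_adjoint (T - T') (S - S')"
  by (simp add: is_adjoint_def blinfun.diff_left cinner_diff_left cinner_diff_right)

lemma is_adjoint_norm_le: assumes "is_adjoint T S" shows "norm S \<le> norm T"
proof (rule norm_blinfun_bound)
  fix \<xi>
  let ?y = "norm (blinfun_apply S \<xi>)"
  have "?y * ?y = blinfun_apply S \<xi> \<bullet> blinfun_apply S \<xi>"
    by (simp only: power2_norm_eq_inner[symmetric] power2_eq_square)
  also have "\<dots> = \<xi> \<bullet> blinfun_apply T (blinfun_apply S \<xi>)"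
    using is_adjointD[OF assms] by (simp add: inner_ell2_def)
  also have "\<dots> \<le> norm \<xi> * norm (blinfun_apply T (blinfun_apply S \<xi>))" by (rule norm_cauchy_schwarz)
  also have "\<dots> \<le> norm \<xi> * (norm T * ?y)" by (intro mult_left_mono norm_blinfun) simp
  finally have "?y * ?y \<le> (norm T * norm \<xi>) * ?y" by (simp add: ac_simps)
  then show "?y \<le> norm T * norm \<xi>"
    by (cases "?y = 0") (auto simp: mult_le_cancel_right)
qed simp

text \<open>Passing to adjoints does not increase the norm, so that the adjoints of a convergent sequence form a
  Cauchy sequence.\<close>

lemma is_adjoint_closure:
  assumes adj: "\<And>T. T \<in> X \<Longrightarrow> \<exists>S\<in>X. is_adjoint T S" and T: "T \<in> closure X"
  shows "\<exists>S\<in>closure X. is_adjoint T S"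
proof -
  obtain T' where T': "\<And>n. T' n \<in> X" "T' \<longlonglongrightarrow> T" using T unfolding closure_sequential by blast
  obtain S' where S': "\<And>n. S' n \<in> X" "\<And>n. is_adjoint (T' n) (S' n)" using adj[OF T'(1)] by metis
  have d: "dist (S' m) (S' n) \<le> dist (T' m) (T' n)" for m n
    unfolding dist_norm by (intro is_adjoint_norm_le is_adjoint_diff S')
  have "Cauchy T'" using T'(2) by (rule LIMSEQ_imp_Cauchy)
  then have "Cauchy S'" using d unfolding Cauchy_def by (meson le_less_trans)
  then obtain S where S: "S' \<longlonglongrightarrow> S" using Cauchy_convergent convergent_def by blast
  have "is_adjoint T S"
    unfolding is_adjoint_def
  proof (intro allI)
    fix \<xi> \<eta>
    have "(\<lambda>n. cinner (blinfun_apply (S' n) \<xi>) \<eta>) \<longlonglongrightarrow> cinner (blinfun_apply S \<xi>) \<eta>"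
      by (intro tendsto_cinner_left tendsto_intros S)
    moreover have "(\<lambda>n. cinner \<xi> (blinfun_apply (T' n) \<eta>)) \<longlonglongrightarrow> cinner \<xi> (blinfun_apply T \<eta>)"
      by (intro tendsto_cinner_right tendsto_intros T')
    ultimately show "cinner (blinfun_apply S \<xi>) \<eta> = cinner \<xi> (blinfun_apply T \<eta>)"
      unfolding is_adjointD[OF S'(2)] using LIMSEQ_unique by blast
  qed
  moreover have "S \<in> closure X" using S S'(1) unfolding closure_sequential by blast
  ultimately show ?thesis by blast
qed

text \<open>As \<open>\<alpha>\<close> is injective, the squares of the moved values of \<open>\<xi>\<close> are part of the sum that defines the
  norm of \<open>\<xi>\<close>; hence a bound of the weight bounds the operator.\<close>

lemma weighted_shift_exists:
  assumes "inj_on \<alpha> D" "\<And>g. cmod (c g) \<le> M" "0 \<le> M"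
  obtains T :: "'i ell2 \<Rightarrow>\<^sub>L 'i ell2"
    where "\<And>\<xi> g. ell2_fun (blinfun_apply T \<xi>) g = (if g \<in> D then c g * ell2_fun \<xi> (\<alpha> g) else 0)"
proof -
  have bound: "\<exists>\<eta>. ell2_fun \<eta> = (\<lambda>g. if g \<in> D then c g * ell2_fun \<xi> (\<alpha> g) else 0) \<and> norm \<eta> \<le> M * norm \<xi>"
    for \<xi> :: "'i ell2"
  proof -
    have "(\<Sum>g\<in>F. (cmod (if g \<in> D then c g * ell2_fun \<xi> (\<alpha> g) else 0))\<^sup>2) \<le> (M * norm \<xi>)\<^sup>2"
      if F: "finite F" for F
    proof -
      have "(\<Sum>g\<in>F. (cmod (if g \<in> D then c g * ell2_fun \<xi> (\<alpha> g) else 0))\<^sup>2)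
          = (\<Sum>g\<in>F \<inter> D. (cmod (c g * ell2_fun \<xi> (\<alpha> g)))\<^sup>2)"
        using F by (intro sum.mono_neutral_cong_right) auto
      also have "\<dots> \<le> (\<Sum>g\<in>F \<inter> D. M\<^sup>2 * (cmod (ell2_fun \<xi> (\<alpha> g)))\<^sup>2)"
        unfolding norm_mult power_mult_distrib
        by (intro sum_mono mult_right_mono power_mono assms(2)) simp_all
      also have "\<dots> = M\<^sup>2 * (\<Sum>k\<in>\<alpha> ` (F \<inter> D). (cmod (ell2_fun \<xi> k))\<^sup>2)"
        unfolding sum_distrib_left
        by (subst sum.reindex) (auto intro: inj_on_subset[OF assms(1)])
      also have "\<dots> \<le> M\<^sup>2 * (norm \<xi>)\<^sup>2" using F by (intro mult_left_mono ell2_sum_le) auto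
      finally show ?thesis by (simp add: power_mult_distrib)
    qed
    then show ?thesis
      by (rule ell2_of_bounded_sums[OF mult_nonneg_nonneg[OF assms(3) norm_ge_zero]])
  qed
  then obtain t where t: "\<And>\<xi>. ell2_fun (t \<xi>) = (\<lambda>g. if g \<in> D then c g * ell2_fun \<xi> (\<alpha> g) else 0)"
      "\<And>\<xi> :: 'i ell2. norm (t \<xi>) \<le> M * norm \<xi>" by metis
  have "bounded_linear t"
    by (rule bounded_linear_intro[where K = M])
      (auto intro!: ell2_eqI simp: t(1) algebra_simps t(2) mult.commute[of _ M])
  then show ?thesis using that[of "Blinfun t"] t(1) by (simp add: bounded_linear_Blinfun_apply)
qed

lemma weighted_shift_adjoint:
  fixes T S :: "'i ell2 \<Rightarrow>\<^sub>L 'i ell2"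
  assumes "bij_betw \<alpha> D E"
    and "\<And>\<xi> g. ell2_fun (blinfun_apply T \<xi>) g = (if g \<in> D then c g * ell2_fun \<xi> (\<alpha> g) else 0)"
    and "\<And>g \<eta>. g \<in> D \<Longrightarrow> ell2_fun (blinfun_apply S \<eta>) (\<alpha> g) = cnj (c g) * ell2_fun \<eta> g"
    and "\<And>k \<eta>. k \<notin> E \<Longrightarrow> ell2_fun (blinfun_apply S \<eta>) k = 0"
  shows "is_adjoint S T"
  unfolding is_adjoint_def
proof (intro allI)
  fix \<xi> \<eta>
  have "cinner \<xi> (blinfun_apply S \<eta>) = (\<Sum>\<^sub>\<infinity>k\<in>E. ell2_fun \<xi> k * cnj (ell2_fun (blinfun_apply S \<eta>) k))"
    unfolding cinner_def by (rule infsum_cong_neutral) (auto simp: assms(4))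
  also have "\<dots> = (\<Sum>\<^sub>\<infinity>k\<in>\<alpha> ` D. ell2_fun \<xi> k * cnj (ell2_fun (blinfun_apply S \<eta>) k))"
    using bij_betw_imp_surj_on[OF assms(1)] by simp
  also have "\<dots> = (\<Sum>\<^sub>\<infinity>g\<in>D. ell2_fun \<xi> (\<alpha> g) * cnj (ell2_fun (blinfun_apply S \<eta>) (\<alpha> g)))"
    by (subst infsum_reindex[OF bij_betw_imp_inj_on[OF assms(1)]]) (simp add: o_def)
  also have "\<dots> = (\<Sum>\<^sub>\<infinity>g\<in>D. ell2_fun (blinfun_apply T \<xi>) g * cnj (ell2_fun \<eta> g))"
    by (rule infsum_cong) (simp add: assms(2,3))
  also have "\<dots> = cinner (blinfun_apply T \<xi>) \<eta>"
    unfolding cinner_def by (rule infsum_cong_neutral) (auto simp: assms(2))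
  finally show "cinner (blinfun_apply T \<xi>) \<eta> = cinner \<xi> (blinfun_apply S \<eta>)" by simp
qed

section \<open>The regular representation\<close>

lemma continuous_on_clopen_If:
  fixes f :: "'a::topological_space \<Rightarrow> 'b::{topological_space, zero}"
  assumes "open U" "closed U" "continuous_on U f"
  shows "continuous_on UNIV (\<lambda>x. if x \<in> U then f x else 0)"
proof -
  have "continuous_on (U \<union> - U) (\<lambda>x. if x \<in> U then f x else 0)"
    using assms by (intro continuous_on_If) (auto intro: continuous_on_subset)
  then show ?thesis by simp
qed

lemma Cc_continuous: "f \<in> Cc \<Longrightarrow> continuous_on UNIV f"
  by (simp add: Cc_def)

lemma closure_limitI: "(\<And>n. X n \<in> A) \<Longrightarrow> X \<longlonglongrightarrow> T \<Longrightarrow> T \<in> closure A"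
  for T :: "'b::metric_space"
  unfolding closure_sequential by blast

lemma zero_outside_support: "g \<notin> closure {g. f g \<noteq> 0} \<Longrightarrow> f g = 0"
  using closure_subset[of "{g. f g \<noteq> 0}"] by blast

lemma CcI: fixes f :: "'g::t2_space \<Rightarrow> complex"
  assumes "continuous_on UNIV f" "compact K" "\<And>g. g \<notin> K \<Longrightarrow> f g = 0" shows "f \<in> Cc"
proof -
  have "closure {g. f g \<noteq> 0} \<subseteq> K"
    using assms(3) by (intro closure_minimal compact_imp_closed[OF assms(2)]) auto
  then have "compact (closure {g. f g \<noteq> 0})"
    using assms(2) by (metis closed_closure compact_Int_closed inf.absorb2)
  then show ?thesis using assms(1) by (simp add: Cc_def)
qed

lemma Cc_add: fixes f :: "'g::t2_space \<Rightarrow> complex"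
  assumes "f \<in> Cc" "h \<in> Cc" shows "(\<lambda>x. f x + h x) \<in> Cc"
proof (rule CcI)
  show "compact (closure {g. f g \<noteq> 0} \<union> closure {g. h g \<noteq> 0})"
    using assms by (simp add: Cc_def compact_Un)
  show "f g + h g = 0" if "g \<notin> closure {g. f g \<noteq> 0} \<union> closure {g. h g \<noteq> 0}" for g
    using that zero_outside_support[of g f] zero_outside_support[of g h] by simp
qed (intro continuous_intros Cc_continuous assms)

lemma Cc_scale: fixes f :: "'g::t2_space \<Rightarrow> complex"
  assumes "f \<in> Cc" shows "(\<lambda>x. c * f x) \<in> Cc"
proof (rule CcI)
  show "compact (closure {g. f g \<noteq> 0})" using assms by (simp add: Cc_def)
  show "c * f g = 0" if "g \<notin> closure {g. f g \<noteq> 0}" for g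
    using zero_outside_support[OF that] by simp
qed (intro continuous_intros Cc_continuous assms)

lemma Cc_zero: "(\<lambda>x. 0) \<in> (Cc :: ('g::t2_space \<Rightarrow> complex) set)"
  by (simp add: Cc_def)

context ample_groupoid
begin

definition bisfun :: "'a set \<Rightarrow> ('a \<Rightarrow> complex) set" where
  "bisfun U = {f. continuous_on UNIV f \<and> (\<forall>g. g \<notin> U \<longrightarrow> f g = 0)}"

lemma bisfunD: "f \<in> bisfun U \<Longrightarrow> continuous_on UNIV f" "f \<in> bisfun U \<Longrightarrow> g \<notin> U \<Longrightarrow> f g = 0"
  by (auto simp: bisfun_def)

lemma bisfun_Cc: "U \<in> cobs \<Longrightarrow> f \<in> bisfun U \<Longrightarrow> f \<in> Cc"
  using CcI[OF bisfunD(1) cobD(1) bisfunD(2)] .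

lemma restrict_bisfun:
  assumes "U \<in> cobs" "continuous_on UNIV f" shows "(\<lambda>g. if g \<in> U then f g else 0) \<in> bisfun U"
proof -
  have "continuous_on UNIV (\<lambda>g. if g \<in> U then f g else 0)"
    using assms cobD(2,9) by (intro continuous_on_clopen_If) (auto intro: continuous_on_subset)
  then show ?thesis by (simp add: bisfun_def)
qed

text \<open>The support is covered by finitely many compact open bisections, and cutting along these clopen sets
  keeps the pieces continuous.\<close>

lemma Cc_induct [consumes 1, case_names zero add]:
  assumes f: "f \<in> Cc" and zero: "P (\<lambda>g. 0)"
    and add: "\<And>U f h. U \<in> cobs \<Longrightarrow> f \<in> bisfun U \<Longrightarrow> h \<in> Cc \<Longrightarrow> P h \<Longrightarrow> P (\<lambda>g. f g + h g)"
  shows "P f"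
proof -
  have ex: "\<exists>W. W \<in> cobs \<and> g \<in> W" for g
    using topological_basisE[OF ample open_UNIV UNIV_I[of g]] by metis
  then obtain W where W: "\<And>g. W g \<in> cobs" "\<And>g. g \<in> W g" by metis
  have "compact (closure {g. f g \<noteq> 0})" using f by (simp add: Cc_def)
  moreover have "open (W g)" for g using W(1) cobD(2) by blast
  moreover have "closure {g. f g \<noteq> 0} \<subseteq> (\<Union>g\<in>UNIV. W g)" using W(2) by blast
  ultimately obtain J where J: "finite J" "closure {g. f g \<noteq> 0} \<subseteq> (\<Union>g\<in>J. W g)"
    using compactE_image[of "closure {g. f g \<noteq> 0}" UNIV W] by metis
  have "P h" if "continuous_on UNIV h" "\<And>g. g \<notin> (\<Union>g\<in>J. W g) \<Longrightarrow> h g = 0" for h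
    using J(1) that
  proof (induction J arbitrary: h rule: finite_induct)
    case empty
    then have "h = (\<lambda>g. 0)" by auto
    then show ?case using zero by simp
  next
    case (insert i J)
    let ?h1 = "\<lambda>g. if g \<in> W i then h g else 0" and ?h2 = "\<lambda>g. if g \<in> - W i then h g else 0"
    have c2: "continuous_on UNIV ?h2"
      using insert.prems(1) cobD(2,9)[OF W(1)]
      by (intro continuous_on_clopen_If) (auto intro: continuous_on_subset)
    have "?h2 \<in> Cc"
    proof (rule CcI[OF c2])
      show "compact (\<Union>g\<in>insert i J. W g)" using insert.hyps W(1) cobD(1) by (intro compact_UN) auto
      show "?h2 g = 0" if "g \<notin> (\<Union>g\<in>insert i J. W g)" for g using insert.prems(2)[OF that] by simp
    qed
    moreover have "P ?h2"
      using insert.prems(2) by (intro insert.IH c2) auto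
    ultimately have "P (\<lambda>g. ?h1 g + ?h2 g)"
      by (intro add[OF W(1) restrict_bisfun[OF W(1) insert.prems(1)]])
    moreover have "(\<lambda>g. ?h1 g + ?h2 g) = h" by auto
    ultimately show ?case by simp
  qed
  moreover have "f g = 0" if "g \<notin> (\<Union>g\<in>J. W g)" for g
    using zero_outside_support[of g f] that J(2) by blast
  ultimately show ?thesis using f by (simp add: Cc_def)
qed

lemma bisfun_term_zero:
  assumes "U \<in> cobs" "f \<in> bisfun U" "s h = s g" "\<not> (g \<in> ltrans_dom U \<and> h = ltrans U g)"
  shows "f (g \<odot> inv' h) = 0"
proof (rule ccontr)
  assume "f (g \<odot> inv' h) \<noteq> 0"
  then have u: "g \<odot> inv' h \<in> U" using bisfunD(2)[OF assms(2)] by blast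
  have "r (g \<odot> inv' h) = r g" using assms(3) by simp
  then have "g \<in> ltrans_dom U" using u unfolding ltrans_dom_def by (metis (mono_tags) imageI mem_Collect_eq)
  moreover have "ltrans U ((g \<odot> inv' h) \<odot> h) = h" using u assms(1,3) by (intro ltrans_eq) simp_all
  then have "h = ltrans U g" using assms(3) by simp
  ultimately show False using assms(4) by blast
qed

lemma bisfun_term:
  assumes "U \<in> cobs" "g \<in> ltrans_dom U"
  shows "g \<odot> inv' (ltrans U g) = sect U (r g)"
proof -
  have u: "sect U (r g) \<odot> ltrans U g = g" by (rule sect_mult_ltrans[OF assms])
  have "s (sect U (r g)) = r (ltrans U g)" using rng_ltrans[OF assms] by simp
  then show ?thesis using mult_cancel_right u by metis
qed

lemma bisfun_summable:
  assumes "U \<in> cobs" "f \<in> bisfun U"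
  shows "(\<lambda>h. f (g \<odot> inv' h) * \<xi> h) summable_on {h. s h = s g}"
proof -
  have "(\<lambda>h. f (g \<odot> inv' h) * \<xi> h) summable_on ({ltrans U g} \<inter> {h. s h = s g})"
    by (rule summable_on_finite) simp
  then show ?thesis
    by (rule summable_on_cong_neutral[THEN iffD1, rotated -1]) (use bisfun_term_zero[OF assms] in auto)
qed

text \<open>Only the term \<open>h = ltrans U g\<close> contributes to the convolution, because an arrow of \<open>U\<close> is determined
  by its range.\<close>

lemma bisfun_infsum:
  assumes "U \<in> cobs" "f \<in> bisfun U"
  shows "(\<Sum>\<^sub>\<infinity>h\<in>{h. s h = s g}. f (g \<odot> inv' h) * \<xi> h)
      = (if g \<in> ltrans_dom U then f (sect U (r g)) * \<xi> (ltrans U g) else 0)"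
proof (cases "g \<in> ltrans_dom U")
  case True
  have "(\<Sum>\<^sub>\<infinity>h\<in>{h. s h = s g}. f (g \<odot> inv' h) * \<xi> h) = (\<Sum>\<^sub>\<infinity>h\<in>{ltrans U g}. f (g \<odot> inv' h) * \<xi> h)"
    by (rule infsum_cong_neutral) (use bisfun_term_zero[OF assms] src_ltrans[OF assms(1) True] in auto)
  then show ?thesis using True bisfun_term[OF assms(1) True] by simp
next
  case False
  have "(\<Sum>\<^sub>\<infinity>h\<in>{h. s h = s g}. f (g \<odot> inv' h) * \<xi> h) = 0"
    by (rule infsum_0) (use bisfun_term_zero[OF assms] False in auto)
  then show ?thesis using False by simp
qed

lemma Cc_summable:
  assumes "f \<in> Cc" shows "(\<lambda>h. f (g \<odot> inv' h) * \<xi> h) summable_on {h. s h = s g}"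
  using assms
proof (induction f rule: Cc_induct)
  case (add U f h)
  then show ?case
    using summable_on_add[OF bisfun_summable[OF add(1,2), of g \<xi>] add(4)] by (simp add: distrib_right)
qed simp

lemma bisfun_bounded: assumes "U \<in> cobs" "f \<in> bisfun U" obtains M where "0 \<le> M" "\<And>g. cmod (f g) \<le> M"
proof -
  have "compact (f ` U)"
    using bisfunD(1)[OF assms(2)] cobD(1)[OF assms(1)]
    by (intro compact_continuous_image) (auto intro: continuous_on_subset)
  then obtain M where M: "\<And>x. x \<in> f ` U \<Longrightarrow> cmod x \<le> M" using compact_imp_bounded bounded_iff by metis
  have "cmod (f g) \<le> max M 0" for g
    using M[of "f g"] bisfunD(2)[OF assms(2), of g] by (cases "g \<in> U") auto
  then show ?thesis using that[of "max M 0"] by simp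
qed

lemma is_regular_rep_bisfun:
  assumes "U \<in> cobs" "f \<in> bisfun U"
  shows "is_regular_rep G f T \<longleftrightarrow> (\<forall>\<xi> g. ell2_fun (blinfun_apply T \<xi>) g =
     (if g \<in> ltrans_dom U then f (sect U (r g)) * ell2_fun \<xi> (ltrans U g) else 0))"
  unfolding is_regular_rep_def bisfun_infsum[OF assms] ..

lemma is_regular_rep_add:
  assumes "f \<in> Cc" "h \<in> Cc" "is_regular_rep G f T" "is_regular_rep G h S"
  shows "is_regular_rep G (\<lambda>g. f g + h g) (T + S)"
  using assms(3,4)
  by (simp add: is_regular_rep_def blinfun.add_left distrib_right
      infsum_add[OF Cc_summable[OF assms(1)] Cc_summable[OF assms(2)]])

lemma is_regular_rep_zero: "is_regular_rep G (\<lambda>g. 0) 0"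
  by (simp add: is_regular_rep_def)

lemma is_regular_rep_scale:
  assumes "f \<in> Cc" "is_regular_rep G f T"
  shows "is_regular_rep G (\<lambda>g. c * f g) (scaleC_blinfun c o\<^sub>L T)"
  using assms(2)
  by (simp add: is_regular_rep_def scaleC_blinfun.rep_eq mult.assoc
      infsum_cmult_right[OF Cc_summable[OF assms(1)]])

lemma regular_rep_exists: assumes "f \<in> Cc" shows "\<exists>T. is_regular_rep G f T"
  using assms
proof (induction f rule: Cc_induct)
  case zero
  show ?case using is_regular_rep_zero by blast
next
  case (add U f h)
  obtain M where M: "0 \<le> M" "\<And>g. cmod (f g) \<le> M" using bisfun_bounded[OF add(1,2)] by blast
  obtain T :: "'a ell2 \<Rightarrow>\<^sub>L 'a ell2" where "\<And>\<xi> g. ell2_fun (blinfun_apply T \<xi>) g =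
     (if g \<in> ltrans_dom U then f (sect U (r g)) * ell2_fun \<xi> (ltrans U g) else 0)"
    using weighted_shift_exists[OF inj_on_ltrans[OF add(1)], of "\<lambda>g. f (sect U (r g))" M] M by metis
  then have "is_regular_rep G f T" using is_regular_rep_bisfun[OF add(1,2)] by blast
  then show ?case using is_regular_rep_add[OF bisfun_Cc[OF add(1,2)] add(3)] add(4) by blast
qed

lemma is_regular_rep_unique: assumes "is_regular_rep G f T" "is_regular_rep G f S" shows "T = S"
  using assms by (intro blinfun_eqI ell2_eqI) (simp add: is_regular_rep_def)

definition reg :: "('a \<Rightarrow> complex) \<Rightarrow> 'a ell2 \<Rightarrow>\<^sub>L 'a ell2" where
  "reg f = (THE T. is_regular_rep G f T)"

lemma reg_eqI: "is_regular_rep G f T \<Longrightarrow> reg f = T"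
  unfolding reg_def using is_regular_rep_unique by blast

lemma is_regular_rep_reg: "f \<in> Cc \<Longrightarrow> is_regular_rep G f (reg f)"
  using regular_rep_exists reg_eqI by metis

lemma reg_add: "f \<in> Cc \<Longrightarrow> h \<in> Cc \<Longrightarrow> reg (\<lambda>g. f g + h g) = reg f + reg h"
  by (intro reg_eqI is_regular_rep_add is_regular_rep_reg)

lemma reg_zero: "reg (\<lambda>g. 0) = 0"
  by (intro reg_eqI is_regular_rep_zero)

lemma reg_scale: "f \<in> Cc \<Longrightarrow> reg (\<lambda>g. c * f g) = scaleC_blinfun c o\<^sub>L reg f"
  by (intro reg_eqI is_regular_rep_scale is_regular_rep_reg)

lemma reg_bisfun:
  assumes "U \<in> cobs" "f \<in> bisfun U"
  shows "ell2_fun (blinfun_apply (reg f) \<xi>) g =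
     (if g \<in> ltrans_dom U then f (sect U (r g)) * ell2_fun \<xi> (ltrans U g) else 0)"
  using is_regular_rep_reg[OF bisfun_Cc[OF assms]] is_regular_rep_bisfun[OF assms] by blast

lemma reg_delta:
  assumes "f \<in> Cc"
  shows "ell2_fun (blinfun_apply (reg f) (delta h)) g = (if s h = s g then f (g \<odot> inv' h) else 0)"
proof -
  have "ell2_fun (blinfun_apply (reg f) (delta h)) g
      = (\<Sum>\<^sub>\<infinity>k\<in>{k. s k = s g}. f (g \<odot> inv' k) * ell2_fun (delta h) k)"
    using is_regular_rep_reg[OF assms] unfolding is_regular_rep_def by blast
  also have "\<dots> = (\<Sum>\<^sub>\<infinity>k\<in>{h} \<inter> {k. s k = s g}. f (g \<odot> inv' k) * ell2_fun (delta h) k)"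
    by (rule infsum_cong_neutral) (auto simp: ell2_fun_delta)
  also have "\<dots> = (if s h = s g then f (g \<odot> inv' h) else 0)"
    by (auto simp: ell2_fun_delta)
  finally show ?thesis .
qed

text \<open>The convolution product, for a first factor that is supported on the bisection \<open>U\<close>.\<close>

definition conv :: "'a set \<Rightarrow> ('a \<Rightarrow> complex) \<Rightarrow> ('a \<Rightarrow> complex) \<Rightarrow> 'a \<Rightarrow> complex" where
  "conv U f h = (\<lambda>x. if x \<in> ltrans_dom U then f (sect U (r x)) * h (ltrans U x) else 0)"

lemma conv_Cc:
  assumes "U \<in> cobs" "f \<in> bisfun U" "h \<in> Cc" shows "conv U f h \<in> Cc"
proof (rule CcI)
  show "continuous_on UNIV (conv U f h)"
    unfolding conv_def
    by (intro continuous_on_clopen_If open_ltrans_dom closed_ltrans_dom assms continuous_on_mult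
        continuous_on_compose2[OF bisfunD(1)[OF assms(2)] continuous_on_sect_rng[OF assms(1)]]
        continuous_on_compose2[OF Cc_continuous[OF assms(3)] continuous_on_ltrans[OF assms(1)]]) auto
  show "compact (setmul U (closure {g. h g \<noteq> 0}))"
  proof (rule compact_setmul[OF cobD(1)[OF assms(1)]])
    show "compact (closure {g. h g \<noteq> 0})" using assms(3) by (simp add: Cc_def)
  qed
  show "conv U f h g = 0" if "g \<notin> setmul U (closure {g. h g \<noteq> 0})" for g
    using that closure_subset[of "{g. h g \<noteq> 0}"]
    unfolding setmul_eq_vimage[OF assms(1)] conv_def by auto
qed

lemma reg_compose_bisfun:
  assumes "U \<in> cobs" "f \<in> bisfun U" "h \<in> Cc" shows "reg f o\<^sub>L reg h = reg (conv U f h)"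
proof -
  have "is_regular_rep G (conv U f h) (reg f o\<^sub>L reg h)"
    unfolding is_regular_rep_def
  proof (intro allI)
    fix \<xi> g
    have inside: "conv U f h (g \<odot> inv' k) = f (sect U (r g)) * h (ltrans U g \<odot> inv' k)"
      if "g \<in> ltrans_dom U" "s k = s g" for k
    proof -
      have "g \<odot> inv' k \<in> ltrans_dom U" using that by (simp add: ltrans_dom_def)
      moreover have "ltrans U (g \<odot> inv' k) = ltrans U g \<odot> inv' k"
        unfolding ltrans_def using that sect[OF assms(1), of "r g"]
        by (simp add: mult_assoc ltrans_dom_def)
      ultimately show ?thesis using that by (simp add: conv_def)
    qed
    show "ell2_fun (blinfun_apply (reg f o\<^sub>L reg h) \<xi>) g
        = (\<Sum>\<^sub>\<infinity>k\<in>{k. s k = s g}. conv U f h (g \<odot> inv' k) * ell2_fun \<xi> k)"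
    proof (cases "g \<in> ltrans_dom U")
      case True
      have "ell2_fun (blinfun_apply (reg f o\<^sub>L reg h) \<xi>) g
          = f (sect U (r g)) * ell2_fun (blinfun_apply (reg h) \<xi>) (ltrans U g)"
        using True by (simp add: reg_bisfun[OF assms(1,2)])
      also have "ell2_fun (blinfun_apply (reg h) \<xi>) (ltrans U g)
          = (\<Sum>\<^sub>\<infinity>k\<in>{k. s k = s g}. h (ltrans U g \<odot> inv' k) * ell2_fun \<xi> k)"
        using is_regular_rep_reg[OF assms(3)] src_ltrans[OF assms(1) True] unfolding is_regular_rep_def by simp
      also have "f (sect U (r g)) * \<dots>
          = (\<Sum>\<^sub>\<infinity>k\<in>{k. s k = s g}. f (sect U (r g)) * (h (ltrans U g \<odot> inv' k) * ell2_fun \<xi> k))"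
        using Cc_summable[OF assms(3), of "ltrans U g" "ell2_fun \<xi>"] src_ltrans[OF assms(1) True]
        by (intro infsum_cmult_right[symmetric]) simp
      also have "\<dots> = (\<Sum>\<^sub>\<infinity>k\<in>{k. s k = s g}. conv U f h (g \<odot> inv' k) * ell2_fun \<xi> k)"
        by (rule infsum_cong) (simp add: inside[OF True] mult.assoc)
      finally show ?thesis .
    next
      case False
      then have "conv U f h (g \<odot> inv' k) = 0" if "s k = s g" for k
        using that by (simp add: conv_def ltrans_dom_def)
      then have "(\<Sum>\<^sub>\<infinity>k\<in>{k. s k = s g}. conv U f h (g \<odot> inv' k) * ell2_fun \<xi> k) = 0"
        by (intro infsum_0) simp
      then show ?thesis using False by (simp add: reg_bisfun[OF assms(1,2)])
    qed
  qed
  then show ?thesis using reg_eqI by metis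
qed

lemma ginv_bisfun:
  assumes "f \<in> bisfun U"
  shows "(\<lambda>g. cnj (f (inv' g))) \<in> bisfun (inv' ` U)"
proof -
  have "continuous_on UNIV (\<lambda>g. cnj (f (inv' g)))"
    by (intro continuous_intros continuous_on_compose2[OF bisfunD(1)[OF assms]]) auto
  moreover have "f (inv' g) = 0" if "g \<notin> inv' ` U" for g
  proof -
    have "inv' g \<notin> U" using that inv_inv by (metis image_eqI)
    then show ?thesis using bisfunD(2)[OF assms] by blast
  qed
  ultimately show ?thesis by (simp add: bisfun_def)
qed

text \<open>Left translation by the inverses of \<open>U\<close> and left translation by \<open>U\<close> are mutually inverse bijections,
  and they carry the weights of the two operators to conjugates of each other.\<close>

lemma is_adjoint_reg_bisfun:
  assumes "U \<in> cobs" "f \<in> bisfun U"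
  shows "is_adjoint (reg f) (reg (\<lambda>g. cnj (f (inv' g))))"
proof (rule is_adjoint_sym, rule weighted_shift_adjoint[where \<alpha> = "ltrans U"])
  let ?V = "inv' ` U"
  note V = cob_inv[OF assms(1)] and f' = ginv_bisfun[OF assms(2)]
  have domV: "ltrans_dom ?V = {x. r x \<in> s ` U}" by (simp add: ltrans_dom_def rng_inv_image)
  have sect': "sect ?V (s u) = inv' u" if "u \<in> U" for u
    using that by (intro sect_eqI[OF V]) simp_all
  show "bij_betw (ltrans U) (ltrans_dom U) {x. r x \<in> s ` U}"
    unfolding bij_betw_def
  proof (intro conjI set_eqI iffI)
    show "inj_on (ltrans U) (ltrans_dom U)" by (rule inj_on_ltrans[OF assms(1)])
    fix x assume "x \<in> ltrans U ` ltrans_dom U"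
    then obtain g where g: "g \<in> ltrans_dom U" "x = ltrans U g" by blast
    then have "sect U (r g) \<in> U" using sect(1)[OF assms(1)] by (simp add: ltrans_dom_def)
    then show "x \<in> {x. r x \<in> s ` U}" using g rng_ltrans[OF assms(1) g(1)] by simp
  next
    fix x assume "x \<in> {x. r x \<in> s ` U}"
    then obtain u where u: "u \<in> U" "s u = r x" by auto
    then have "u \<odot> x \<in> ltrans_dom U" "ltrans U (u \<odot> x) = x"
      using ltrans_eq[OF assms(1)] by (simp_all add: ltrans_dom_def)
    then show "x \<in> ltrans U ` ltrans_dom U" by (metis imageI)
  qed
  show "ell2_fun (blinfun_apply (reg f) \<xi>) g =
      (if g \<in> ltrans_dom U then f (sect U (r g)) * ell2_fun \<xi> (ltrans U g) else 0)" for \<xi> g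
    by (rule reg_bisfun[OF assms])
  show "ell2_fun (blinfun_apply (reg (\<lambda>g. cnj (f (inv' g)))) \<eta>) k = 0" if "k \<notin> {x. r x \<in> s ` U}" for k \<eta>
    using that unfolding reg_bisfun[OF V f'] domV by simp
  show "ell2_fun (blinfun_apply (reg (\<lambda>g. cnj (f (inv' g)))) \<eta>) (ltrans U g)
      = cnj (f (sect U (r g))) * ell2_fun \<eta> g" if g: "g \<in> ltrans_dom U" for g \<eta>
  proof -
    let ?u = "sect U (r g)"
    have u: "?u \<in> U" using sect(1)[OF assms(1)] g by (simp add: ltrans_dom_def)
    have rk: "r (ltrans U g) = s ?u" by (rule rng_ltrans[OF assms(1) g])
    then have "ltrans U g \<in> ltrans_dom ?V" unfolding domV using u by simp
    moreover have "ltrans ?V (ltrans U g) = g"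
      unfolding ltrans_def[of ?V] rk sect'[OF u] inv_inv by (rule sect_mult_ltrans[OF assms(1) g])
    ultimately show ?thesis unfolding reg_bisfun[OF V f'] by (simp add: rk sect'[OF u] inv_inv)
  qed
qed

definition alg :: "('a ell2 \<Rightarrow>\<^sub>L 'a ell2) set" where
  "alg = reg ` Cc"

lemma reduced_elems: "elems (reduced_cstar_algebra G) = closure alg"
proof -
  have "{T. \<exists>f\<in>Cc. is_regular_rep G f T} = alg"
    unfolding alg_def using is_regular_rep_reg reg_eqI by blast
  then show ?thesis by (simp add: reduced_cstar_algebra_def)
qed

lemma reduced_simps: "mult (reduced_cstar_algebra G) = (o\<^sub>L)" "star (reduced_cstar_algebra G) = adjoint_op"
  "unit (reduced_cstar_algebra G) = id_blinfun" "cscale (reduced_cstar_algebra G) c T = scaleC_blinfun c o\<^sub>L T"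
  by (simp_all add: reduced_cstar_algebra_def)

lemma alg_add: "T \<in> alg \<Longrightarrow> S \<in> alg \<Longrightarrow> T + S \<in> alg"
  unfolding alg_def by (auto simp: reg_add[symmetric] intro!: imageI Cc_add)

lemma alg_compose: assumes "T \<in> alg" "S \<in> alg" shows "T o\<^sub>L S \<in> alg"
proof -
  obtain f h where T: "T = reg f" "f \<in> Cc" and S: "S = reg h" "h \<in> Cc"
    using assms by (auto simp: alg_def)
  have "reg f o\<^sub>L reg h \<in> alg" using T(2)
  proof (induction f rule: Cc_induct)
    case zero
    have "reg (\<lambda>g. 0) o\<^sub>L reg h = reg (\<lambda>g. 0)"
      unfolding reg_zero by (rule blinfun_eqI) simp
    then show ?case using Cc_zero by (auto simp: alg_def)
  next
    case (add U f k)
    have "reg (\<lambda>g. f g + k g) o\<^sub>L reg h = (reg f o\<^sub>L reg h) + (reg k o\<^sub>L reg h)"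
      unfolding reg_add[OF bisfun_Cc[OF add(1,2)] add(3)]
      by (rule blinfun_eqI) (simp add: blinfun.add_left)
    moreover have "reg f o\<^sub>L reg h \<in> alg"
      unfolding reg_compose_bisfun[OF add(1,2) S(2)] alg_def
      by (intro imageI conv_Cc add S)
    ultimately show ?case using alg_add add(4) by simp
  qed
  then show ?thesis using T S by simp
qed

lemma alg_adjoint: assumes "T \<in> alg" shows "\<exists>S\<in>alg. is_adjoint T S"
proof -
  obtain f where T: "T = reg f" "f \<in> Cc" using assms by (auto simp: alg_def)
  have "\<exists>S\<in>alg. is_adjoint (reg f) S" using T(2)
  proof (induction f rule: Cc_induct)
    case zero
    have "(0 :: 'a ell2 \<Rightarrow>\<^sub>L 'a ell2) \<in> alg" unfolding alg_def using Cc_zero reg_zero by (metis imageI)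
    then show ?case unfolding reg_zero using is_adjoint_zero by blast
  next
    case (add U f k)
    obtain S where S: "S \<in> alg" "is_adjoint (reg k) S" using add by blast
    have "reg (\<lambda>g. cnj (f (inv' g))) \<in> alg"
      unfolding alg_def by (intro imageI bisfun_Cc[OF cob_inv[OF add(1)] ginv_bisfun[OF add(2)]])
    then show ?case
      unfolding reg_add[OF bisfun_Cc[OF add(1,2)] add(3)]
      using is_adjoint_add[OF is_adjoint_reg_bisfun[OF add(1,2)] S(2)] alg_add S(1) by blast
  qed
  then show ?thesis using T by simp
qed

lemma closure_alg_adjoint: "T \<in> closure alg \<Longrightarrow> \<exists>S\<in>closure alg. is_adjoint T S"
  by (rule is_adjoint_closure[OF alg_adjoint])

lemma closure_alg_adjoint_op: assumes "T \<in> closure alg"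
  shows "adjoint_op T \<in> closure alg" "is_adjoint T (adjoint_op T)"
proof -
  obtain S where "S \<in> closure alg" "is_adjoint T S" using closure_alg_adjoint[OF assms] by blast
  then show "adjoint_op T \<in> closure alg" "is_adjoint T (adjoint_op T)" using adjoint_op_eq by auto
qed

lemma closure_alg_add: assumes "T \<in> closure alg" "S \<in> closure alg" shows "T + S \<in> closure alg"
proof -
  obtain T' S' where "\<And>n. T' n \<in> alg" "T' \<longlonglongrightarrow> T" "\<And>n. S' n \<in> alg" "S' \<longlonglongrightarrow> S"
    using assms unfolding closure_sequential by blast
  then have "\<And>n. T' n + S' n \<in> alg" "(\<lambda>n. T' n + S' n) \<longlonglongrightarrow> T + S"
    by (auto intro: alg_add tendsto_add)
  then show ?thesis by (rule closure_limitI)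
qed

lemma tendsto_blinfun_compose:
  "(f \<longlongrightarrow> T) F \<Longrightarrow> (h \<longlongrightarrow> S) F \<Longrightarrow> ((\<lambda>n. f n o\<^sub>L h n) \<longlongrightarrow> (T o\<^sub>L S)) F"
  by (rule bounded_bilinear.tendsto[OF bounded_bilinear_blinfun_compose])

lemma closure_alg_compose: assumes "T \<in> closure alg" "S \<in> closure alg" shows "T o\<^sub>L S \<in> closure alg"
proof -
  obtain T' S' where "\<And>n. T' n \<in> alg" "T' \<longlonglongrightarrow> T" "\<And>n. S' n \<in> alg" "S' \<longlonglongrightarrow> S"
    using assms unfolding closure_sequential by blast
  then have "\<And>n. T' n o\<^sub>L S' n \<in> alg" "(\<lambda>n. T' n o\<^sub>L S' n) \<longlonglongrightarrow> (T o\<^sub>L S)"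
    by (auto intro: alg_compose tendsto_blinfun_compose)
  then show ?thesis by (rule closure_limitI)
qed

lemma zero_closure_alg: "0 \<in> closure alg"
proof -
  have "0 \<in> alg" unfolding alg_def using Cc_zero reg_zero by (metis imageI)
  then show ?thesis using closure_subset by blast
qed

lemma closure_alg_sum: "(\<And>i. i \<in> I \<Longrightarrow> f i \<in> closure alg) \<Longrightarrow> (\<Sum>i\<in>I. f i) \<in> closure alg"
  by (induction I rule: infinite_finite_induct) (auto intro: zero_closure_alg closure_alg_add)

lemma closure_alg_scale: assumes "T \<in> closure alg" shows "scaleC_blinfun c o\<^sub>L T \<in> closure alg"
proof -
  obtain T' where T': "\<And>n. T' n \<in> alg" "T' \<longlonglongrightarrow> T" using assms unfolding closure_sequential by blast
  have "scaleC_blinfun c o\<^sub>L T' n \<in> alg" for n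
    using T'(1)[of n] by (auto simp: alg_def reg_scale[symmetric] intro!: imageI Cc_scale)
  moreover have "(\<lambda>n. scaleC_blinfun c o\<^sub>L T' n) \<longlonglongrightarrow> (scaleC_blinfun c o\<^sub>L T)"
    by (intro tendsto_blinfun_compose tendsto_const T')
  ultimately show ?thesis by (rule closure_limitI)
qed

lemma closure_alg_uminus: assumes "T \<in> closure alg" shows "- T \<in> closure alg"
proof -
  have "scaleC_blinfun (- 1) o\<^sub>L T = - T"
    by (rule blinfun_eqI, rule ell2_eqI) (simp add: scaleC_blinfun.rep_eq blinfun.minus_left)
  then show ?thesis using closure_alg_scale[OF assms, of "- 1"] by simp
qed

lemma closure_alg_diff: "T \<in> closure alg \<Longrightarrow> S \<in> closure alg \<Longrightarrow> T - S \<in> closure alg"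
  using closure_alg_add[OF _ closure_alg_uminus] by (simp only: diff_conv_add_uminus)

section \<open>The partial isometries of the bisections\<close>

definition bisop :: "'a set \<Rightarrow> 'a ell2 \<Rightarrow>\<^sub>L 'a ell2" where
  "bisop W = reg (\<lambda>g. if g \<in> W then 1 else 0)"

lemma char_bisfun: "W \<in> cobs \<Longrightarrow> (\<lambda>g. if g \<in> W then 1 else 0) \<in> bisfun W"
  by (rule restrict_bisfun) (simp_all add: continuous_on_const)

lemma bisop_closure: "W \<in> cobs \<Longrightarrow> bisop W \<in> closure alg"
  using closure_subset[of alg] bisfun_Cc[OF _ char_bisfun] unfolding bisop_def alg_def by blast

lemma bisop_compose: assumes "V \<in> cobs" "W \<in> cobs" shows "bisop V o\<^sub>L bisop W = bisop (setmul V W)"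
proof -
  have "conv V (\<lambda>g. if g \<in> V then 1 else 0) (\<lambda>g. if g \<in> W then 1 else 0)
      = (\<lambda>g. if g \<in> setmul V W then 1 else (0 :: complex))"
    using sect(1)[OF assms(1)] unfolding setmul_eq_vimage[OF assms(1)] conv_def
    by (auto simp: fun_eq_iff ltrans_dom_def)
  then show ?thesis
    unfolding bisop_def reg_compose_bisfun[OF assms(1) char_bisfun[OF assms(1)] bisfun_Cc[OF assms(2) char_bisfun[OF assms(2)]]]
    by simp
qed

lemma is_adjoint_bisop: assumes "W \<in> cobs" shows "is_adjoint (bisop W) (bisop (inv' ` W))"
proof -
  have "(\<lambda>g. cnj (if inv' g \<in> W then 1 else 0)) = (\<lambda>g. if g \<in> inv' ` W then 1 else (0 :: complex))"
  proof
    fix g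
    have "inv' g \<in> W \<longleftrightarrow> g \<in> inv' ` W" using inv_inv by (metis image_iff)
    then show "cnj (if inv' g \<in> W then 1 else 0) = (if g \<in> inv' ` W then 1 else (0 :: complex))" by simp
  qed
  then show ?thesis using is_adjoint_reg_bisfun[OF assms char_bisfun[OF assms]] unfolding bisop_def by simp
qed

lemma bisop_empty: "bisop {} = 0"
  by (simp add: bisop_def reg_zero)

lemma bisop_Un: assumes "V \<in> cobs" "W \<in> cobs" "V \<inter> W = {}" shows "bisop (V \<union> W) = bisop V + bisop W"
proof -
  have "(\<lambda>g. if g \<in> V \<union> W then 1 else (0 :: complex))
      = (\<lambda>g. (if g \<in> V then 1 else 0) + (if g \<in> W then 1 else 0))"
    by (rule ext) (use assms(3) in auto)
  then show ?thesis
    unfolding bisop_def using reg_add[OF bisfun_Cc[OF assms(1) char_bisfun] bisfun_Cc[OF assms(2) char_bisfun], OF assms(1,2)]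
    by simp
qed

lemma bisop_sum:
  assumes "finite I" "disjoint_family_on A I" "\<And>i. i \<in> I \<Longrightarrow> A i \<in> copens"
  shows "(\<Union>i\<in>I. A i) \<in> copens \<and> bisop (\<Union>i\<in>I. A i) = (\<Sum>i\<in>I. bisop (A i))"
  using assms
proof (induction I rule: finite_induct)
  case empty
  then show ?case by (simp add: bisop_empty copens_empty)
next
  case (insert i I)
  have IH: "(\<Union>i\<in>I. A i) \<in> copens" "bisop (\<Union>i\<in>I. A i) = (\<Sum>i\<in>I. bisop (A i))"
    using insert by (auto simp: disjoint_family_on_def)
  have Ai: "A i \<in> copens" using insert by blast
  have "A i \<inter> (\<Union>i\<in>I. A i) = {}" using insert.prems(1) insert.hyps(2) by (auto simp: disjoint_family_on_def)
  then have "bisop (A i \<union> (\<Union>i\<in>I. A i)) = bisop (A i) + bisop (\<Union>i\<in>I. A i)"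
    by (intro bisop_Un copens_cob Ai IH)
  then show ?case using IH Ai insert.hyps copens_Un by simp
qed

lemma bisop_unit_space: assumes "compact U0" shows "bisop U0 = id_blinfun"
proof -
  note U = copens_cob[OF unit_space_copens[OF assms]]
  have "is_regular_rep G (\<lambda>g. if g \<in> U0 then 1 else 0) id_blinfun"
    unfolding is_regular_rep_bisfun[OF U char_bisfun[OF U]]
  proof (intro allI)
    fix \<xi> g
    have d: "g \<in> ltrans_dom U0" using image_eqI[of "r g" r "r g" U0] by (simp add: ltrans_dom_def)
    have s: "sect U0 (r g) = r g" by (rule sect_eqI[OF U]) simp_all
    have "ltrans U0 g = g" unfolding ltrans_def s by simp
    then show "ell2_fun (blinfun_apply id_blinfun \<xi>) g = (if g \<in> ltrans_dom U0
        then (if sect U0 (r g) \<in> U0 then 1 else 0) * ell2_fun \<xi> (ltrans U0 g) else 0)"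
      using d s by simp
  qed
  then show ?thesis unfolding bisop_def by (rule reg_eqI)
qed

lemma bisop_inject: assumes "V \<in> cobs" "W \<in> cobs" "bisop V = bisop W" shows "V = W"
proof -
  have "ell2_fun (blinfun_apply (bisop W) (delta (s g))) g = (if g \<in> W then 1 else 0)" if "W \<in> cobs" for W g
    unfolding bisop_def using reg_delta[OF bisfun_Cc[OF that char_bisfun[OF that]], of "s g" g] by simp
  then have "(if g \<in> V then 1 else (0 :: complex)) = (if g \<in> W then 1 else 0)" for g
    using assms by metis
  then show ?thesis by (metis one_neq_zero subsetI subset_antisym)
qed

section \<open>Matrices of bisections\<close>

lemma is_adjoint_sum: "(\<And>i. i \<in> I \<Longrightarrow> is_adjoint (f i) (h i)) \<Longrightarrow> is_adjoint (\<Sum>i\<in>I. f i) (\<Sum>i\<in>I. h i)"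
  by (induction I rule: infinite_finite_induct) (auto intro: is_adjoint_zero is_adjoint_add)

lemma compose_sum: "(\<Sum>p\<in>P. f p) o\<^sub>L (\<Sum>q\<in>Q. h q) = (\<Sum>p\<in>P. \<Sum>q\<in>Q. f p o\<^sub>L h q)"
proof -
  interpret bounded_bilinear "(o\<^sub>L)" by (rule bounded_bilinear_blinfun_compose)
  show ?thesis by (subst sum_left) (simp only: sum_right)
qed

text \<open>The bisection \<open>W p\<close> leads from level \<open>a p\<close> to level \<open>b p\<close>; the target level is the row index because
  operators compose from right to left.\<close>

definition bismat :: "nat \<Rightarrow> nat set \<Rightarrow> (nat \<Rightarrow> 'a set) \<Rightarrow> (nat \<Rightarrow> nat) \<Rightarrow> (nat \<Rightarrow> nat)
    \<Rightarrow> nat \<Rightarrow> nat \<Rightarrow> 'a ell2 \<Rightarrow>\<^sub>L 'a ell2" where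
  "bismat l I W a b i j = (if i < l \<and> j < l then \<Sum>p\<in>{p \<in> I. a p = j \<and> b p = i}. bisop (W p) else 0)"

abbreviation "mat_alg l \<equiv> matrix_algebra l (reduced_cstar_algebra G)"

lemma mat_alg_simps:
  "elems (mat_alg l) = {a. \<forall>i j. if i < l \<and> j < l then a i j \<in> closure alg else a i j = 0}"
  "mult (mat_alg l) a b = (\<lambda>i j. if i < l \<and> j < l then (\<Sum>k<l. a i k o\<^sub>L b k j) else 0)"
  "star (mat_alg l) a = (\<lambda>i j. if i < l \<and> j < l then adjoint_op (a j i) else 0)"
  "unit (mat_alg l) = (\<lambda>i j. if i < l \<and> i = j then id_blinfun else 0)"
  unfolding matrix_algebra_def star_algebra.select_convs reduced_elems reduced_simps by (rule refl)+

lemma bismat_elems: "(\<And>p. p \<in> I \<Longrightarrow> W p \<in> cobs) \<Longrightarrow> bismat l I W a b \<in> elems (mat_alg l)"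
  unfolding mat_alg_simps bismat_def by (auto intro!: closure_alg_sum bisop_closure)

lemma bismat_star:
  assumes "\<And>p. p \<in> I \<Longrightarrow> W p \<in> cobs"
  shows "star (mat_alg l) (bismat l I W a b) = bismat l I (\<lambda>p. inv' ` W p) b a"
proof (intro ext)
  fix i j
  have e: "{p \<in> I. b p = j \<and> a p = i} = {p \<in> I. a p = i \<and> b p = j}" by auto
  have "adjoint_op (\<Sum>p\<in>{p \<in> I. a p = i \<and> b p = j}. bisop (W p))
      = (\<Sum>p\<in>{p \<in> I. a p = i \<and> b p = j}. bisop (inv' ` W p))"
    using assms by (intro adjoint_op_eq is_adjoint_sum is_adjoint_bisop) auto
  then show "star (mat_alg l) (bismat l I W a b) i j = bismat l I (\<lambda>p. inv' ` W p) b a i j"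
    unfolding mat_alg_simps bismat_def e by auto
qed

lemma setmul_inv_self: assumes "W \<in> cobs" shows "setmul (inv' ` W) W = s ` W"
proof (intro set_eqI iffI)
  fix x assume "x \<in> setmul (inv' ` W) W"
  then obtain u v where x: "u \<in> W" "v \<in> W" "r u = r v" "x = inv' u \<odot> v" by (auto simp: setmul_def)
  then have "u = v" using cob_rng_eqD[OF assms] by blast
  then show "x \<in> s ` W" using x by simp
next
  fix x assume "x \<in> s ` W"
  then obtain u where u: "u \<in> W" "x = s u" by blast
  then have "inv' u \<odot> u \<in> setmul (inv' ` W) W" by (intro setmulI) simp_all
  then show "x \<in> setmul (inv' ` W) W" using u by simp
qed

lemma setmul_inv_disjoint: assumes "r ` V \<inter> r ` W = {}" shows "setmul (inv' ` V) W = {}"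
proof (rule ccontr)
  assume "setmul (inv' ` V) W \<noteq> {}"
  then obtain u v where "u \<in> V" "v \<in> W" "r u = r v" unfolding setmul_def by auto
  then have "r u \<in> r ` V \<inter> r ` W" by (metis IntI imageI)
  then show False using assms by blast
qed

text \<open>Different bisections that end at the same level have disjoint ranges, so that their product with one
  of them inverted is empty. What remains is the product of each bisection with its own inverse, which
  is its source set.\<close>

lemma bismat_star_mult:
  assumes fin: "finite I" and W: "\<And>p. p \<in> I \<Longrightarrow> W p \<in> cobs" and b: "\<And>p. p \<in> I \<Longrightarrow> b p < l"
    and ds: "disjoint_family_on (\<lambda>p. s ` W p \<times> {a p}) I"
    and dr: "disjoint_family_on (\<lambda>p. r ` W p \<times> {b p}) I"
  shows "mult (mat_alg l) (bismat l I (\<lambda>p. inv' ` W p) b a) (bismat l I W a b)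
    = (\<lambda>i j. if i < l \<and> i = j then bisop {x. (x, i) \<in> (\<Union>p\<in>I. s ` W p \<times> {a p})} else 0)"
proof (intro ext)
  fix i j
  let ?P = "\<lambda>i k. {p \<in> I. a p = i \<and> b p = k}"
  show "mult (mat_alg l) (bismat l I (\<lambda>p. inv' ` W p) b a) (bismat l I W a b) i j
      = (if i < l \<and> i = j then bisop {x. (x, i) \<in> (\<Union>p\<in>I. s ` W p \<times> {a p})} else 0)"
  proof (cases "i < l \<and> j < l")
    case False
    then show ?thesis unfolding mat_alg_simps by auto
  next
    case True
    have "mult (mat_alg l) (bismat l I (\<lambda>p. inv' ` W p) b a) (bismat l I W a b) i j
        = (\<Sum>k<l. (\<Sum>p\<in>?P i k. bisop (inv' ` W p)) o\<^sub>L (\<Sum>q\<in>?P j k. bisop (W q)))"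
      unfolding mat_alg_simps bismat_def using True by (auto intro!: sum.cong simp: conj_commute)
    also have "\<dots> = (\<Sum>k<l. \<Sum>p\<in>?P i k. \<Sum>q\<in>?P j k. bisop (inv' ` W p) o\<^sub>L bisop (W q))"
      unfolding compose_sum ..
    also have "\<dots> = (\<Sum>k<l. \<Sum>p\<in>?P i k. \<Sum>q\<in>?P j k. if q = p then bisop (s ` W p) else 0)"
    proof (intro sum.cong refl)
      fix k p q assume pq: "p \<in> ?P i k" "q \<in> ?P j k"
      then have c: "bisop (inv' ` W p) o\<^sub>L bisop (W q) = bisop (setmul (inv' ` W p) (W q))"
        using W cob_inv by (intro bisop_compose) auto
      show "bisop (inv' ` W p) o\<^sub>L bisop (W q) = (if q = p then bisop (s ` W p) else 0)"
      proof (cases "q = p")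
        case True
        then show ?thesis using setmul_inv_self W pq unfolding c by simp
      next
        case False
        then have "(r ` W p \<times> {b p}) \<inter> (r ` W q \<times> {b q}) = {}"
          using dr pq unfolding disjoint_family_on_def by blast
        then have "r ` W p \<inter> r ` W q = {}" using pq by auto
        then show ?thesis using False setmul_inv_disjoint bisop_empty unfolding c by simp
      qed
    qed
    also have "\<dots> = (\<Sum>k<l. \<Sum>p\<in>?P i k. if i = j then bisop (s ` W p) else 0)"
      using fin by (intro sum.cong refl) (auto simp: sum.delta')
    also have "\<dots> = (if i = j then \<Sum>k<l. \<Sum>p\<in>?P i k. bisop (s ` W p) else 0)" by simp
    also have "(\<Sum>k<l. \<Sum>p\<in>?P i k. bisop (s ` W p)) = (\<Sum>p\<in>{p \<in> I. a p = i}. bisop (s ` W p))"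
    proof -
      have "?P i k = {p \<in> {p \<in> I. a p = i}. b p = k}" for k by auto
      moreover have "b ` {p \<in> I. a p = i} \<subseteq> {..<l}" using b by auto
      ultimately show ?thesis
        using sum.group[of "{p \<in> I. a p = i}" "{..<l}" b "\<lambda>p. bisop (s ` W p)"] fin by simp
    qed
    also have "\<dots> = bisop (\<Union>p\<in>{p \<in> I. a p = i}. s ` W p)"
    proof -
      have "disjoint_family_on (\<lambda>p. s ` W p) {p \<in> I. a p = i}"
        unfolding disjoint_family_on_def
      proof (intro ballI impI)
        fix p q assume "p \<in> {p \<in> I. a p = i}" "q \<in> {p \<in> I. a p = i}" "p \<noteq> q"
        then have "(s ` W p \<times> {a p}) \<inter> (s ` W q \<times> {a q}) = {}" "a p = a q"
          using ds unfolding disjoint_family_on_def by auto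
        then show "s ` W p \<inter> s ` W q = {}" by auto
      qed
      then show ?thesis
        using bisop_sum[of "{p \<in> I. a p = i}" "\<lambda>p. s ` W p"] fin W cob_src_copen by simp
    qed
    also have "(\<Union>p\<in>{p \<in> I. a p = i}. s ` W p) = {x. (x, i) \<in> (\<Union>p\<in>I. s ` W p \<times> {a p})}" by auto
    finally show ?thesis using True by simp
  qed
qed

text \<open>The moves form a matrix \<open>v\<close> with \<open>v\<^sup>* v = 1\<close>, since their sources partition all levels, and \<open>v v\<^sup>*\<close> is the
  diagonal projection of the set of their ranges.\<close>

lemma not_stably_finite_if_proper_embedding:
  assumes U: "compact U0" and "0 < l" and L: "moves L" "dsum L = indicator (U0 \<times> {..<l})"
    "rsum L \<le> indicator (U0 \<times> {..<l})" "rsum L \<noteq> indicator (U0 \<times> {..<l})"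
  shows "\<not> stably_finite (reduced_cstar_algebra G)"
proof -
  define I where "I = {p. p < length L \<and> fst (L ! p) \<noteq> {}}"
  define W where "W p = fst (L ! p)" for p
  define a where "a p = fst (snd (L ! p))" for p
  define b where "b p = snd (snd (L ! p))" for p
  have fin: "finite I" by (simp add: I_def)
  have W: "W p \<in> cobs" if "p \<in> I" for p
    using that L(1) unfolding I_def W_def moves_def by simp
  have tp: "tsrc (L ! p) = s ` W p \<times> {a p}" "trng (L ! p) = r ` W p \<times> {b p}" for p
    by (simp_all add: tsrc_def trng_def W_def a_def b_def)
  have d': "(\<Sum>p<length L. indicator (s ` W p \<times> {a p})) = (indicator (U0 \<times> {..<l}) :: 'a \<times> nat \<Rightarrow> nat)"
    using L(2) unfolding dsum_conv_sum tp .
  have r': "(\<Sum>p<length L. indicator (r ` W p \<times> {b p})) \<le> (indicator (U0 \<times> {..<l}) :: 'a \<times> nat \<Rightarrow> nat)"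
    using L(3) unfolding rsum_conv_sum tp .
  have dsL: "disjoint_family_on (\<lambda>p. s ` W p \<times> {a p}) {..<length L}"
    by (rule disjoint_of_sum_indicator_le[where B = "U0 \<times> {..<l}"]) (simp_all add: d')
  have drL: "disjoint_family_on (\<lambda>p. r ` W p \<times> {b p}) {..<length L}"
    by (rule disjoint_of_sum_indicator_le[OF _ r']) simp
  have IL: "I \<subseteq> {..<length L}" by (auto simp: I_def)
  have ds: "disjoint_family_on (\<lambda>p. s ` W p \<times> {a p}) I" by (rule disjoint_family_on_mono[OF IL dsL])
  have dr: "disjoint_family_on (\<lambda>p. r ` W p \<times> {b p}) I" by (rule disjoint_family_on_mono[OF IL drL])
  have Ws: "W p = {}" if "p \<in> {..<length L} - I" for p using that by (auto simp: I_def W_def)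
  have sU: "(\<Union>p\<in>I. s ` W p \<times> {a p}) = U0 \<times> {..<l}"
  proof -
    have "(\<Union>p<length L. s ` W p \<times> {a p}) = U0 \<times> {..<l}"
      using Union_of_sum_indicator[OF finite_lessThan d'] .
    moreover have "(\<Union>p<length L. s ` W p \<times> {a p}) = (\<Union>p\<in>I. s ` W p \<times> {a p})"
      using IL Ws by blast
    ultimately show ?thesis by simp
  qed
  define R where "R = (\<Union>p\<in>I. r ` W p \<times> {b p})"
  have rR: "rsum L = indicator R"
  proof -
    have "rsum L = indicator (\<Union>p<length L. r ` W p \<times> {b p})"
      unfolding rsum_conv_sum tp by (rule sum_indicator_disjoint[OF _ drL]) simp
    moreover have "(\<Union>p<length L. r ` W p \<times> {b p}) = R"
      unfolding R_def using IL Ws by blast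
    ultimately show ?thesis by simp
  qed
  have RU: "R \<subseteq> U0 \<times> {..<l}"
  proof
    fix x assume "x \<in> R"
    then have "1 \<le> rsum L x" by (simp add: rR)
    then have "1 \<le> (indicator (U0 \<times> {..<l}) x :: nat)" using le_funD[OF L(3), of x] by (rule order_trans)
    then show "x \<in> U0 \<times> {..<l}" by (cases "x \<in> U0 \<times> {..<l}") (simp_all only: indicator_simps, simp)
  qed
  have Rne: "R \<noteq> U0 \<times> {..<l}" using L(4) rR by auto
  have al: "a p < l" if "p \<in> I" for p
  proof -
    obtain x where "x \<in> W p" using \<open>p \<in> I\<close> by (auto simp: I_def W_def)
    then have "(s x, a p) \<in> U0 \<times> {..<l}" unfolding sU[symmetric] using \<open>p \<in> I\<close> by blast
    then show ?thesis by simp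
  qed
  have bl: "b p < l" if "p \<in> I" for p
  proof -
    obtain x where "x \<in> W p" using \<open>p \<in> I\<close> by (auto simp: I_def W_def)
    then have "(r x, b p) \<in> R" unfolding R_def using \<open>p \<in> I\<close> by blast
    then show ?thesis using RU by blast
  qed
  let ?M = "mat_alg l"
  define v where "v = bismat l I W a b"
  have v: "v \<in> elems ?M" unfolding v_def by (rule bismat_elems[OF W])
  have sv: "star ?M v = bismat l I (\<lambda>p. inv' ` W p) b a"
    unfolding v_def by (rule bismat_star[OF W])
  have vv: "mult ?M (star ?M v) v = unit ?M"
  proof -
    have "mult ?M (star ?M v) v
        = (\<lambda>i j. if i < l \<and> i = j then bisop {x. (x, i) \<in> (\<Union>p\<in>I. s ` W p \<times> {a p})} else 0)"
      unfolding sv unfolding v_def by (rule bismat_star_mult[OF fin W bl ds dr])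
    moreover have "{x. (x, i) \<in> U0 \<times> {..<l}} = U0" if "i < l" for i using that by auto
    ultimately show ?thesis
      unfolding sU mat_alg_simps(4) using bisop_unit_space[OF U] by (auto simp: fun_eq_iff)
  qed
  define q where "q = (\<lambda>i j. if i < l \<and> i = j then bisop {x. (x, i) \<in> R} else 0)"
  have R_slice: "{x. (x, i) \<in> R} \<in> copens" for i
  proof -
    have "{x. (x, i) \<in> R} = (\<Union>p\<in>{p \<in> I. b p = i}. r ` W p)" unfolding R_def by auto
    moreover have "disjoint_family_on (\<lambda>p. r ` W p) {p \<in> I. b p = i}"
      unfolding disjoint_family_on_def
    proof (intro ballI impI)
      fix p q assume "p \<in> {p \<in> I. b p = i}" "q \<in> {p \<in> I. b p = i}" "p \<noteq> q"
      then have "(r ` W p \<times> {b p}) \<inter> (r ` W q \<times> {b q}) = {}" "b p = b q"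
        using dr unfolding disjoint_family_on_def by auto
      then show "r ` W p \<inter> r ` W q = {}" by auto
    qed
    ultimately show ?thesis
      using bisop_sum[of "{p \<in> I. b p = i}" "\<lambda>p. r ` W p"] fin W cob_rng_copen by simp
  qed
  have vv': "mult ?M v (star ?M v) = q"
  proof -
    have W': "inv' ` W p \<in> cobs" if "p \<in> I" for p using cob_inv W that by blast
    have inv2: "inv' ` inv' ` X = X" for X by (simp add: image_image inv_inv)
    have "mult ?M (bismat l I (\<lambda>p. inv' ` inv' ` W p) a b) (bismat l I (\<lambda>p. inv' ` W p) b a)
        = (\<lambda>i j. if i < l \<and> i = j then bisop {x. (x, i) \<in> (\<Union>p\<in>I. s ` inv' ` W p \<times> {b p})} else 0)"
      by (rule bismat_star_mult[OF fin W' al])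
        (simp_all only: src_inv_image rng_inv_image ds dr)
    from this[unfolded inv2 src_inv_image] show ?thesis unfolding sv unfolding q_def R_def v_def .
  qed
  have proj_q: "projection ?M q"
    unfolding projection_def
  proof (intro conjI)
    show "q \<in> elems ?M"
      unfolding mat_alg_simps q_def using R_slice bisop_closure[OF copens_cob] zero_closure_alg by auto
    have sq: "bisop A o\<^sub>L bisop A = bisop A" "adjoint_op (bisop A) = bisop A" if "A \<in> copens" for A
    proof -
      have "A \<subseteq> U0" using copensD(1)[OF that] .
      then have "inv' ` A = A" by (force simp: image_iff)
      then show "adjoint_op (bisop A) = bisop A"
        using adjoint_op_eq[OF is_adjoint_bisop[OF copens_cob[OF that]]] by simp
      have "setmul A A = A"
        using setmul_inv_self[OF copens_cob[OF that]] copens_image(2)[OF that] \<open>inv' ` A = A\<close> by simp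
      then show "bisop A o\<^sub>L bisop A = bisop A" using bisop_compose[OF copens_cob[OF that] copens_cob[OF that]] by simp
    qed
    show "mult ?M q q = q"
    proof (intro ext)
      fix i j
      have "(\<Sum>k<l. q i k o\<^sub>L q k j) = (\<Sum>k<l. if k = i then q i i o\<^sub>L q i j else 0)" if "i < l"
        by (intro sum.cong refl) (auto simp: q_def)
      then show "mult ?M q q i j = q i j"
        unfolding mat_alg_simps using sq(1)[OF R_slice] by (auto simp: q_def)
    qed
    show "star ?M q = q"
      unfolding mat_alg_simps using sq(2)[OF R_slice] adjoint_op_eq[OF is_adjoint_zero]
      by (auto simp: q_def fun_eq_iff)
  qed
  have proj_1: "projection ?M (unit ?M)"
    unfolding projection_def
  proof (intro conjI)
    have "id_blinfun \<in> closure alg"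
      using bisop_closure[OF copens_cob[OF unit_space_copens[OF U]]] bisop_unit_space[OF U] by simp
    then show "unit ?M \<in> elems ?M" unfolding mat_alg_simps using zero_closure_alg by auto
    show "star ?M (unit ?M) = unit ?M"
      unfolding mat_alg_simps using adjoint_op_eq[OF is_adjoint_zero] adjoint_op_eq[OF is_adjoint_id]
      by (auto simp: fun_eq_iff)
    show "mult ?M (unit ?M) (unit ?M) = unit ?M"
    proof (intro ext)
      fix i j
      show "mult ?M (unit ?M) (unit ?M) i j = unit ?M i j"
      proof (cases "i < l \<and> j < l")
        case True
        have "(\<Sum>k<l. unit ?M i k o\<^sub>L unit ?M k j) = (\<Sum>k<l. if k = i then unit ?M i j else 0)"
          by (intro sum.cong refl) (auto simp: mat_alg_simps intro!: blinfun_eqI)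
        then show ?thesis using True unfolding mat_alg_simps(2) by simp
      qed (auto simp: mat_alg_simps)
    qed
  qed
  have "mult ?M q (unit ?M) = q"
  proof (intro ext)
    fix i j
    show "mult ?M q (unit ?M) i j = q i j"
    proof (cases "i < l \<and> j < l")
      case True
      have "(\<Sum>k<l. q i k o\<^sub>L unit ?M k j) = (\<Sum>k<l. if k = j then q i j else 0)"
        by (intro sum.cong refl) (auto simp: mat_alg_simps intro!: blinfun_eqI)
      then show ?thesis using True unfolding mat_alg_simps(2) by simp
    qed (auto simp: mat_alg_simps q_def)
  qed
  moreover have "q \<noteq> unit ?M"
  proof
    assume eq: "q = unit ?M"
    have "{x. (x, i) \<in> R} = U0" if "i < l" for i
    proof (rule bisop_inject[OF copens_cob[OF R_slice] copens_cob[OF unit_space_copens[OF U]]])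
      have "q i i = unit ?M i i" using eq by simp
      then show "bisop {x. (x, i) \<in> R} = bisop U0"
        using that bisop_unit_space[OF U] by (simp add: q_def mat_alg_simps)
    qed
    then have "U0 \<times> {..<l} \<subseteq> R" by auto
    then show False using RU Rne by blast
  qed
  ultimately have "proper_subprojection ?M q (unit ?M)"
    unfolding proper_subprojection_def using proj_q proj_1 by blast
  moreover have "murray_von_neumann_equiv ?M (unit ?M) q"
    unfolding murray_von_neumann_equiv_def using proj_q proj_1 v vv vv' by blast
  ultimately show ?thesis unfolding stably_finite_def using assms(2) by (intro notI) (auto simp: Suc_le_eq)
qed

section \<open>A faithful trace forces stable finiteness\<close>

text \<open>For the defect projection \<open>p = 1 - q\<close> the trace of \<open>p = p\<^sup>* p\<close> vanishes, and it is a sum of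
  nonnegative numbers, one for each entry of \<open>p\<close>.\<close>

lemma stably_finite_if_faithful_trace:
  assumes "faithful_tracial_state (reduced_cstar_algebra G) \<tau>" and U: "compact U0"
  shows "stably_finite (reduced_cstar_algebra G)"
proof -
  have add: "\<tau> (a + b) = \<tau> a + \<tau> b" if "a \<in> closure alg" "b \<in> closure alg" for a b
    using assms(1) that unfolding faithful_tracial_state_def tracial_state_def reduced_elems by blast
  have pos: "\<tau> (adjoint_op a o\<^sub>L a) \<in> \<real>\<^sub>\<ge>\<^sub>0" if "a \<in> closure alg" for a
    using assms(1) that
    unfolding faithful_tracial_state_def tracial_state_def reduced_elems reduced_simps by blast
  have one: "\<tau> id_blinfun = 1"
    using assms(1) unfolding faithful_tracial_state_def tracial_state_def reduced_simps by blast
  have tr: "\<tau> (a o\<^sub>L b) = \<tau> (b o\<^sub>L a)" if "a \<in> closure alg" "b \<in> closure alg" for a b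
    using assms(1) that
    unfolding faithful_tracial_state_def tracial_state_def reduced_elems reduced_simps by blast
  have faithful: "a = 0" if "a \<in> closure alg" "\<tau> (adjoint_op a o\<^sub>L a) = 0" for a
    using assms(1) that unfolding faithful_tracial_state_def reduced_elems reduced_simps by blast
  have "\<tau> (0 + 0) = \<tau> 0 + \<tau> 0" by (intro add zero_closure_alg)
  then have zero: "\<tau> 0 = 0" by simp
  have sum: "\<tau> (\<Sum>i\<in>I. f i) = (\<Sum>i\<in>I. \<tau> (f i))" if "\<And>i. i \<in> I \<Longrightarrow> f i \<in> closure alg"
    for I :: "nat set" and f
    using that by (induction I rule: infinite_finite_induct) (simp_all add: zero add closure_alg_sum)
  have id_in: "id_blinfun \<in> closure alg"
    using bisop_closure[OF copens_cob[OF unit_space_copens[OF U]]] bisop_unit_space[OF U] by simp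
  show ?thesis
    unfolding stably_finite_def
  proof (intro allI impI notI, elim exE conjE)
    fix n q assume "1 \<le> n"
      and q: "proper_subprojection (mat_alg n) q (unit (mat_alg n))"
      and mvn: "murray_von_neumann_equiv (mat_alg n) (unit (mat_alg n)) q"
    obtain v where v: "v \<in> elems (mat_alg n)" "mult (mat_alg n) (star (mat_alg n) v) v = unit (mat_alg n)"
        "mult (mat_alg n) v (star (mat_alg n) v) = q"
      using mvn unfolding murray_von_neumann_equiv_def by blast
    have vin: "v i j \<in> closure alg" if "i < n" "j < n" for i j
    proof -
      have "if i < n \<and> j < n then v i j \<in> closure alg else v i j = 0" using v(1) unfolding mat_alg_simps by blast
      then show ?thesis using that by simp
    qed
    have qp: "projection (mat_alg n) q" "q \<noteq> unit (mat_alg n)" using q unfolding proper_subprojection_def by blast+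
    have "q \<in> elems (mat_alg n)" using qp(1) unfolding projection_def by blast
    then have qin': "if i < n \<and> j < n then q i j \<in> closure alg else q i j = 0" for i j
      unfolding mat_alg_simps by blast
    have qin: "q i j \<in> closure alg" if "i < n" "j < n" for i j using qin'[of i j] that by simp
    have qq: "(\<Sum>k<n. q i k o\<^sub>L q k j) = q i j" if "i < n" "j < n" for i j
    proof -
      have "mult (mat_alg n) q q i j = q i j" using qp(1) unfolding projection_def by simp
      then show ?thesis using that unfolding mat_alg_simps by simp
    qed
    have qs: "adjoint_op (q j i) = q i j" if "i < n" "j < n" for i j
    proof -
      have "star (mat_alg n) q i j = q i j" using qp(1) unfolding projection_def by simp
      then show ?thesis using that unfolding mat_alg_simps by simp
    qed
    note cl = closure_alg_compose closure_alg_adjoint_op(1)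
    have "(\<Sum>i<n. \<tau> (q i i)) = (\<Sum>i<n. \<Sum>k<n. \<tau> (v i k o\<^sub>L adjoint_op (v i k)))"
    proof (rule sum.cong[OF refl])
      fix i assume i: "i \<in> {..<n}"
      have "q i i = (\<Sum>k<n. v i k o\<^sub>L adjoint_op (v i k))"
        unfolding v(3)[symmetric] mat_alg_simps using i by (auto intro!: sum.cong)
      then show "\<tau> (q i i) = (\<Sum>k<n. \<tau> (v i k o\<^sub>L adjoint_op (v i k)))"
        using i by (auto intro!: sum cl vin)
    qed
    also have "\<dots> = (\<Sum>i<n. \<Sum>k<n. \<tau> (adjoint_op (v i k) o\<^sub>L v i k))"
      by (intro sum.cong refl tr cl vin) auto
    also have "\<dots> = (\<Sum>k<n. \<Sum>i<n. \<tau> (adjoint_op (v i k) o\<^sub>L v i k))" by (rule sum.swap)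
    also have "\<dots> = (\<Sum>k<n. \<tau> id_blinfun)"
    proof (rule sum.cong[OF refl])
      fix k assume k: "k \<in> {..<n}"
      have "unit (mat_alg n) k k = (\<Sum>i<n. adjoint_op (v i k) o\<^sub>L v i k)"
        unfolding v(2)[symmetric] unfolding mat_alg_simps using k by (auto intro!: sum.cong)
      then have "id_blinfun = (\<Sum>i<n. adjoint_op (v i k) o\<^sub>L v i k)" using k by (simp add: mat_alg_simps)
      moreover have "\<tau> (\<Sum>i<n. adjoint_op (v i k) o\<^sub>L v i k) = (\<Sum>i<n. \<tau> (adjoint_op (v i k) o\<^sub>L v i k))"
        by (rule sum) (use k in \<open>auto intro: cl vin\<close>)
      ultimately show "(\<Sum>i<n. \<tau> (adjoint_op (v i k) o\<^sub>L v i k)) = \<tau> id_blinfun" by simp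
    qed
    finally have trq: "(\<Sum>i<n. \<tau> (q i i)) = of_nat n" by (simp add: one)
    define e where "e i j = (if i = j then id_blinfun else 0 :: 'a ell2 \<Rightarrow>\<^sub>L 'a ell2)" for i j :: nat
    define p where "p i j = e i j - q i j" for i j
    have pin: "p i j \<in> closure alg" if "i < n" "j < n" for i j
      unfolding p_def e_def
      by (intro closure_alg_diff qin that) (simp add: id_in zero_closure_alg)
    have ps: "adjoint_op (p j i) = p i j" if "i < n" "j < n" for i j
    proof (rule adjoint_op_eq)
      have q': "is_adjoint (q j i) (q i j)" using closure_alg_adjoint_op(2)[OF qin[OF that(2,1)]] qs[OF that] by simp
      show "is_adjoint (p j i) (p i j)"
        unfolding p_def e_def
        by (rule is_adjoint_diff[OF _ q']) (simp add: is_adjoint_id is_adjoint_zero)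
    qed
    have pp: "(\<Sum>k<n. p i k o\<^sub>L p k i) = id_blinfun - q i i" if i: "i < n" for i
    proof -
      have "p i k o\<^sub>L p k i = (if k = i then id_blinfun - q i i - q i i else 0) + (q i k o\<^sub>L q k i)" for k
        by (rule blinfun_eqI) (auto simp: p_def e_def blinfun.add_left blinfun.diff_left blinfun.diff_right)
      then have "(\<Sum>k<n. p i k o\<^sub>L p k i)
          = (\<Sum>k<n. if k = i then id_blinfun - q i i - q i i else 0) + (\<Sum>k<n. q i k o\<^sub>L q k i)"
        by (simp add: sum.distrib)
      then show ?thesis using i qq[OF i i] by simp
    qed
    have "(\<Sum>i<n. \<Sum>k<n. \<tau> (adjoint_op (p k i) o\<^sub>L p k i)) = (\<Sum>i<n. \<tau> (\<Sum>k<n. p i k o\<^sub>L p k i))"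
    proof (rule sum.cong[OF refl])
      fix i assume i: "i \<in> {..<n}"
      then have "(\<Sum>k<n. \<tau> (adjoint_op (p k i) o\<^sub>L p k i)) = (\<Sum>k<n. \<tau> (p i k o\<^sub>L p k i))"
        using ps by (auto intro!: sum.cong)
      moreover have "\<tau> (\<Sum>k<n. p i k o\<^sub>L p k i) = (\<Sum>k<n. \<tau> (p i k o\<^sub>L p k i))"
        by (rule sum) (use i in \<open>auto intro: cl pin\<close>)
      ultimately show "(\<Sum>k<n. \<tau> (adjoint_op (p k i) o\<^sub>L p k i)) = \<tau> (\<Sum>k<n. p i k o\<^sub>L p k i)" by simp
    qed
    also have "\<dots> = (\<Sum>i<n. 1 - \<tau> (q i i))"
    proof (rule sum.cong[OF refl])
      fix i assume "i \<in> {..<n}"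
      then have i: "i < n" by simp
      have "\<tau> ((id_blinfun - q i i) + q i i) = \<tau> (id_blinfun - q i i) + \<tau> (q i i)"
        by (intro add closure_alg_diff id_in qin i)
      then show "\<tau> (\<Sum>k<n. p i k o\<^sub>L p k i) = 1 - \<tau> (q i i)"
        unfolding pp[OF i] by (simp add: one algebra_simps)
    qed
    also have "\<dots> = 0" by (simp add: sum_subtractf trq)
    finally have zero_sum: "(\<Sum>i<n. \<Sum>k<n. Re (\<tau> (adjoint_op (p k i) o\<^sub>L p k i))) = 0"
      by (metis (no_types, lifting) Re_sum sum.cong zero_complex.simps(1))
    have nn: "0 \<le> Re (\<tau> (adjoint_op (p k i) o\<^sub>L p k i))" "Im (\<tau> (adjoint_op (p k i) o\<^sub>L p k i)) = 0"
      if "i < n" "k < n" for i k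
      using pos[OF pin[OF that(2,1)]] by (auto simp: complex_nonneg_Reals_iff)
    have p0: "p k i = 0" if ik: "i < n" "k < n" for i k
    proof (rule faithful[OF pin[OF ik(2,1)]], rule complex_eqI)
      have "(\<Sum>k<n. Re (\<tau> (adjoint_op (p k i) o\<^sub>L p k i))) = 0"
        using zero_sum ik by (subst (asm) sum_nonneg_eq_0_iff) (auto intro!: sum_nonneg nn)
      then show "Re (\<tau> (adjoint_op (p k i) o\<^sub>L p k i)) = Re 0"
        using ik by (subst (asm) sum_nonneg_eq_0_iff) (auto intro!: nn)
    qed (use nn(2)[OF ik] in simp)
    have "q = unit (mat_alg n)"
    proof (intro ext)
      fix i j
      show "q i j = unit (mat_alg n) i j"
      proof (cases "i < n \<and> j < n")
        case True
        then show ?thesis using p0[of j i] by (simp add: p_def e_def mat_alg_simps)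
      next
        case False
        then show ?thesis using qin'[of i j] by (auto simp: mat_alg_simps)
      qed
    qed
    then show False using qp(2) by blast
  qed
qed

end

section \<open>The diagonal of an operator\<close>

context ample_groupoid
begin

definition diag :: "('a ell2 \<Rightarrow>\<^sub>L 'a ell2) \<Rightarrow> 'a \<Rightarrow> complex" where
  "diag T x = ell2_fun (blinfun_apply T (delta x)) x"

lemma tendsto_ell2_fun: "(f \<longlongrightarrow> \<xi>) F \<Longrightarrow> ((\<lambda>n. ell2_fun (f n) g) \<longlongrightarrow> ell2_fun \<xi> g) F"
  unfolding cinner_delta(1)[symmetric] by (rule tendsto_cinner_left)

text \<open>The operators commute with right translations, so that they are determined by their values
  at the units.\<close>

lemma coeff_translate:
  assumes "T \<in> closure alg"
  shows "ell2_fun (blinfun_apply T (delta h)) g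
    = (if s h = s g then ell2_fun (blinfun_apply T (delta (r h))) (g \<odot> inv' h) else 0)"
proof -
  obtain T' where T': "\<And>n. T' n \<in> alg" "T' \<longlonglongrightarrow> T" using assms unfolding closure_sequential by blast
  have eq: "ell2_fun (blinfun_apply (T' n) (delta h)) g
    = (if s h = s g then ell2_fun (blinfun_apply (T' n) (delta (r h))) (g \<odot> inv' h) else 0)" for n
  proof -
    obtain f where f: "T' n = reg f" "f \<in> Cc" using T'(1)[of n] by (auto simp: alg_def)
    have "(g \<odot> inv' h) \<odot> r h = g \<odot> inv' h" if "s h = s g" using that by (intro mult_unit) simp_all
    then show ?thesis unfolding f(1) reg_delta[OF f(2)] by simp
  qed
  have lim: "(\<lambda>n. ell2_fun (blinfun_apply (T' n) \<xi>) g) \<longlonglongrightarrow> ell2_fun (blinfun_apply T \<xi>) g" for \<xi> g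
    by (intro tendsto_ell2_fun tendsto_intros T')
  have "(\<lambda>n. if s h = s g then ell2_fun (blinfun_apply (T' n) (delta (r h))) (g \<odot> inv' h) else 0)
      \<longlonglongrightarrow> (if s h = s g then ell2_fun (blinfun_apply T (delta (r h))) (g \<odot> inv' h) else 0)"
    using lim by (cases "s h = s g") simp_all
  then have "(\<lambda>n. ell2_fun (blinfun_apply (T' n) (delta h)) g)
      \<longlonglongrightarrow> (if s h = s g then ell2_fun (blinfun_apply T (delta (r h))) (g \<odot> inv' h) else 0)"
    unfolding eq .
  then show ?thesis by (rule LIMSEQ_unique[OF lim[of "delta h" g]])
qed

lemma zero_if_zero_at_units:
  assumes T: "T \<in> closure alg" and zero: "\<And>x. x \<in> U0 \<Longrightarrow> blinfun_apply T (delta x) = 0"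
  shows "T = 0"
proof -
  have T0: "blinfun_apply T (delta h) = 0" for h
    by (rule ell2_eqI, subst coeff_translate[OF T]) (simp add: zero)
  obtain S where S: "is_adjoint T S" using closure_alg_adjoint[OF T] by blast
  have S0: "blinfun_apply S (delta g) = 0" for g
  proof (rule ell2_eqI)
    fix h
    have "cinner (blinfun_apply S (delta g)) (delta h) = 0"
      unfolding is_adjointD[OF S] T0 by (rule cinner_zero_right)
    then show "ell2_fun (blinfun_apply S (delta g)) h = ell2_fun 0 h" by (simp add: cinner_delta)
  qed
  show ?thesis
  proof (rule blinfun_eqI, rule ell2_eqI)
    fix \<xi> g
    have "cinner (blinfun_apply T \<xi>) (delta g) = 0"
      unfolding is_adjointD[OF is_adjoint_sym[OF S]] S0 by (rule cinner_zero_right)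
    then show "ell2_fun (blinfun_apply T \<xi>) g = ell2_fun (blinfun_apply 0 \<xi>) g" by (simp add: cinner_delta)
  qed
qed

lemma diag_le: "cmod (diag T x) \<le> norm T"
proof -
  have "cmod (diag T x) \<le> norm (blinfun_apply T (delta x))" unfolding diag_def by (rule ell2_coord_le)
  also have "\<dots> \<le> norm T" using norm_blinfun[of T "delta x"] by (simp add: norm_delta)
  finally show ?thesis .
qed

lemma diag_add: "diag (T + S) x = diag T x + diag S x"
  and diag_diff: "diag (T - S) x = diag T x - diag S x"
  and diag_scale: "diag (scaleC_blinfun c o\<^sub>L T) x = c * diag T x"
  by (simp_all add: diag_def blinfun.add_left blinfun.diff_left scaleC_blinfun.rep_eq)

lemma diag_id: "diag id_blinfun x = 1"
  by (simp add: diag_def ell2_fun_delta)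

lemma diag_adjoint:
  assumes "is_adjoint T S" shows "diag (S o\<^sub>L T) x = of_real ((norm (blinfun_apply T (delta x)))\<^sup>2)"
  unfolding diag_def cinner_delta(1)[symmetric] blinfun_apply_blinfun_compose is_adjointD[OF assms]
    cinner_self ..

lemma diag_reg: "f \<in> Cc \<Longrightarrow> x \<in> U0 \<Longrightarrow> diag (reg f) x = f x"
  by (simp add: diag_def reg_delta)

text \<open>The diagonal of a compactly supported function is its restriction to the units, and the diagonals
  converge uniformly when the operators converge in norm.\<close>

lemma continuous_on_diag: assumes "T \<in> closure alg" shows "continuous_on U0 (diag T)"
proof -
  obtain T' where T': "\<And>n. T' n \<in> alg" "T' \<longlonglongrightarrow> T" using assms unfolding closure_sequential by blast
  have "continuous_on U0 (diag (T' n))" for n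
  proof -
    obtain f where f: "T' n = reg f" "f \<in> Cc" using T'(1)[of n] by (auto simp: alg_def)
    have "continuous_on U0 f" using Cc_continuous[OF f(2)] by (rule continuous_on_subset) simp
    then show ?thesis using diag_reg[OF f(2)] unfolding f(1) by (simp cong: continuous_on_cong)
  qed
  then have c: "\<forall>\<^sub>F n in sequentially. continuous_on U0 (diag (T' n))" by (intro always_eventually) simp
  have "uniform_limit U0 (\<lambda>n. diag (T' n)) (diag T) sequentially"
  proof (rule uniform_limitI)
    fix e :: real assume "0 < e"
    then have "\<forall>\<^sub>F n in sequentially. dist (T' n) T < e" using T'(2) by (rule tendstoD[rotated])
    then show "\<forall>\<^sub>F n in sequentially. \<forall>x\<in>U0. dist (diag (T' n) x) (diag T x) < e"
    proof (rule eventually_mono)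
      fix n assume "dist (T' n) T < e"
      then show "\<forall>x\<in>U0. dist (diag (T' n) x) (diag T x) < e"
        unfolding dist_norm diag_diff[symmetric] using diag_le by (meson le_less_trans)
    qed
  qed
  then show ?thesis by (rule uniform_limit_theorem[OF c]) simp
qed

section \<open>From invariant contents to measures\<close>

lemma copen_separation:
  fixes K V :: "'a set"
  assumes "compact K" "K \<subseteq> V" "open V"
  obtains C where "compact C" "open C" "K \<subseteq> C" "C \<subseteq> V"
proof -
  have "\<exists>W. W \<in> cobs \<and> x \<in> W \<and> W \<subseteq> V" if "x \<in> K" for x
    using topological_basisE[OF ample assms(3), of x] that assms(2) by (metis subsetD)
  then obtain W where W: "\<And>x. x \<in> K \<Longrightarrow> W x \<in> cobs \<and> x \<in> W x \<and> W x \<subseteq> V" by metis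
  have o: "open (W x)" if "x \<in> K" for x using W[OF that] cobD(2) by blast
  have c: "K \<subseteq> (\<Union>x\<in>K. W x)" using W by blast
  obtain J where J: "J \<subseteq> K" "finite J" "K \<subseteq> (\<Union>x\<in>J. W x)"
    by (rule compactE_image[OF assms(1) o c])
  show ?thesis
  proof
    show "compact (\<Union>x\<in>J. W x)" using J W cobD(1) by (intro compact_UN) blast+
    show "open (\<Union>x\<in>J. W x)" using J o by (intro open_UN) blast
    show "K \<subseteq> (\<Union>x\<in>J. W x)" by (rule J)
    show "(\<Union>x\<in>J. W x) \<subseteq> V" using J W by blast
  qed
qed

text \<open>An open set \<open>S\<close> is a countable union of closed sets. Their preimages are compact, so that each is
  contained in a compact open subset of the preimage of \<open>S\<close>. Hence the preimage of \<open>S\<close> is a countable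
  union of compact open sets.\<close>

lemma continuous_measurable:
  fixes f :: "'a \<Rightarrow> complex"
  assumes X: "compact X" "open X" "space N = X"
    and sets: "\<And>C. compact C \<Longrightarrow> open C \<Longrightarrow> C \<subseteq> X \<Longrightarrow> C \<in> sets N"
    and f: "continuous_on X f"
  shows "f \<in> borel_measurable N"
proof (rule borel_measurableI)
  fix S :: "complex set" assume S: "open S"
  show "f -` S \<inter> space N \<in> sets N"
  proof (cases "S = UNIV")
    case True
    then show ?thesis using sets[OF X(1,2)] X(3) by simp
  next
    case False
    define K where "K n = {x \<in> X. 1 / Suc n \<le> infdist (f x) (- S)}" for n :: nat
    have V: "open (f -` S \<inter> X)"
      using f S X(2) by (simp add: continuous_on_open_vimage Int_commute)
    have K: "compact (K n)" "K n \<subseteq> f -` S \<inter> X" for n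
    proof -
      have "closedin (top_of_set X) (X \<inter> (\<lambda>x. infdist (f x) (- S)) -` {1 / Suc n..})"
        by (rule continuous_closedin_preimage) (intro continuous_on_infdist f closed_atLeast)+
      then have "compact (X \<inter> (\<lambda>x. infdist (f x) (- S)) -` {1 / Suc n..})"
        using X(1) closedin_compact by blast
      moreover have "X \<inter> (\<lambda>x. infdist (f x) (- S)) -` {1 / Suc n..} = K n" by (auto simp: K_def)
      ultimately show "compact (K n)" by simp
      show "K n \<subseteq> f -` S \<inter> X"
      proof
        fix x assume x: "x \<in> K n"
        have "f x \<in> S"
        proof (rule ccontr)
          assume "f x \<notin> S"
          then have "infdist (f x) (- S) = 0" by simp
          then show False using x by (simp add: K_def)
        qed
        then show "x \<in> f -` S \<inter> X" using x by (simp add: K_def)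
      qed
    qed
    have "\<exists>C. compact C \<and> open C \<and> K n \<subseteq> C \<and> C \<subseteq> f -` S \<inter> X" for n
      using copen_separation[OF K V] by metis
    then obtain C where C: "\<And>n. compact (C n) \<and> open (C n) \<and> K n \<subseteq> C n \<and> C n \<subseteq> f -` S \<inter> X" by metis
    have "f -` S \<inter> X \<subseteq> (\<Union>n. K n)"
    proof
      fix x assume x: "x \<in> f -` S \<inter> X"
      have "closed (- S)" "- S \<noteq> {}" "f x \<notin> - S" using x False S by auto
      then have "infdist (f x) (- S) \<noteq> 0" using in_closed_iff_infdist_zero by metis
      then have "0 < infdist (f x) (- S)" using infdist_nonneg[of "f x" "- S"] by simp
      then obtain n where "inverse (real (Suc n)) < infdist (f x) (- S)" using reals_Archimedean by blast
      then have "x \<in> K n" using x by (simp add: K_def inverse_eq_divide)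
      then show "x \<in> (\<Union>n. K n)" by blast
    qed
    then have "f -` S \<inter> X \<subseteq> (\<Union>n. C n)" using C by (meson UN_mono order_refl order_trans)
    moreover have "(\<Union>n. C n) \<subseteq> f -` S \<inter> X" using C by (intro UN_least) simp
    ultimately have "f -` S \<inter> X = (\<Union>n. C n)" by (rule subset_antisym)
    moreover have "C n \<in> sets N" for n using C[of n] by (intro sets) auto
    ultimately show ?thesis using X(3) by auto
  qed
qed

text \<open>A decreasing sequence of compact open sets with empty intersection is eventually empty, so that finite
  additivity already gives continuity at the empty set, as Caratheodory's theorem requires.\<close>

lemma content_extends:
  fixes \<mu> :: "'a set \<Rightarrow> ennreal"
  assumes add: "\<And>A B. A \<in> copens \<Longrightarrow> B \<in> copens \<Longrightarrow> A \<inter> B = {} \<Longrightarrow> \<mu> (A \<union> B) = \<mu> A + \<mu> B"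
    and fin: "\<And>A. A \<in> copens \<Longrightarrow> \<mu> A < \<infinity>" and empty: "\<mu> {} = 0" and U: "compact U0"
  obtains M where "space M = U0" "sets M = sigma_sets U0 copens" "\<And>A. A \<in> copens \<Longrightarrow> emeasure M A = \<mu> A"
proof -
  interpret R: ring_of_sets U0 copens
    unfolding ring_of_sets_iff
  proof (intro conjI ballI copens_empty copens_Un copens_Diff)
    show "copens \<subseteq> Pow U0" using copensD(1) by blast
  qed
  have "\<exists>\<mu>'. (\<forall>A\<in>copens. \<mu>' A = \<mu> A) \<and> measure_space U0 (sigma_sets U0 copens) \<mu>'"
  proof (rule R.caratheodory_empty_continuous)
    show "positive copens \<mu>" using empty by (simp add: positive_def)
    show "additive copens \<mu>" using add by (simp add: additive_def)
    show "\<mu> A \<noteq> \<infinity>" if "A \<in> copens" for A using fin[OF that] by simp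
    fix A :: "nat \<Rightarrow> 'a set" assume A: "range A \<subseteq> copens" "decseq A" "(\<Inter>i. A i) = {}"
    have o: "open (- A i)" for i using copensD(4) A(1) by (intro open_Compl) blast
    have c: "U0 \<subseteq> (\<Union>i\<in>UNIV. - A i)" using A(3) by blast
    obtain J where J: "J \<subseteq> UNIV" "finite J" "U0 \<subseteq> (\<Union>i\<in>J. - A i)"
      by (rule compactE_image[OF U o c])
    have "A n = {}" if n: "Max (insert 0 J) \<le> n" for n
    proof -
      have "A n \<subseteq> A i" if i: "i \<in> J" for i
      proof (rule decseqD[OF A(2)])
        have "i \<le> Max (insert 0 J)" using J(2) i by (intro Max_ge) auto
        then show "i \<le> n" using n by simp
      qed
      moreover have "A n \<subseteq> U0" using A(1) copensD(1) by blast
      ultimately show ?thesis using J(3) by blast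
    qed
    then have "\<forall>\<^sub>F n in sequentially. \<mu> (A n) = 0"
      using empty unfolding eventually_sequentially by metis
    then show "(\<lambda>n. \<mu> (A n)) \<longlonglongrightarrow> 0" by (rule tendsto_eventually)
  qed
  then obtain \<mu>' where \<mu>': "\<And>A. A \<in> copens \<Longrightarrow> \<mu>' A = \<mu> A"
      "measure_space U0 (sigma_sets U0 copens) \<mu>'" by blast
  have sub: "copens \<subseteq> Pow U0" using copensD(1) by blast
  show ?thesis
  proof
    let ?M = "measure_of U0 copens \<mu>'"
    show "space ?M = U0" by (simp add: space_measure_of sub)
    show "sets ?M = sigma_sets U0 copens" by (simp add: sets_measure_of sub)
    show "emeasure ?M A = \<mu> A" if "A \<in> copens" for A
    proof -
      have "emeasure ?M A = \<mu>' A"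
        using \<mu>'(2) that sub by (intro emeasure_measure_of[of ?M U0 copens \<mu>'])
          (auto simp: measure_space_def sets_measure_of)
      then show ?thesis using \<mu>'(1)[OF that] by simp
    qed
  qed
qed

end

locale invariant_measure = ample_groupoid G for G :: "'g::t2_space groupoid" +
  fixes M :: "'g measure"
  assumes compact_units: "compact U0"
    and space_M: "space M = U0" and sets_M: "sets M = sigma_sets U0 copens"
    and total: "emeasure M U0 = 1"
    and invariant_M: "W \<in> cobs \<Longrightarrow> emeasure M (r ` W) = emeasure M (s ` W)"
    and positive_M: "A \<in> copens \<Longrightarrow> emeasure M A = 0 \<Longrightarrow> A = {}"
begin

sublocale finite_measure M
  by (rule finite_measureI) (simp add: space_M total)

lemma copens_sets: "A \<in> copens \<Longrightarrow> A \<in> sets M"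
  unfolding sets_M by (rule sigma_sets.Basic)

lemma measure_space_M: "measure M (space M) = 1"
  by (simp add: space_M total measure_def)

lemma continuous_measurable_M: fixes f :: "'g \<Rightarrow> complex"
  assumes "continuous_on U0 f" shows "f \<in> borel_measurable M"
  using compact_units open_unit_space space_M copens_sets assms
  by (intro continuous_measurable) (auto simp: copens_def)

lemma continuous_integrable: fixes f :: "'g \<Rightarrow> complex"
  assumes "continuous_on U0 f" "\<And>x. x \<in> U0 \<Longrightarrow> cmod (f x) \<le> B" shows "integrable M f"
  using assms space_M
  by (intro integrable_const_bound[of _ B] continuous_measurable_M) auto

lemma restrict_distr:
  assumes U: "U \<in> cobs" and A: "A \<in> copens" and \<theta>: "\<theta> ` A \<subseteq> U"
    and pre: "\<And>W. W \<in> cobs \<Longrightarrow> W \<subseteq> U \<Longrightarrow> {x \<in> A. \<theta> x \<in> W} \<in> copens"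
  defines "E \<equiv> {W \<in> cobs. W \<subseteq> U}"
  shows "\<theta> \<in> measurable (restrict_space M A) (sigma U E)"
    and "W \<in> E \<Longrightarrow> emeasure (distr (restrict_space M A) (sigma U E) \<theta>) W = emeasure M {x \<in> A. \<theta> x \<in> W}"
proof -
  have EU: "E \<subseteq> Pow U" by (auto simp: E_def)
  have AU: "A \<subseteq> U0" using copensD(1)[OF A] .
  have spc: "space (restrict_space M A) = A" using AU space_M by (simp add: space_restrict_space Int_absorb2)
  have AM: "A \<inter> space M \<in> sets M" using copens_sets[OF A] AU space_M by (simp add: Int_absorb2)
  have inv_im: "\<theta> -` W \<inter> A = {x \<in> A. \<theta> x \<in> W}" for W by auto
  show m: "\<theta> \<in> measurable (restrict_space M A) (sigma U E)"
  proof (rule measurable_measure_of[OF EU])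
    show "\<theta> \<in> space (restrict_space M A) \<rightarrow> U" using \<theta> unfolding spc by auto
    fix W assume "W \<in> E"
    then have "{x \<in> A. \<theta> x \<in> W} \<in> copens" using pre by (auto simp: E_def)
    then show "\<theta> -` W \<inter> space (restrict_space M A) \<in> sets (restrict_space M A)"
      unfolding spc inv_im using copens_sets by (auto simp: sets_restrict_space_iff[OF AM])
  qed
  show "emeasure (distr (restrict_space M A) (sigma U E) \<theta>) W = emeasure M {x \<in> A. \<theta> x \<in> W}" if W: "W \<in> E"
  proof -
    have "W \<in> sets (sigma U E)" using W EU by (simp add: sets_measure_of sigma_sets.Basic)
    then have "emeasure (distr (restrict_space M A) (sigma U E) \<theta>) W
        = emeasure (restrict_space M A) (\<theta> -` W \<inter> A)"
      using emeasure_distr[OF m] unfolding spc by simp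
    also have "\<dots> = emeasure M (\<theta> -` W \<inter> A)" by (rule emeasure_restrict_space[OF AM]) auto
    finally show ?thesis unfolding inv_im .
  qed
qed

text \<open>The range and source maps of a bisection transport the measure to the same measure on the
  bisection, since both agree on its compact open subsets.\<close>

lemma integral_bisection:
  fixes F :: "'g \<Rightarrow> complex"
  assumes U: "U \<in> cobs" and F: "continuous_on U F"
  shows "(\<integral>x. indicator (r ` U) x *\<^sub>R F (sect U x) \<partial>M)
    = (\<integral>x. indicator (s ` U) x *\<^sub>R F (inv' (sect (inv' ` U) x)) \<partial>M)"
proof -
  let ?E = "{W \<in> cobs. W \<subseteq> U}" and ?t = "\<lambda>x. inv' (sect (inv' ` U) x)"
  note U' = cob_inv[OF U]
  have t_src: "?t (s u) = u" if "u \<in> U" for u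
    using sect_eqI[OF U', of "inv' u" "s u"] that inv_inv by simp
  have pre_r: "{x \<in> r ` U. sect U x \<in> W} = r ` W" if "W \<subseteq> U" for W
    using that sect_eq[OF U] by (auto simp: subset_iff image_iff)
  have pre_s: "{x \<in> s ` U. ?t x \<in> W} = s ` W" if "W \<subseteq> U" for W
    using that t_src by (auto simp: subset_iff image_iff)
  have r1: "sect U ` r ` U \<subseteq> U" using sect_eq[OF U] by auto
  have s1: "?t ` s ` U \<subseteq> U" using t_src by auto
  have r2: "{x \<in> r ` U. sect U x \<in> W} \<in> copens" if "W \<in> cobs" "W \<subseteq> U" for W
    unfolding pre_r[OF that(2)] by (rule cob_rng_copen[OF that(1)])
  have s2: "{x \<in> s ` U. ?t x \<in> W} \<in> copens" if "W \<in> cobs" "W \<subseteq> U" for W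
    unfolding pre_s[OF that(2)] by (rule cob_src_copen[OF that(1)])

  let ?N1 = "distr (restrict_space M (r ` U)) (sigma U ?E) (sect U)"
  let ?N2 = "distr (restrict_space M (s ` U)) (sigma U ?E) ?t"
  have R1: "sect U \<in> measurable (restrict_space M (r ` U)) (sigma U ?E)"
    by (rule restrict_distr(1)[OF U cob_rng_copen[OF U] r1]) (rule r2)
  have S1: "?t \<in> measurable (restrict_space M (s ` U)) (sigma U ?E)"
    by (rule restrict_distr(1)[OF U cob_src_copen[OF U] s1]) (rule s2)
  have R2: "emeasure ?N1 W = emeasure M (r ` W)" if W: "W \<in> ?E" for W
  proof -
    have "emeasure ?N1 W = emeasure M {x \<in> r ` U. sect U x \<in> W}"
      by (rule restrict_distr(2)[OF U cob_rng_copen[OF U] r1 _ W]) (rule r2)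
    then show ?thesis using W pre_r by simp
  qed
  have S2: "emeasure ?N2 W = emeasure M (s ` W)" if W: "W \<in> ?E" for W
  proof -
    have "emeasure ?N2 W = emeasure M {x \<in> s ` U. ?t x \<in> W}"
      by (rule restrict_distr(2)[OF U cob_src_copen[OF U] s1 _ W]) (rule s2)
    then show ?thesis using W pre_s by simp
  qed
  have EU: "?E \<subseteq> Pow U" by auto
  have UE: "U \<in> ?E" using U by simp
  have eq: "?N1 = ?N2"
  proof (rule measure_eqI_generator_eq[where E = ?E and \<Omega> = U and A = "\<lambda>_. U"])
    show "Int_stable ?E"
    proof (rule Int_stableI)
      fix V W assume VW: "V \<in> ?E" "W \<in> ?E"
      then have V: "V \<in> cobs" and W: "W \<in> cobs" by auto
      have "V \<inter> W \<in> cobs"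
        by (rule cob_subset[OF V Int_lower1 open_Int[OF cobD(2)[OF V] cobD(2)[OF W]]
              closed_Int[OF cobD(9)[OF V] cobD(9)[OF W]]])
      then show "V \<inter> W \<in> ?E" using VW by auto
    qed
    show "emeasure ?N1 W = emeasure ?N2 W" if W: "W \<in> ?E" for W
      using W invariant_M unfolding R2[OF W] S2[OF W] by blast
    show "emeasure ?N1 U \<noteq> \<infinity>"
      unfolding R2[OF UE] by (simp add: emeasure_finite)
  qed (use EU UE in \<open>auto simp: sets_measure_of\<close>)
  have mF: "F \<in> borel_measurable (sigma U ?E)"
  proof (rule continuous_measurable[of U])
    show "compact U" "open U" using cobD[OF U] by auto
    show "space (sigma U ?E) = U" using EU by (simp add: space_measure_of)
    show "C \<in> sets (sigma U ?E)" if "compact C" "open C" "C \<subseteq> U" for C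
    proof -
      have "C \<in> ?E" using that cob_subset[OF U that(3,2)] compact_imp_closed by auto
      then show ?thesis using EU by (simp add: sets_measure_of sigma_sets.Basic)
    qed
  qed (rule F)
  have sp: "r ` U \<inter> space M \<in> sets M" "s ` U \<inter> space M \<in> sets M"
    using copens_sets[OF cob_rng_copen[OF U]] copens_sets[OF cob_src_copen[OF U]] by auto
  have "(\<integral>x. indicator (r ` U) x *\<^sub>R F (sect U x) \<partial>M) = integral\<^sup>L ?N1 F"
    unfolding integral_distr[OF R1 mF] integral_restrict_space[OF sp(1)] ..
  also have "\<dots> = (\<integral>x. indicator (s ` U) x *\<^sub>R F (?t x) \<partial>M)"
    unfolding eq integral_distr[OF S1 mF] integral_restrict_space[OF sp(2)] ..
  finally show ?thesis .
qed

section \<open>The trace of an invariant measure\<close>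

definition trace :: "('g ell2 \<Rightarrow>\<^sub>L 'g ell2) \<Rightarrow> complex" where
  "trace T = (\<integral>x. diag T x \<partial>M)"

lemma diag_integrable: "T \<in> closure alg \<Longrightarrow> integrable M (diag T)"
  by (rule continuous_integrable[OF continuous_on_diag diag_le])

lemma trace_add: "T \<in> closure alg \<Longrightarrow> S \<in> closure alg \<Longrightarrow> trace (T + S) = trace T + trace S"
  unfolding trace_def diag_add by (intro Bochner_Integration.integral_add diag_integrable)

lemma trace_scale: "trace (scaleC_blinfun c o\<^sub>L T) = c * trace T"
  unfolding trace_def diag_scale by simp

lemma trace_id: "trace id_blinfun = 1"
  by (simp add: trace_def diag_id measure_space_M)

lemma trace_diff_le:
  assumes "T \<in> closure alg" "S \<in> closure alg" shows "cmod (trace T - trace S) \<le> norm (T - S)"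
proof -
  have "trace T - trace S = (\<integral>x. diag (T - S) x \<partial>M)"
    unfolding trace_def diag_diff
    by (intro Bochner_Integration.integral_diff[symmetric] diag_integrable assms)
  also have "cmod \<dots> \<le> (\<integral>x. cmod (diag (T - S) x) \<partial>M)" by (rule integral_norm_bound)
  also have "\<dots> \<le> (\<integral>x. norm (T - S) \<partial>M)"
    by (intro integral_mono integrable_norm diag_integrable closure_alg_diff assms diag_le) simp
  also have "\<dots> = norm (T - S)" by (simp add: measure_space_M)
  finally show ?thesis .
qed

lemma tendsto_trace:
  assumes "\<And>n. X n \<in> closure alg" "T \<in> closure alg" "X \<longlonglongrightarrow> T"
  shows "(\<lambda>n. trace (X n)) \<longlonglongrightarrow> trace T"
proof -
  have "(\<lambda>n. trace (X n) - trace T) \<longlonglongrightarrow> 0"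
  proof (rule Lim_null_comparison[OF always_eventually])
    show "\<forall>n. cmod (trace (X n) - trace T) \<le> norm (X n - T)" using trace_diff_le assms by blast
    show "(\<lambda>n. norm (X n - T)) \<longlonglongrightarrow> 0" using assms(3) by (simp add: LIM_zero tendsto_norm_zero)
  qed
  then show ?thesis by (rule LIM_zero_cancel)
qed

lemma alg_closure: "T \<in> alg \<Longrightarrow> T \<in> closure alg"
  using closure_subset by blast

text \<open>Both diagonals come from the one function \<open>u \<mapsto> f u * h (u\<^sup>-\<^sup>1)\<close> on the bisection, placed at the
  ranges of \<open>u\<close> for one product and at the sources for the other.\<close>

lemma trace_commute_bisfun:
  assumes U: "U \<in> cobs" and f: "f \<in> bisfun U" and h: "h \<in> Cc"
  shows "trace (reg f o\<^sub>L reg h) = trace (reg h o\<^sub>L reg f)"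
proof -
  let ?F = "\<lambda>u. f u * h (inv' u)" and ?t = "\<lambda>x. inv' (sect (inv' ` U) x)"
  note fC = bisfun_Cc[OF U f]
  have t: "?t x \<in> U" "s (?t x) = x" if x: "x \<in> s ` U" for x
  proof -
    obtain u where u: "u \<in> U" "x = s u" using x by blast
    then have "sect (inv' ` U) x = inv' u" by (intro sect_eqI[OF cob_inv[OF U]]) simp_all
    then show "?t x \<in> U" "s (?t x) = x" using u inv_inv by simp_all
  qed
  have 1: "diag (reg f o\<^sub>L reg h) x = indicator (r ` U) x *\<^sub>R ?F (sect U x)" if x: "x \<in> U0" for x
  proof (cases "x \<in> r ` U")
    case True
    then have d: "x \<in> ltrans_dom U" using x by (simp add: ltrans_dom_def)
    have lt: "ltrans U x = inv' (sect U x)"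
      unfolding ltrans_def using x sect(2)[OF U True] by simp
    have "diag (reg f o\<^sub>L reg h) x = f (sect U x) * ell2_fun (blinfun_apply (reg h) (delta x)) (ltrans U x)"
      unfolding diag_def blinfun_apply_blinfun_compose reg_bisfun[OF U f] using d x by simp
    also have "ell2_fun (blinfun_apply (reg h) (delta x)) (ltrans U x) = h (inv' (sect U x))"
      unfolding reg_delta[OF h] lt using x sect(2)[OF U True] by simp
    finally show ?thesis using True by simp
  next
    case False
    then have "x \<notin> ltrans_dom U" using x by (simp add: ltrans_dom_def)
    then show ?thesis
      unfolding diag_def blinfun_apply_blinfun_compose reg_bisfun[OF U f] using False by simp
  qed
  have 2: "diag (reg h o\<^sub>L reg f) x = indicator (s ` U) x *\<^sub>R ?F (?t x)" if x: "x \<in> U0" for x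
  proof -
    have "diag (reg h o\<^sub>L reg f) x
        = (\<Sum>\<^sub>\<infinity>k\<in>{k. s k = s x}. h (x \<odot> inv' k) * ell2_fun (blinfun_apply (reg f) (delta x)) k)"
      unfolding diag_def blinfun_apply_blinfun_compose
      using is_regular_rep_reg[OF h] unfolding is_regular_rep_def by blast
    also have "\<dots> = (\<Sum>\<^sub>\<infinity>k\<in>{k. s k = x}. h (inv' k) * f k)"
      unfolding reg_delta[OF fC] using x by (intro infsum_cong_neutral) auto
    also have "\<dots> = indicator (s ` U) x *\<^sub>R ?F (?t x)"
    proof (cases "x \<in> s ` U")
      case True
      have "(\<Sum>\<^sub>\<infinity>k\<in>{k. s k = x}. h (inv' k) * f k) = (\<Sum>\<^sub>\<infinity>k\<in>{?t x}. h (inv' k) * f k)"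
      proof (rule infsum_cong_neutral)
        fix k assume k: "k \<in> {k. s k = x} - {?t x}"
        then have "k \<notin> U" using cob_src_eqD[OF U, of k "?t x"] t[OF True] by auto
        then show "h (inv' k) * f k = 0" using bisfunD(2)[OF f] by simp
      qed (use t[OF True] in auto)
      then show ?thesis using True by (simp add: mult.commute)
    next
      case False
      have "f k = 0" if "s k = x" for k
        using that False bisfunD(2)[OF f, of k] by blast
      then have "(\<Sum>\<^sub>\<infinity>k\<in>{k. s k = x}. h (inv' k) * f k) = 0" by (intro infsum_0) simp
      then show ?thesis using False by simp
    qed
    finally show ?thesis .
  qed
  have "continuous_on U ?F"
    by (intro continuous_intros continuous_on_compose2[OF Cc_continuous[OF h]]
        continuous_on_subset[OF bisfunD(1)[OF f]]) auto
  then have "(\<integral>x. indicator (r ` U) x *\<^sub>R ?F (sect U x) \<partial>M) = (\<integral>x. indicator (s ` U) x *\<^sub>R ?F (?t x) \<partial>M)"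
    by (rule integral_bisection[OF U])
  moreover have "trace (reg f o\<^sub>L reg h) = (\<integral>x. indicator (r ` U) x *\<^sub>R ?F (sect U x) \<partial>M)"
    unfolding trace_def by (intro Bochner_Integration.integral_cong 1) (simp_all add: space_M)
  moreover have "trace (reg h o\<^sub>L reg f) = (\<integral>x. indicator (s ` U) x *\<^sub>R ?F (?t x) \<partial>M)"
    unfolding trace_def by (intro Bochner_Integration.integral_cong 2) (simp_all add: space_M)
  ultimately show ?thesis by simp
qed

lemma trace_commute_alg: assumes "T \<in> alg" "S \<in> alg" shows "trace (T o\<^sub>L S) = trace (S o\<^sub>L T)"
proof -
  obtain f h where T: "T = reg f" "f \<in> Cc" and S: "S = reg h" "h \<in> Cc"
    using assms by (auto simp: alg_def)
  have "trace (reg f o\<^sub>L reg h) = trace (reg h o\<^sub>L reg f)" using T(2)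
  proof (induction f rule: Cc_induct)
    case zero
    have "0 o\<^sub>L reg h = 0" "reg h o\<^sub>L 0 = 0" by (rule blinfun_eqI; simp)+
    then show ?case unfolding reg_zero by simp
  next
    case (add U f k)
    have in_alg: "reg f \<in> alg" "reg k \<in> alg" "reg h \<in> alg"
      using bisfun_Cc[OF add(1,2)] add(3) S(2) by (auto simp: alg_def)
    have "(reg f + reg k) o\<^sub>L reg h = (reg f o\<^sub>L reg h) + (reg k o\<^sub>L reg h)"
      "reg h o\<^sub>L (reg f + reg k) = (reg h o\<^sub>L reg f) + (reg h o\<^sub>L reg k)"
      by (rule blinfun_eqI; simp add: blinfun.add_left blinfun.add_right)+
    then show ?case
      unfolding reg_add[OF bisfun_Cc[OF add(1,2)] add(3)]
      using trace_commute_bisfun[OF add(1,2) S(2)] add(4) in_alg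
      by (simp add: trace_add alg_closure alg_compose)
  qed
  then show ?thesis using T S by simp
qed

lemma trace_commute:
  assumes "T \<in> closure alg" "S \<in> closure alg" shows "trace (T o\<^sub>L S) = trace (S o\<^sub>L T)"
proof -
  obtain T' where T': "\<And>n. T' n \<in> alg" "T' \<longlonglongrightarrow> T" using assms(1) unfolding closure_sequential by blast
  obtain S' where S': "\<And>n. S' n \<in> alg" "S' \<longlonglongrightarrow> S" using assms(2) unfolding closure_sequential by blast
  have "(\<lambda>n. trace (T' n o\<^sub>L S' n)) \<longlonglongrightarrow> trace (T o\<^sub>L S)"
    by (intro tendsto_trace tendsto_blinfun_compose T' S' closure_alg_compose alg_closure assms)
  moreover have "(\<lambda>n. trace (S' n o\<^sub>L T' n)) \<longlonglongrightarrow> trace (S o\<^sub>L T)"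
    by (intro tendsto_trace tendsto_blinfun_compose T' S' closure_alg_compose alg_closure assms)
  ultimately show ?thesis using trace_commute_alg[OF T'(1) S'(1)] LIMSEQ_unique by simp
qed

lemma trace_star_mult:
  assumes "T \<in> closure alg"
  shows "trace (adjoint_op T o\<^sub>L T) = of_real (\<integral>x. (norm (blinfun_apply T (delta x)))\<^sup>2 \<partial>M)"
  unfolding trace_def diag_adjoint[OF closure_alg_adjoint_op(2)[OF assms]]
  by (rule integral_complex_of_real)

text \<open>The trace of \<open>T\<^sup>* T\<close> integrates the continuous function \<open>x \<mapsto> \<parallel>T \<delta>\<^sub>x\<parallel>\<^sup>2\<close> against a measure that
  is positive on every nonempty compact open set.\<close>

lemma trace_faithful:
  assumes T: "T \<in> closure alg" and zero: "trace (adjoint_op T o\<^sub>L T) = 0" shows "T = 0"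
proof (rule zero_if_zero_at_units[OF T], rule ccontr)
  fix x assume x: "x \<in> U0" and nz: "blinfun_apply T (delta x) \<noteq> 0"
  let ?S = "adjoint_op T o\<^sub>L T" and ?g = "\<lambda>x. (norm (blinfun_apply T (delta x)))\<^sup>2"
  have S: "?S \<in> closure alg" by (intro closure_alg_compose closure_alg_adjoint_op T)
  have d: "?g y = Re (diag ?S y)" for y
    unfolding diag_adjoint[OF closure_alg_adjoint_op(2)[OF T]] by simp
  have cg: "continuous_on U0 ?g" unfolding d by (intro continuous_intros continuous_on_diag S)
  have ig: "integrable M ?g" unfolding d by (intro integrable_Re diag_integrable S)
  let ?c = "?g x / 2"
  have c: "0 < ?c" "?c < ?g x" using nz by auto
  have V: "open (?g -` {?c<..} \<inter> U0)"
    using cg open_greaterThan[of ?c] open_unit_space by (simp only: continuous_on_open_vimage)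
  obtain W where W: "W \<in> cobs" "x \<in> W" "W \<subseteq> ?g -` {?c<..} \<inter> U0"
    using topological_basisE[OF ample V, of x] x c(2) by auto
  have WC: "W \<in> copens" using W cobD(1,2) by (auto simp: copens_def)
  have "measure M W \<noteq> 0"
    using positive_M[OF WC] W(2) by (auto simp: emeasure_eq_measure)
  then have pos: "0 < ?c * measure M W" using c(1) by (simp add: zero_less_measure_iff)
  have "?c * measure M W = (\<integral>y. ?c * indicator W y \<partial>M)" using copens_sets[OF WC] sets.sets_into_space by simp
  also have "\<dots> \<le> (\<integral>y. ?g y \<partial>M)"
  proof (rule integral_mono[OF _ ig])
    show "integrable M (\<lambda>y. ?c * indicator W y)"
      by (intro integrable_mult_right integrable_real_indicator copens_sets WC)
        (simp add: emeasure_finite less_top[symmetric])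
    fix y assume "y \<in> space M"
    show "?c * indicator W y \<le> ?g y" using W(3) by (cases "y \<in> W") auto
  qed
  also have "(\<integral>y. ?g y \<partial>M) = 0" using zero unfolding trace_star_mult[OF T] by simp
  finally show False using pos by simp
qed

lemma faithful_tracial_state_trace: "faithful_tracial_state (reduced_cstar_algebra G) trace"
  unfolding faithful_tracial_state_def tracial_state_def reduced_elems reduced_simps
proof (intro conjI ballI allI impI)
  fix T assume T: "T \<in> closure alg"
  show "trace (adjoint_op T o\<^sub>L T) \<in> \<real>\<^sub>\<ge>\<^sub>0" unfolding trace_star_mult[OF T] by simp
  show "T = 0" if "trace (adjoint_op T o\<^sub>L T) = 0" using trace_faithful[OF T that] .
qed (auto intro: trace_add trace_scale trace_id trace_commute)

end

theorem theorem5p14: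
  fixes G :: "('g::t2_space) groupoid"
  assumes "ample_groupoid G"
    and "compact (unit_space G)"
    and "minimal_groupoid G"
  shows
    "((\<exists>\<tau>. faithful_tracial_state (reduced_cstar_algebra G) \<tau>)
        \<longleftrightarrow> stably_finite (reduced_cstar_algebra G)) \<and>
     (stably_finite (reduced_cstar_algebra G)
        \<longleftrightarrow> (\<forall>A. openin (top_of_set (unit_space G)) A \<and> closedin (top_of_set (unit_space G)) A
              \<longrightarrow> completely_non_paradoxical G A)) \<and>
     ((\<forall>A. openin (top_of_set (unit_space G)) A \<and> closedin (top_of_set (unit_space G)) A
              \<longrightarrow> completely_non_paradoxical G A)
        \<longleftrightarrow> (\<exists>\<phi>. faithful_monoid_state (type_semigroup G) \<phi>
              \<and> (\<forall>x\<in>pm_elems (type_semigroup G). \<phi> x < \<infinity>)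
              \<and> \<phi> (ts_class G (unit_space G \<times> {1})) = 1))"
    (is "(?trace \<longleftrightarrow> ?fin) \<and> (?fin \<longleftrightarrow> ?para) \<and> (?para \<longleftrightarrow> ?state)")
proof -
  interpret ample_groupoid G by (rule assms)
  have 12: ?fin if ?trace using that stably_finite_if_faithful_trace assms(2) by blast
  have 23: ?para if fin: ?fin
    unfolding completely_non_paradoxical_def
  proof (intro allI impI notI)
    fix A k l
    assume A: "openin (top_of_set U0) A \<and> closedin (top_of_set U0) A" and kl: "l < k \<and> 0 < l"
      and para: "paradoxical G k l A"
    have "A \<subseteq> U0" using A openin_subset by fastforce
    moreover have "open A" using A openin_open_eq[OF open_unit_space] by blast
    moreover have "compact A" using A closedin_compact[OF assms(2)] by blast
    ultimately have "A \<in> copens" by (simp add: copens_def)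
    then obtain L where "moves L" "dsum L = indicator (U0 \<times> {..<l})" "rsum L \<le> indicator (U0 \<times> {..<l})"
        "rsum L \<noteq> indicator (U0 \<times> {..<l})"
      using paradoxical_proper_embedding[OF assms(3,2) _ para] kl by blast
    then show False using not_stably_finite_if_proper_embedding[OF assms(2)] kl fin by blast
  qed
  have 34: ?state if para: ?para
  proof (rule state_if_not_paradoxical[OF assms(3,2)])
    fix k l :: nat assume "l < k" "0 < l"
    then show "\<not> paradoxical G k l U0"
      using para unfolding completely_non_paradoxical_def by (metis closedin_topspace openin_topspace topspace_euclidean_subtopology)
  qed
  have 41: ?trace if st: ?state
  proof -
    obtain \<phi> where \<phi>: "faithful_monoid_state (type_semigroup G) \<phi>"
        "\<forall>x\<in>pm_elems (type_semigroup G). \<phi> x < \<infinity>" "\<phi> (ts_class G (U0 \<times> {1})) = 1"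
      using st by blast
    obtain \<mu> :: "'g set \<Rightarrow> ennreal" where \<mu>:
        "\<And>A B. A \<in> copens \<Longrightarrow> B \<in> copens \<Longrightarrow> A \<inter> B = {} \<Longrightarrow> \<mu> (A \<union> B) = \<mu> A + \<mu> B"
        "\<And>W. W \<in> cobs \<Longrightarrow> \<mu> (r ` W) = \<mu> (s ` W)" "\<mu> U0 = 1"
        "\<And>A. A \<in> copens \<Longrightarrow> \<mu> A = 0 \<Longrightarrow> A = {}" "\<And>A. A \<in> copens \<Longrightarrow> \<mu> A < \<infinity>" "\<mu> {} = 0"
      using invariant_content_if_state[OF \<phi>] by blast
    obtain M where M: "space M = U0" "sets M = sigma_sets U0 copens" "\<And>A. A \<in> copens \<Longrightarrow> emeasure M A = \<mu> A"
      using content_extends[of \<mu>] \<mu>(1,5,6) assms(2) by blast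
    interpret invariant_measure G M
    proof
      show "emeasure M (r ` W) = emeasure M (s ` W)" if "W \<in> cobs" for W
        using M(3) \<mu>(2) cob_rng_copen cob_src_copen that by simp
      show "emeasure M U0 = 1" using M(3) \<mu>(3) unit_space_copens assms(2) by simp
      show "A = {}" if "A \<in> copens" "emeasure M A = 0" for A using M(3) \<mu>(4) that by simp
    qed (use M assms(2) in simp_all)
    show ?thesis using faithful_tracial_state_trace by blast
  qed
  show ?thesis using 12 23 34 41 by blast
qed

end
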